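(* Let $\lambda|\mu\in\Lambda_{as}$ and $i\ge1$. Then $$\mathscr Y_i\,m_{\lambda|\mu}\in \delta_i(\lambda)\,q^{\lambda_i}t^{u_{\lambda\mu}(i)}\,m_{\lambda|\mu}+\sum_{\lambda'|\mu'\prec\lambda|\mu}\mathbb K\,m_{\lambda'|\mu'} .$$
   Context: Let $\mathbb K=\mathbb Q(t,q)$. For $k\ge1$ let $\mathcal P_k^+=\mathbb K[x_1,\dots,x_k]$, and let $\pi_k:\mathcal P_k^+\to\mathcal P_{k-1}^+$ be evaluation at $x_k=0$. Let $\mathcal P_\infty^+$ be the graded inverse limit of the $\mathcal P_k^+$ (bounded-degree formal series in $x_1,x_2,\dots$), with canonical maps $\Pi_k:\mathcal P_\infty^+\to\mathcal P_k^+$. The simple transpositions $s_i$ act on $\mathcal P_\infty^+$. Put $\mathcal P(k)^+=\{F\in\mathcal P_\infty^+ : s_iF=F \text{ for all } i>k\}$ and $\mathcal P_{as}^+=\bigcup_{k\ge0}\mathcal P(k)^+$. Limits. For $R=A/B\in\mathbb K$ with $A,B\in\mathbb Q[t,q]$, $\operatorname{ord}R$ is the order of vanishing of $A$ at $t=0$ minus that of $B$. A sequence $(a_n)$ in $\mathbb K$ converges to $a$ if $\operatorname{ord}(a_n-a)\to+\infty$. A sequence $(f_k)$, $f_k\in\mathcal P_k^+$ (starting index irrelevant), is convergent if there are $N\ge 1$ and $h_k,g_{i,k}\in\mathcal P_k^+$, $a_{i,k}\in\mathbb K$ ($1\le i\le N$) with $f_k=h_k+\sum_{i=1}^Na_{i,k}g_{i,k}$,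 $\pi_k(h_k)=h_{k-1}$, $\pi_k(g_{i,k})=g_{i,k-1}$, such that the element $g_i\in\mathcal P_\infty^+$ defined by $(g_{i,k})_k$ lies in $\mathcal P_{as}^+$ and $(a_{i,k})_k$ converges to some $a_i$. Then $\lim_kf_k:=h+\sum_i a_ig_i$, $h$ being defined by $(h_k)$; this is independent of choices. A sequence of operators $A_k$ on $\mathcal P_k^+$ has limit operator $A=\lim_kA_k$ on $\mathcal P_{as}^+$, $Af:=\lim_kA_k\Pi_kf$, if for every $f\in\mathcal P_{as}^+$ this limit exists and lies in $\mathcal P_{as}^+$. Operators. On $\mathcal P_k^+$ let $T_if=s_if+(1-t)x_i\frac{f-s_if}{x_i-x_{i+1}}$; let $\mathrm{pr}_1$ be the linear map that is the identity on monomials divisible by $x_1$ and zero on the other monomials; let $\varpi_kf=\mathrm{pr}_1 f(x_2,\dots,x_k,qx_1)$; and $\widetilde Y_i^{(k)}=t^{k+1-i}T_{i-1}\cdots T_1\varpi_kT_{k-1}^{-1}\cdots T_i^{-1}$. Then $\mathscr Y_i:=\lim_k\widetilde Y_i^{(k)}:\mathcal P_{as}^+\to\mathcal P_{as}^+$ (this limit operator is known to exist). Bruhat order. For $k\ge1$ the affine symmetric group $\widetilde S_k$ (a Coxeter group with generators $s_0,s_1,\dots,s_{k-1}$) acts on $\mathbb Z^k$: $s_i$ ($1\le i\le k-1$) swaps coordinates $i,i+1$, and $s_0(x_1,\dots,x_k)=(x_k+1,x_2,\dots,x_{k-1},x_1-1)$. Each orbit contains a unique $\tilde\lambda$ with $\tilde\lambda_1\ge\dots\ge\tilde\lambda_k\ge\tilde\lambda_1-1$;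 let $w_\lambda\in\widetilde S_k$ be the minimal length element with $w_\lambda(\tilde\lambda)=\lambda$. For $\lambda,\mu\in\mathbb Z^k$, $\lambda\le\mu$ means that they lie in the same $\widetilde S_k$-orbit and $w_\lambda\le w_\mu$ in the Bruhat order of $\widetilde S_k$. Let $\Lambda_k=\mathbb Z_{\ge0}^k$ and let $\Lambda$ be the inductive limit of the $\Lambda_k$ along appending a zero; the orders on the $\Lambda_k$ are compatible and define an order $\le$ on $\Lambda$. Compositions are finite sequences of non-negative integers; $\ell(\lambda)$ denotes the number of terms. A strict composition is one that is empty or has non-zero last term; a partition is a finite weakly decreasing sequence of positive integers. $\Lambda_{as}$ is the set of pairs $\lambda|\mu$ with $\lambda$ a strict composition and $\mu$ a partition. Concatenation is denoted by juxtaposition $\lambda\mu$, and $0^n$ is a sequence of $n$ zeros. The partial order on $\Lambda_{as}$: $\lambda|\mu\preceq\eta|\nu$ if $\ell(\lambda)\le\ell(\eta)$ and $\lambda0^{\ell(\eta)-\ell(\lambda)}\mu\le\eta\nu$ in $\Lambda$. For $\lambda|\mu\in\Lambda_{as}$, $m_{\lambda|\mu}=x^\lambda\, m_\mu[\mathbf X_{\ell(\lambda)}]$, where $x^\lambda=\prod_i x_i^{\lambda_i}$ and $m_\mu[\mathbf X_n]$ is the monomial symmetric function in the variables $x_{n+1},x_{n+2},\dots$. For $\lambda\in\Lambda_k$ and $1\le i\le k$, $u_\lambda(i)=|\{1\le j\le i:\lambda_j>\lambda_i\}|+|\{i\le j\le k:\lambda_j\ge\lambda_i\}|$. Also $\delta_i(\lambda)=1$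 if $i\le\ell(\lambda)$ and $\lambda_i>0$, and $\delta_i(\lambda)=0$ otherwise (in which case the corresponding term is $0$). *)

theory Defs
  imports
    Complex_Main
    "HOL-Library.Poly_Mapping"
    "HOL-Library.Extended_Real"
    "HOL-Combinatorics.Transposition"
    "HOL-Computational_Algebra.Polynomial"
    "HOL-Computational_Algebra.Fraction_Field"
begin

section \<open>The field \<open>\<rat>(t,q)\<close> and its $t$-adic order\<close>

text \<open>The fraction field of \<open>\<rat>[q][t]\<close>: \<open>t\<close> is the outer and \<open>q\<close> the inner
  polynomial variable, so that the order of vanishing of \<open>A\<close> at \<open>t = 0\<close> is \<open>order 0 A\<close>.\<close>

type_synonym K = "rat poly poly fract"

definition tK :: K where "tK = Fract [:0, 1:] 1"

definition qK :: K where "qK = Fract [:[:0, 1:]:] 1"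

definition ordK :: "K \<Rightarrow> ereal" where
  "ordK R = (if R = 0 then \<infinity> else
     (THE v. \<exists>A B. A \<noteq> 0 \<and> B \<noteq> 0 \<and> R = Fract A B \<and>
        v = ereal (real (order 0 A) - real (order 0 B))))"

definition K_converges :: "(nat \<Rightarrow> K) \<Rightarrow> K \<Rightarrow> bool" where
  "K_converges a l \<longleftrightarrow> ((\<lambda>n. ordK (a n - l)) \<longlongrightarrow> \<infinity>) sequentially"

section \<open>Polynomials and formal series\<close>

text \<open>Monomials are exponent vectors; the variables are \<open>x\<^sub>1, x\<^sub>2, \<dots>\<close>, so index \<open>0\<close> is never
  used.  A formal series is the function of its coefficients.\<close>

type_synonym mon = "nat \<Rightarrow>\<^sub>0 nat"
type_synonym pol = "mon \<Rightarrow>\<^sub>0 K"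
type_synonym ser = "mon \<Rightarrow> K"

definition mdeg :: "mon \<Rightarrow> nat" where
  "mdeg m = (\<Sum>i\<in>Poly_Mapping.keys m. Poly_Mapping.lookup m i)"

definition var :: "nat \<Rightarrow> pol" where
  "var i = Poly_Mapping.single (Poly_Mapping.single i 1) 1"

definition cst :: "K \<Rightarrow> pol" where
  "cst c = Poly_Mapping.single 0 c"

definition pol_subst :: "(nat \<Rightarrow> pol) \<Rightarrow> pol \<Rightarrow> pol" where
  "pol_subst \<sigma> f = (\<Sum>m\<in>Poly_Mapping.keys f. cst (Poly_Mapping.lookup f m) * (\<Prod>i\<in>Poly_Mapping.keys m. \<sigma> i ^ Poly_Mapping.lookup m i))"

definition Pol :: "nat \<Rightarrow> pol set" where
  "Pol k = {f. \<forall>m\<in>Poly_Mapping.keys f. Poly_Mapping.keys m \<subseteq> {1..k}}"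

definition proj :: "nat \<Rightarrow> pol \<Rightarrow> pol" where
  "proj k = pol_subst (\<lambda>i. if i = k then 0 else var i)"

definition P_inf :: "ser set" where
  "P_inf = {F. \<exists>d. \<forall>m. F m \<noteq> 0 \<longrightarrow> Poly_Mapping.keys m \<subseteq> {1..} \<and> mdeg m \<le> d}"

definition Proj :: "nat \<Rightarrow> ser \<Rightarrow> pol" where
  "Proj k F = Abs_poly_mapping (\<lambda>m. if Poly_Mapping.keys m \<subseteq> {1..k} then F m else 0)"

definition s_ser :: "nat \<Rightarrow> ser \<Rightarrow> ser" where
  "s_ser i F = (\<lambda>m. F (Poly_Mapping.map_key (transpose i (Suc i)) m))"

definition P_sym :: "nat \<Rightarrow> ser set" where
  "P_sym k = {F \<in> P_inf. \<forall>i>k. s_ser i F = F}"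

definition P_as :: "ser set" where
  "P_as = (\<Union>k. P_sym k)"

section \<open>Limits\<close>

text \<open>\<open>represents k\<^sub>0 h H\<close>: the compatible sequence \<open>(h\<^sub>k)\<close>, \<open>k \<ge> k\<^sub>0\<close>, defines the element \<open>H\<close>
  of the graded inverse limit.\<close>

definition represents :: "nat \<Rightarrow> (nat \<Rightarrow> pol) \<Rightarrow> ser \<Rightarrow> bool" where
  "represents k0 h H \<longleftrightarrow>
     (\<forall>k\<ge>k0. h k \<in> Pol k) \<and> (\<forall>k>k0. proj k (h k) = h (k - 1)) \<and>
     H \<in> P_inf \<and> (\<forall>k\<ge>k0. Proj k H = h k)"

definition has_limit :: "(nat \<Rightarrow> pol) \<Rightarrow> ser \<Rightarrow> bool" where
  "has_limit f F \<longleftrightarrow>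
     (\<exists>k0 N h g a H G l. N \<ge> (1::nat) \<and>
        (\<forall>k\<ge>k0. f k = h k + (\<Sum>i=1..N. cst (a i k) * g i k)) \<and>
        represents k0 h H \<and>
        (\<forall>i\<in>{1..N}. represents k0 (g i) (G i) \<and> G i \<in> P_as \<and> K_converges (a i) (l i)) \<and>
        F = (\<lambda>m. H m + (\<Sum>i=1..N. l i * G i m)))"

definition limit_operator :: "(nat \<Rightarrow> pol \<Rightarrow> pol) \<Rightarrow> ser \<Rightarrow> ser" where
  "limit_operator A f = (THE F. has_limit (\<lambda>k. A k (Proj k f)) F)"

section \<open>The operators\<close>

definition s_pol :: "nat \<Rightarrow> pol \<Rightarrow> pol" where
  "s_pol i = pol_subst (\<lambda>j. var (transpose i (Suc i) j))"

definition T_op :: "nat \<Rightarrow> pol \<Rightarrow> pol" where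
  "T_op i f = s_pol i f +
     cst (1 - tK) * var i * (THE g. (var i - var (Suc i)) * g = f - s_pol i f)"

definition pr1 :: "pol \<Rightarrow> pol" where
  "pr1 f = (\<Sum>m\<in>Poly_Mapping.keys f. if 1 \<in> Poly_Mapping.keys m then Poly_Mapping.single m (Poly_Mapping.lookup f m) else 0)"

definition varpi :: "nat \<Rightarrow> pol \<Rightarrow> pol" where
  "varpi k f = pr1 (pol_subst (\<lambda>i. if i = k then cst qK * var 1 else var (Suc i)) f)"

text \<open>\<open>fold\<close> applies the operator of the head of the list first: the innermost factor below is
  the inverse of \<open>T_op i\<close>, the outermost one is \<open>T_op (i - 1)\<close>.\<close>

definition Y_fin :: "nat \<Rightarrow> nat \<Rightarrow> pol \<Rightarrow> pol" where
  "Y_fin i k f = cst (tK ^ (k + 1 - i)) *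
     fold T_op [1..<i] (varpi k (fold (\<lambda>j. inv_into (Pol k) (T_op j)) [i..<k] f))"

definition Y_op :: "nat \<Rightarrow> ser \<Rightarrow> ser" where
  "Y_op i = limit_operator (Y_fin i)"

section \<open>The affine symmetric group and its Bruhat order\<close>

text \<open>\<open>\<int>\<^sup>k\<close> is embedded in \<open>nat \<Rightarrow> int\<close> as coordinates \<open>1, \<dots>, k\<close>; the remaining coordinates
  are left unchanged.  The action on \<open>\<int>\<^sup>k\<close> is faithful, so the group is realised by these
  transformations.  For \<open>k = 1\<close> the group is trivial.\<close>

type_synonym vec = "nat \<Rightarrow> int"

definition aff_gen :: "nat \<Rightarrow> nat \<Rightarrow> vec \<Rightarrow> vec" where
  "aff_gen k i x =
     (if k < 2 then x
      else if i = 0 then x(1 := x k + 1, k := x 1 - 1)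
      else x \<circ> transpose i (Suc i))"

definition aff_word :: "nat \<Rightarrow> nat list \<Rightarrow> vec \<Rightarrow> vec" where
  "aff_word k is = foldr (\<lambda>i w. aff_gen k i \<circ> w) is id"

definition aff_group :: "nat \<Rightarrow> (vec \<Rightarrow> vec) set" where
  "aff_group k = {aff_word k is | is. set is \<subseteq> {0..<k}}"

definition aff_length :: "nat \<Rightarrow> (vec \<Rightarrow> vec) \<Rightarrow> nat" where
  "aff_length k w = (LEAST n. \<exists>is. set is \<subseteq> {0..<k} \<and> length is = n \<and> aff_word k is = w)"

definition aff_reflections :: "nat \<Rightarrow> (vec \<Rightarrow> vec) set" where
  "aff_reflections k = {w \<circ> aff_gen k i \<circ> inv w | w i. w \<in> aff_group k \<and> i < k}"

definition bruhat_step :: "nat \<Rightarrow> (vec \<Rightarrow> vec) \<Rightarrow> (vec \<Rightarrow> vec) \<Rightarrow> bool" where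
  "bruhat_step k v w \<longleftrightarrow> v \<in> aff_group k \<and> w \<in> aff_group k \<and>
     (\<exists>r\<in>aff_reflections k. w = v \<circ> r) \<and> aff_length k v < aff_length k w"

definition bruhat_le :: "nat \<Rightarrow> (vec \<Rightarrow> vec) \<Rightarrow> (vec \<Rightarrow> vec) \<Rightarrow> bool" where
  "bruhat_le k = (bruhat_step k)\<^sup>*\<^sup>*"

definition orbit :: "nat \<Rightarrow> vec \<Rightarrow> vec set" where
  "orbit k x = {w x | w. w \<in> aff_group k}"

definition vec_dom :: "nat \<Rightarrow> vec \<Rightarrow> vec" where
  "vec_dom k x = (THE y. y \<in> orbit k x \<and> (\<forall>j. 1 \<le> j \<and> j < k \<longrightarrow> y j \<ge> y (Suc j)) \<and>
     y k \<ge> y 1 - 1)"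

definition min_elt :: "nat \<Rightarrow> vec \<Rightarrow> vec \<Rightarrow> vec" where
  "min_elt k x = arg_min (aff_length k) (\<lambda>w. w \<in> aff_group k \<and> w (vec_dom k x) = x)"

definition vec_le :: "nat \<Rightarrow> vec \<Rightarrow> vec \<Rightarrow> bool" where
  "vec_le k x y \<longleftrightarrow> x \<in> orbit k y \<and> bruhat_le k (min_elt k x) (min_elt k y)"

section \<open>Compositions\<close>

text \<open>\<open>coord xs j\<close> is the \<open>j\<close>-th term of \<open>xs\<close>, counted from \<open>1\<close>, and \<open>0\<close> beyond the end.
  Thus \<open>coord\<close> identifies compositions that differ by trailing zeros.\<close>

definition coord :: "nat list \<Rightarrow> nat \<Rightarrow> nat" where
  "coord xs j = (if 1 \<le> j \<and> j \<le> length xs then xs ! (j - 1) else 0)"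

definition vec_of :: "nat list \<Rightarrow> vec" where
  "vec_of xs = (\<lambda>j. int (coord xs j))"

definition comp_le :: "nat list \<Rightarrow> nat list \<Rightarrow> bool" where
  "comp_le xs ys \<longleftrightarrow>
     (\<exists>k\<ge>1. length xs \<le> k \<and> length ys \<le> k \<and> vec_le k (vec_of xs) (vec_of ys))"

definition strict_comp :: "nat list \<Rightarrow> bool" where
  "strict_comp xs \<longleftrightarrow> xs = [] \<or> last xs \<noteq> 0"

definition is_partition :: "nat list \<Rightarrow> bool" where
  "is_partition xs \<longleftrightarrow> sorted_wrt (\<ge>) xs \<and> 0 \<notin> set xs"

definition Lambda_as :: "(nat list \<times> nat list) set" where
  "Lambda_as = {(lam, mu). strict_comp lam \<and> is_partition mu}"

fun as_le :: "nat list \<times> nat list \<Rightarrow> nat list \<times> nat list \<Rightarrow> bool" where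
  "as_le (lam, mu) (eta, nu) \<longleftrightarrow> length lam \<le> length eta \<and>
     comp_le (lam @ replicate (length eta - length lam) 0 @ mu) (eta @ nu)"

definition as_less :: "nat list \<times> nat list \<Rightarrow> nat list \<times> nat list \<Rightarrow> bool" where
  "as_less p r \<longleftrightarrow> as_le p r \<and> p \<noteq> r"

text \<open>The monomial symmetric function in the variables \<open>x\<^bsub>n+1\<^esub>, x\<^bsub>n+2\<^esub>, \<dots>\<close>.\<close>

definition m_sym :: "nat list \<Rightarrow> nat \<Rightarrow> ser" where
  "m_sym mu n = (\<lambda>m. if Poly_Mapping.keys m \<subseteq> {n<..} \<and> image_mset (Poly_Mapping.lookup m) (mset_set (Poly_Mapping.keys m)) = mset mu
     then 1 else 0)"

text \<open>Multiplication of a series by the monomial with exponent vector \<open>a\<close>.\<close>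

definition mon_mult :: "mon \<Rightarrow> ser \<Rightarrow> ser" where
  "mon_mult a F = (\<lambda>m. if \<exists>b. m = a + b then F (m - a) else 0)"

fun m_as :: "nat list \<times> nat list \<Rightarrow> ser" where
  "m_as (lam, mu) = mon_mult (Abs_poly_mapping (coord lam)) (m_sym mu (length lam))"

definition u_stat :: "nat list \<Rightarrow> nat \<Rightarrow> nat" where
  "u_stat xs i = card {j. 1 \<le> j \<and> j \<le> i \<and> coord xs j > coord xs i} +
            card {j. i \<le> j \<and> j \<le> length xs \<and> coord xs j \<ge> coord xs i}"

definition delta :: "nat \<Rightarrow> nat list \<Rightarrow> K" where
  "delta i lam = (if i \<le> length lam \<and> coord lam i > 0 then 1 else 0)"

definition K_span :: "ser set \<Rightarrow> ser set" where
  "K_span B = {(\<lambda>m. \<Sum>G\<in>S. c G * G m) | S c. finite S \<and> S \<subseteq> B}"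

end

theory Submission
  imports Defs
begin

text \<open>
  The theorem is a limit of a triangularity statement in finitely many variables.

  Finitely many variables.  On monomials \<open>T\<^sub>j\<close> and \<open>t T\<^sub>j\<^sup>-\<^sup>1\<close> only redistribute the exponents at
  \<open>j\<close> and \<open>j + 1\<close>, with explicit weights.  In the product defining the \<open>i\<close>-th operator one entry travels
  from position \<open>i\<close> to the right end, is moved to the front by the cyclic shift (which supplies
  \<open>q\<^sup>e\<close>, \<open>e\<close> being its value, or kills it if \<open>e = 0\<close>), and travels back to \<open>i\<close>.  If the travelling
  entry is always put back into position \<open>i\<close> before comparing, each factor either keeps the
  monomial or moves two entries closer together, or exchanges them so that the larger one comes
  first (\<open>triangular_step\<close>); the powers of \<open>t\<close> collected by the unchanged monomial give the
  exponent \<open>u\<close> (\<open>Y_ser_triangular\<close>).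

  Bruhat order.  Such a move is a reflection in an affine root that is negative at the vector.  By the
  strong exchange property it shortens the group element that leads to the vector, and passing to
  minimal coset representatives preserves the comparison (\<open>reflect_vec_le\<close>).  Hence it suffices to
  work with chains of moves, for which strictness is visible from a potential (\<open>lower_pot_less\<close>) and
  sorting adjacent entries is monotone (\<open>lek_sort_at\<close>).

  The limit.  Let \<open>f\<close> be symmetric beyond \<open>x\<^sub>L\<close>.  By the braid relations the images of its truncations
  are symmetric beyond \<open>x\<^bsub>max i L\<^esub>\<close> (\<open>s_pol_Y_fin\<close>), and each coefficient converges, because from some
  \<open>k\<close> on it is of the form \<open>a + b t\<^sup>k\<close> (\<open>varpi_ser_converges\<close>).  Symmetry and bounded degree
  make finitely many coefficients, those at monomials with sorted tail, determine the truncations;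
  this gives existence of the limit and its expansion (\<open>has_limit_symmetric\<close>).  If \<open>i\<close> exceeds the
  length of \<open>\<lambda>\<close>, a power of \<open>t\<close> survives and the limit is \<open>0\<close>.  Otherwise a coefficient that
  does not tend to \<open>0\<close> belongs to a monomial below one of the truncated basis element, and sorting the tail
  of the latter shows that it is below \<open>\<lambda>\<mu>\<close>.  The expansion obtained in this way is indexed by
  compositions of fixed length that may end in zeros; removing the zeros only adds smaller terms
  (\<open>m_as_in_span\<close>).
\<close>

abbreviation "lookup \<equiv> Poly_Mapping.lookup"
abbreviation "keys \<equiv> Poly_Mapping.keys"
abbreviation "single \<equiv> Poly_Mapping.single"

section \<open>Roots and reflections of the affine symmetric group\<close>

text \<open>The affine root \<open>(i, j, n)\<close> is the affine functional \<open>x\<^sub>i - x\<^sub>j + n\<close>.  The positive roots are those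
  that take non-negative values on the vectors singled out as orbit representatives.\<close>

type_synonym root = "nat \<times> nat \<times> int"

fun root_eval :: "root \<Rightarrow> vec \<Rightarrow> int" where
  "root_eval (i, j, n) x = x i - x j + n"

fun reflect :: "root \<Rightarrow> vec \<Rightarrow> vec" where
  "reflect (i, j, n) x = x(i := x j - n, j := x i + n)"

fun root_pos :: "root \<Rightarrow> bool" where
  "root_pos (i, j, n) \<longleftrightarrow> n > 0 \<or> n = 0 \<and> i < j"

fun root_neg :: "root \<Rightarrow> root" where
  "root_neg (i, j, n) = (j, i, - n)"

definition roots :: "nat \<Rightarrow> root set" where
  "roots k = {(i, j, n). i \<in> {1..k} \<and> j \<in> {1..k} \<and> i \<noteq> j}"

definition simple_root :: "nat \<Rightarrow> nat \<Rightarrow> root" where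
  "simple_root k p = (if p = 0 then (k, 1, 1) else (p, Suc p, 0))"

text \<open>The wrap-around generator exchanges the coordinates \<open>1\<close> and \<open>k\<close> and shifts them, which
  changes the constant of a root by one for each end of the root that lies on \<open>1\<close> or \<open>k\<close>.\<close>

fun gen_root :: "nat \<Rightarrow> nat \<Rightarrow> root \<Rightarrow> root" where
  "gen_root k p (i, j, n) =
     (if p = 0 then (transpose 1 k i, transpose 1 k j,
        n + (if i = 1 then 1 else if i = k then - 1 else 0)
          - (if j = 1 then 1 else if j = k then - 1 else 0))
      else (transpose p (Suc p) i, transpose p (Suc p) j, n))"

definition word_root :: "nat \<Rightarrow> nat list \<Rightarrow> root \<Rightarrow> root" where
  "word_root k = fold (gen_root k)"

lemma word_root_simps [simp]:
  "word_root k [] b = b"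
  "word_root k (p # ps) b = word_root k ps (gen_root k p b)"
  "word_root k (ps @ qs) b = word_root k qs (word_root k ps b)"
  by (simp_all add: word_root_def)

lemma aff_word_simps [simp]:
  "aff_word k [] = id"
  "aff_word k (p # ps) = aff_gen k p \<circ> aff_word k ps"
  by (simp_all add: aff_word_def)

lemma aff_word_append [simp]: "aff_word k (ps @ qs) = aff_word k ps \<circ> aff_word k qs"
  by (induction ps) (simp_all add: comp_assoc)

lemma aff_gen_involution:
  assumes "k \<ge> 2" "p < k" shows "aff_gen k p (aff_gen k p x) = x"
  using assms by (auto simp: aff_gen_def fun_eq_iff transpose_def)

lemma aff_word_rev:
  assumes "k \<ge> 2" "set ps \<subseteq> {0..<k}"
  shows "aff_word k (rev ps) (aff_word k ps x) = x"
  using assms by (induction ps arbitrary: x) (simp_all add: aff_gen_involution)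

lemma aff_word_rev':
  assumes "k \<ge> 2" "set ps \<subseteq> {0..<k}"
  shows "aff_word k ps (aff_word k (rev ps) x) = x"
  using aff_word_rev[of k "rev ps" x] assms by simp

lemma inv_aff_word:
  assumes "k \<ge> 2" "set ps \<subseteq> {0..<k}"
  shows "inv (aff_word k ps) = aff_word k (rev ps)"
  by (rule inv_unique_comp) (auto simp: fun_eq_iff aff_word_rev[OF assms] aff_word_rev'[OF assms])

lemma gen_root_mem:
  assumes "k \<ge> 2" "p < k" "b \<in> roots k" shows "gen_root k p b \<in> roots k"
  using assms by (cases b) (auto simp: roots_def transpose_def)

lemma word_root_mem:
  assumes "k \<ge> 2" "set ps \<subseteq> {0..<k}" "b \<in> roots k" shows "word_root k ps b \<in> roots k"
  using assms by (induction ps arbitrary: b) (simp_all add: gen_root_mem)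

lemma gen_root_neg: "k \<ge> 2 \<Longrightarrow> gen_root k p (root_neg b) = root_neg (gen_root k p b)"
  by (cases b) auto

lemma word_root_neg: "k \<ge> 2 \<Longrightarrow> word_root k ps (root_neg b) = root_neg (word_root k ps b)"
  by (induction ps arbitrary: b) (simp_all add: gen_root_neg)

lemma gen_root_eval:
  assumes "k \<ge> 2" "p < k"
  shows "root_eval (gen_root k p b) x = root_eval b (aff_gen k p x)"
  using assms by (cases b) (auto simp: aff_gen_def transpose_def)

lemma word_root_eval:
  assumes "k \<ge> 2" "set ps \<subseteq> {0..<k}"
  shows "root_eval (word_root k ps b) x = root_eval b (aff_word k ps x)"
  using assms by (induction ps arbitrary: b x) (simp_all add: gen_root_eval)

lemma root_eval_inject:
  assumes "b \<in> roots k" "c \<in> roots k" "\<And>x. root_eval b x = root_eval c x"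
  shows "b = c"
proof -
  obtain i j n where b: "b = (i, j, n)" by (cases b)
  obtain i' j' n' where c: "c = (i', j', n')" by (cases c)
  have ij: "i \<noteq> j" "i' \<noteq> j'" using assms(1,2) by (auto simp: roots_def b c)
  have n: "n = n'" using assms(3)[of "\<lambda>_. 0"] by (simp add: b c)
  have "i = i'" using assms(3)[of "\<lambda>r. if r = i then 1 else 0"] n ij
    by (auto simp: b c split: if_splits)
  moreover have "j = j'" using assms(3)[of "\<lambda>r. if r = j then 1 else 0"] n ij
    by (auto simp: b c split: if_splits)
  ultimately show ?thesis using n by (simp add: b c)
qed

lemma word_root_cong:
  assumes "k \<ge> 2" "set ps \<subseteq> {0..<k}" "set qs \<subseteq> {0..<k}" "b \<in> roots k"
    and "aff_word k ps = aff_word k qs"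
  shows "word_root k ps b = word_root k qs b"
  by (rule root_eval_inject[of _ k]) (simp_all add: assms word_root_mem word_root_eval)

lemma root_pos_or_neg: "b \<in> roots k \<Longrightarrow> root_pos (root_neg b) \<longleftrightarrow> \<not> root_pos b"
  by (cases b) (auto simp: roots_def)

lemma root_neg_neg [simp]: "root_neg (root_neg b) = b"
  by (cases b) simp

lemma root_neg_mem: "b \<in> roots k \<Longrightarrow> root_neg b \<in> roots k"
  by (cases b) (auto simp: roots_def)

lemma simple_root_facts:
  assumes "k \<ge> 2" "p < k"
  shows "simple_root k p \<in> roots k" "root_pos (simple_root k p)"
    "gen_root k p (simple_root k p) = root_neg (simple_root k p)"
    "reflect (simple_root k p) = aff_gen k p"
  using assms by (auto simp: simple_root_def roots_def aff_gen_def fun_eq_iff transpose_def)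

lemma gen_root_pos:
  assumes "k \<ge> 2" "p < k" "b \<in> roots k" "root_pos b" "\<not> root_pos (gen_root k p b)"
  shows "b = simple_root k p"
proof (cases "p = 0")
  case True
  obtain i j n where b: "b = (i, j, n)" by (cases b)
  show ?thesis
    using assms True unfolding b roots_def
    by (auto simp: simple_root_def transpose_def split: if_splits)
next
  case False
  then show ?thesis
    using assms by (cases b) (auto simp: simple_root_def roots_def transpose_def split: if_splits)
qed

lemma reflect_conj:
  assumes "k \<ge> 2" "p < k" "b \<in> roots k"
  shows "reflect b (aff_gen k p x) = aff_gen k p (reflect (gen_root k p b) x)"
proof -
  obtain i j n where b: "b = (i, j, n)" by (cases b)
  have ij: "i \<noteq> j" using assms(3) by (auto simp: roots_def b)
  show ?thesis
  proof (cases "p = 0")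
    case True
    have k: "k \<noteq> 1" "\<not> k < 2" using assms(1) by auto
    consider "i = 1" "j = k" | "i = k" "j = 1" | "i = 1" "j \<noteq> k" | "i = k" "j \<noteq> 1"
      | "j = 1" "i \<noteq> k" | "j = k" "i \<noteq> 1" | "i \<notin> {1, k}" "j \<notin> {1, k}"
      by auto
    then show ?thesis
      by cases (use True k ij in \<open>simp_all add: b aff_gen_def fun_eq_iff del: One_nat_def\<close>)
  next
    case False
    have inj: "transpose p (Suc p) u = transpose p (Suc p) v \<longleftrightarrow> u = v" for u v
      by (metis transpose_involutory)
    have "reflect b (x \<circ> transpose p (Suc p)) r =
      reflect (transpose p (Suc p) i, transpose p (Suc p) j, n) x (transpose p (Suc p) r)" for r
      by (cases "r = j"; cases "r = i") (simp_all add: b ij inj)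
    then show ?thesis using False assms(1) by (simp add: b aff_gen_def fun_eq_iff)
  qed
qed

text \<open>Strong exchange.  A word moves the fundamental chamber through a gallery; a positive root that is
  negative at the end changes sign at some step, and a generator changes the sign of only one
  positive root, so the reflection is a conjugate of that generator and deletes it.\<close>

lemma exchange:
  assumes "k \<ge> 2" "set ps \<subseteq> {0..<k}" "b \<in> roots k" "root_pos b" "\<not> root_pos (word_root k ps b)"
  shows "\<exists>us p vs. ps = us @ p # vs \<and> reflect b = aff_word k (us @ p # rev us)"
  using assms(2-5)
proof (induction ps arbitrary: b)
  case Nil
  then show ?case by simp
next
  case (Cons p ps)
  have p: "p < k" "set ps \<subseteq> {0..<k}" using Cons.prems by auto
  show ?case
  proof (cases "root_pos (gen_root k p b)")
    case True
    have "\<not> root_pos (word_root k ps (gen_root k p b))" using Cons.prems(4) by simp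
    note IH = Cons.IH[OF p(2) gen_root_mem[OF assms(1) p(1) Cons.prems(2)] True this]
    obtain us r vs where u: "ps = us @ r # vs"
      "reflect (gen_root k p b) = aff_word k (us @ r # rev us)"
      using IH by blast
    have "reflect b x = aff_word k ((p # us) @ r # rev (p # us)) x" for x
    proof -
      have "reflect b x = reflect b (aff_gen k p (aff_gen k p x))"
        using aff_gen_involution[OF assms(1) p(1)] by simp
      also have "\<dots> = aff_gen k p (reflect (gen_root k p b) (aff_gen k p x))"
        by (rule reflect_conj) (use assms(1) p Cons.prems in auto)
      finally show ?thesis using u(2) by simp
    qed
    then have "reflect b = aff_word k ((p # us) @ r # rev (p # us))" by blast
    moreover have "p # ps = (p # us) @ r # vs" using u(1) by simp
    ultimately show ?thesis by (intro exI[of _ "p # us"] exI[of _ r] exI[of _ vs] conjI)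
  next
    case False
    then have "b = simple_root k p" using gen_root_pos[of k p b] Cons.prems p assms(1) by auto
    then have "reflect b = aff_word k ([] @ p # rev [])"
      using simple_root_facts(4)[OF assms(1) p(1)] by simp
    then show ?thesis by (metis append_Nil)
  qed
qed

lemma exchange_delete:
  assumes "k \<ge> 2" "set ps \<subseteq> {0..<k}" "b \<in> roots k" "root_pos b" "\<not> root_pos (word_root k ps b)"
  shows "\<exists>qs. set qs \<subseteq> {0..<k} \<and> length qs < length ps \<and> reflect b \<circ> aff_word k ps = aff_word k qs"
proof -
  obtain us p vs where u: "ps = us @ p # vs" "reflect b = aff_word k (us @ p # rev us)"
    using exchange[OF assms] by blast
  have us: "set us \<subseteq> {0..<k}" "p < k" using u assms(2) by auto
  have "reflect b (aff_word k ps x) = aff_word k (us @ vs) x" for x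
    using us u by (simp add: aff_word_rev[OF assms(1)] aff_gen_involution[OF assms(1)])
  then have "reflect b \<circ> aff_word k ps = aff_word k (us @ vs)" by auto
  moreover have "set (us @ vs) \<subseteq> {0..<k}" "length (us @ vs) < length ps" using u assms(2) by auto
  ultimately show ?thesis by blast
qed

text \<open>A group element that preserves the fundamental chamber is trivial: otherwise the first letter
  of a word could always be cancelled against a later one.\<close>

lemma pos_word_trivial:
  assumes "k \<ge> 2" "set ps \<subseteq> {0..<k}"
    and "\<And>b. b \<in> roots k \<Longrightarrow> root_pos b \<Longrightarrow> root_pos (word_root k ps b)"
  shows "aff_word k ps = id"
  using assms(2,3)
proof (induction "length ps" arbitrary: ps rule: less_induct)
  case less
  show ?case
  proof (cases ps)
    case Nil
    then show ?thesis by simp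
  next
    case (Cons p rs)
    have p: "p < k" "set rs \<subseteq> {0..<k}" using less.prems Cons by auto
    let ?b = "simple_root k p"
    note b = simple_root_facts[OF assms(1) p(1)]
    have "root_pos (word_root k ps ?b)" using less.prems b by auto
    then have "root_pos (root_neg (word_root k rs ?b))"
      using Cons b word_root_neg[OF assms(1)] by simp
    then have "\<not> root_pos (word_root k rs ?b)"
      using root_pos_or_neg word_root_mem[OF assms(1) p(2) b(1)] by blast
    then obtain qs where qs: "set qs \<subseteq> {0..<k}" "length qs < length rs"
      "reflect ?b \<circ> aff_word k rs = aff_word k qs"
      using exchange_delete[OF assms(1) p(2) b(1,2)] by blast
    have e: "aff_word k ps = aff_word k qs" using qs(3) b(4) Cons by simp
    have "aff_word k qs = id"
    proof (rule less.hyps)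
      show "length qs < length ps" using qs Cons by simp
      show "set qs \<subseteq> {0..<k}" by fact
      show "root_pos (word_root k qs c)" if "c \<in> roots k" "root_pos c" for c
        using word_root_cong[OF assms(1) less.prems(1) qs(1) that(1) e] less.prems(2)[OF that] by simp
    qed
    then show ?thesis using e by simp
  qed
qed

section \<open>Dominant representatives\<close>

definition dominant :: "nat \<Rightarrow> vec \<Rightarrow> bool" where
  "dominant k y \<longleftrightarrow> (\<forall>j. 1 \<le> j \<and> j < k \<longrightarrow> y j \<ge> y (Suc j)) \<and> y k \<ge> y 1 - 1"

lemma dominant_antimono:
  assumes "dominant k y" "1 \<le> i" "i \<le> j" "j \<le> k" shows "y j \<le> y i"
  using assms(3,4)
proof (induction j rule: dec_induct)
  case (step n)
  then have "y (Suc n) \<le> y n" using assms(1,2) by (simp add: dominant_def)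
  then show ?case using step by simp
qed simp

lemma dominant_root_nonneg:
  assumes "dominant k y" "b \<in> roots k" "root_pos b" shows "root_eval b y \<ge> 0"
proof -
  obtain i j n where b: "b = (i, j, n)" by (cases b)
  have ij: "1 \<le> i" "i \<le> k" "1 \<le> j" "j \<le> k" using assms(2) by (auto simp: b roots_def)
  have "y k \<le> y i" "y j \<le> y 1" "y k \<ge> y 1 - 1"
    using dominant_antimono[OF assms(1)] ij assms(1) by (auto simp: dominant_def)
  moreover have "i < j \<Longrightarrow> y j \<le> y i" using dominant_antimono[OF assms(1)] ij by simp
  ultimately show ?thesis using assms(3) by (auto simp: b)
qed

lemma sum_upd2:
  fixes f :: "nat \<Rightarrow> int \<Rightarrow> int"
  assumes "finite A" "i \<in> A" "j \<in> A" "i \<noteq> j"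
  shows "(\<Sum>r\<in>A. f r ((x(i := c, j := d)) r)) = (\<Sum>r\<in>A. f r (x r)) - f i (x i) - f j (x j) + f i c + f j d"
proof -
  have "(\<Sum>r\<in>A. f r (z r)) = f i (z i) + (f j (z j) + (\<Sum>r\<in>A - {i} - {j}. f r (z r)))" for z
    using assms by (simp add: sum.remove[of A i] sum.remove[of "A - {i}" j])
  note e = this
  have "(\<Sum>r\<in>A - {i} - {j}. f r ((x(i := c, j := d)) r)) = (\<Sum>r\<in>A - {i} - {j}. f r (x r))"
    by (rule sum.cong) auto
  then show ?thesis using e[of "x(i := c, j := d)"] e[of x] assms(4) by simp
qed

lemma aff_gen_cases:
  assumes "k \<ge> 2" "p < k"
  obtains "p = 0" "aff_gen k p x = x(1 := x k + 1, k := x 1 - 1)"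
    | "1 \<le> p" "aff_gen k p x = x(p := x (Suc p), Suc p := x p)"
  using assms by (cases "p = 0") (auto simp: aff_gen_def fun_eq_iff transpose_def)

lemma aff_gen_sum:
  assumes "k \<ge> 2" "p < k" shows "(\<Sum>r=1..k. aff_gen k p x r) = (\<Sum>r=1..k. x r)"
proof (cases rule: aff_gen_cases[OF assms, where x = x])
  case 1
  then show ?thesis using sum_upd2[of "{1..k}" 1 k "\<lambda>_ z. z"] assms by simp
next
  case 2
  then show ?thesis using sum_upd2[of "{1..k}" p "Suc p" "\<lambda>_ z. z"] assms by simp
qed

lemma aff_group_sum:
  assumes "k \<ge> 2" "w \<in> aff_group k" shows "(\<Sum>r=1..k. w x r) = (\<Sum>r=1..k. x r)"
proof -
  obtain ps where ps: "w = aff_word k ps" "set ps \<subseteq> {0..<k}"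
    using assms(2) by (auto simp: aff_group_def)
  have "(\<Sum>r=1..k. aff_word k ps x r) = (\<Sum>r=1..k. x r)"
    using ps(2) by (induction ps) (auto simp: aff_gen_sum[OF assms(1)] simp del: One_nat_def)
  then show ?thesis using ps by simp
qed

lemma aff_group_outside:
  assumes "k \<ge> 2" "w \<in> aff_group k" "r \<notin> {1..k}" shows "w x r = x r"
proof -
  obtain ps where ps: "w = aff_word k ps" "set ps \<subseteq> {0..<k}"
    using assms(2) by (auto simp: aff_group_def)
  have "aff_word k ps x r = x r"
    using ps(2)
  proof (induction ps)
    case (Cons p ps)
    then have "p < k" by simp
    from aff_gen_cases[OF assms(1) this, of "aff_word k ps x"]
    show ?case using Cons assms by cases auto
  qed simp
  then show ?thesis using ps by simp
qed

lemma aff_groupI: "set ps \<subseteq> {0..<k} \<Longrightarrow> aff_word k ps \<in> aff_group k"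
  unfolding aff_group_def by blast

lemma aff_group_id: "id \<in> aff_group k"
  unfolding aff_group_def using aff_word_simps(1)[of k] by (metis (mono_tags, lifting) empty_set empty_subsetI mem_Collect_eq)

lemma aff_group_comp: "v \<in> aff_group k \<Longrightarrow> w \<in> aff_group k \<Longrightarrow> v \<circ> w \<in> aff_group k"
  unfolding aff_group_def
  by (auto, metis aff_word_append le_sup_iff set_append)

lemma aff_group_inv: "k \<ge> 2 \<Longrightarrow> w \<in> aff_group k \<Longrightarrow> inv w \<in> aff_group k"
  unfolding aff_group_def by (auto, metis inv_aff_word set_rev)

lemma aff_group_bij:
  assumes "k \<ge> 2" "w \<in> aff_group k" shows "w (inv w x) = x" "inv w (w x) = x"
proof -
  obtain ps where ps: "w = aff_word k ps" "set ps \<subseteq> {0..<k}"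
    using assms(2) by (auto simp: aff_group_def)
  show "w (inv w x) = x" "inv w (w x) = x"
    unfolding ps(1) inv_aff_word[OF assms(1) ps(2)]
    by (simp_all add: aff_word_rev[OF assms(1) ps(2)] aff_word_rev'[OF assms(1) ps(2)])
qed

lemma orbit_refl: "x \<in> orbit k x"
  unfolding orbit_def using aff_group_id[of k] by (metis (mono_tags, lifting) id_apply mem_Collect_eq)

lemma orbitI: "w \<in> aff_group k \<Longrightarrow> w x \<in> orbit k x"
  unfolding orbit_def by blast

lemma orbit_trans:
  assumes "x \<in> orbit k y" "y \<in> orbit k z" shows "x \<in> orbit k z"
proof -
  obtain v w where "v \<in> aff_group k" "w \<in> aff_group k" "x = v y" "y = w z"
    using assms by (auto simp: orbit_def)
  then show ?thesis using orbitI[OF aff_group_comp[of v k w], of z] by simp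
qed

lemma orbit_sym:
  assumes "k \<ge> 2" "x \<in> orbit k y" shows "y \<in> orbit k x"
proof -
  obtain w where "w \<in> aff_group k" "x = w y" using assms by (auto simp: orbit_def)
  then show ?thesis
    using orbitI[OF aff_group_inv[OF assms(1), of w], of x] aff_group_bij(2)[OF assms(1), of w] by simp
qed

text \<open>Two dominant vectors with the same sum coincide: at the first coordinate where they differ, say
  with \<open>y\<close> the larger, all coordinates of \<open>y\<close> are at least those of \<open>z\<close>.\<close>

lemma dominant_unique_aux:
  assumes "dominant k y" "dominant k z" "(\<Sum>r=1..k. y r) = (\<Sum>r=1..k. z r)"
    and "1 \<le> j" "j \<le> k" "\<And>r. 1 \<le> r \<Longrightarrow> r < j \<Longrightarrow> y r = z r"
  shows "\<not> z j < y j"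
proof
  assume lt: "z j < y j"
  have "z r \<le> y r" if "1 \<le> r" "r \<le> k" for r
  proof (cases "r < j")
    case True
    then show ?thesis using assms(6) that by simp
  next
    case False
    have "z r \<le> z j" "y j \<le> y 1" "y 1 - 1 \<le> y k" "y k \<le> y r"
      using dominant_antimono[OF assms(1)] dominant_antimono[OF assms(2)] assms(1,4,5) that False
      by (auto simp: dominant_def)
    then show ?thesis using lt by linarith
  qed
  then have "(\<Sum>r=1..k. z r) < (\<Sum>r=1..k. y r)"
    using lt assms(4,5) by (intro sum_strict_mono_ex1) auto
  then show False using assms(3) by simp
qed

lemma dominant_unique:
  assumes "dominant k y" "dominant k z" "(\<Sum>r=1..k. y r) = (\<Sum>r=1..k. z r)"
    and "1 \<le> r" "r \<le> k"
  shows "y r = z r"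
  using assms(4,5)
proof (induction r rule: less_induct)
  case (less j)
  show ?case
    using dominant_unique_aux[OF assms(1-3) less.prems less.IH]
      dominant_unique_aux[OF assms(2,1) assms(3)[symmetric] less.prems] less
    by (metis antisym_conv3 less_imp_le_nat order.trans)
qed

text \<open>The fundamental chamber contains the point whose coordinates are \<open>-j/k\<close>, so the orbit element
  nearest to it is dominant; after scaling by \<open>k\<close> the squared distance is an integer.\<close>

lemma dominant_exists:
  assumes "k \<ge> 2" shows "\<exists>y\<in>orbit k x. dominant k y"
proof -
  define h where "h r z = (int k * z + int r)\<^sup>2" for r :: nat and z :: int
  define Q where "Q y = nat (\<Sum>r=1..k. h r (y r))" for y :: vec
  have hpos: "0 \<le> (\<Sum>r=1..k. h r (y r))" for y by (simp add: h_def sum_nonneg)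
  have "\<exists>y. y \<in> orbit k x \<and> (\<forall>z. z \<in> orbit k x \<longrightarrow> Q y \<le> Q z)"
    by (rule ex_has_least_nat[of "\<lambda>y. y \<in> orbit k x", OF orbit_refl])
  then obtain y where y: "y \<in> orbit k x" "\<And>z. z \<in> orbit k x \<Longrightarrow> Q y \<le> Q z" by blast
  have step: "(\<Sum>r=1..k. h r (y r)) \<le> (\<Sum>r=1..k. h r (aff_gen k p y r))" if "p < k" for p
  proof -
    have "aff_gen k p = aff_word k [p]" by auto
    then have "aff_gen k p \<in> aff_group k" using that unfolding aff_group_def by fastforce
    then have "aff_gen k p y \<in> orbit k y" by (auto simp: orbit_def)
    then have "Q y \<le> Q (aff_gen k p y)" using y orbit_trans by blast
    then show ?thesis using hpos unfolding Q_def by (simp add: nat_le_eq_zle)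
  qed
  have "y j \<ge> y (Suc j)" if "1 \<le> j" "j < k" for j
  proof -
    have "aff_gen k j y = y(j := y (Suc j), Suc j := y j)"
      using that assms by (auto simp: aff_gen_def fun_eq_iff transpose_def)
    then have "0 \<le> - h j (y j) - h (Suc j) (y (Suc j)) + h j (y (Suc j)) + h (Suc j) (y j)"
      using step[OF that(2)] sum_upd2[of "{1..k}" j "Suc j" h] that by simp
    also have "\<dots> = 2 * int k * (y j - y (Suc j))"
      by (simp add: h_def power2_eq_square algebra_simps)
    finally show ?thesis using assms by (simp add: zero_le_mult_iff)
  qed
  moreover have "y k \<ge> y 1 - 1"
  proof -
    have e: "aff_gen k 0 y = y(1 := y k + 1, k := y 1 - 1)" using assms by (simp add: aff_gen_def)
    have "0 < k" "finite {1..k}" "1 \<in> {1..k}" "k \<in> {1..k}" "1 \<noteq> k" using assms by auto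
    then have "0 \<le> - h 1 (y 1) - h k (y k) + h 1 (y k + 1) + h k (y 1 - 1)"
      using step[of 0] sum_upd2[of "{1..k}" 1 k h y "y k + 1" "y 1 - 1"] unfolding e by linarith
    also have "\<dots> = 2 * int k * (y k - y 1 + 1)"
      by (simp add: h_def power2_eq_square algebra_simps)
    finally show ?thesis using assms by (simp add: zero_le_mult_iff)
  qed
  ultimately show ?thesis using y(1) unfolding dominant_def by blast
qed

lemma vec_dom_eqI:
  assumes "k \<ge> 2" "y \<in> orbit k x" "dominant k y" shows "vec_dom k x = y"
  unfolding vec_dom_def
proof (rule the_equality)
  show "y \<in> orbit k x \<and> (\<forall>j. 1 \<le> j \<and> j < k \<longrightarrow> y (Suc j) \<le> y j) \<and> y 1 - 1 \<le> y k"
    using assms by (auto simp: dominant_def)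
next
  fix z assume "z \<in> orbit k x \<and> (\<forall>j. 1 \<le> j \<and> j < k \<longrightarrow> z (Suc j) \<le> z j) \<and> z 1 - 1 \<le> z k"
  then have z: "z \<in> orbit k x" "dominant k z" by (auto simp: dominant_def)
  then obtain w where w: "w \<in> aff_group k" "z = w y"
    using orbit_trans[OF _ orbit_sym[OF assms(1,2)]] by (auto simp: orbit_def)
  show "z = y"
  proof
    fix r
    show "z r = y r"
    proof (cases "r \<in> {1..k}")
      case True
      then show ?thesis
        using dominant_unique[OF z(2) assms(3), of r] aff_group_sum[OF assms(1) w(1)] w(2) by simp
    next
      case False
      then show ?thesis using aff_group_outside[OF assms(1) w(1)] w(2) by simp
    qed
  qed
qed

lemma vec_dom_facts:
  assumes "k \<ge> 2" shows "vec_dom k x \<in> orbit k x" "dominant k (vec_dom k x)"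
  using dominant_exists[OF assms, of x] vec_dom_eqI[OF assms] by auto

lemma vec_dom_orbit:
  assumes "k \<ge> 2" "x \<in> orbit k y" shows "vec_dom k x = vec_dom k y"
  using vec_dom_eqI[OF assms(1)] vec_dom_facts[OF assms(1), of y] orbit_trans orbit_sym[OF assms]
  by blast

section \<open>The Bruhat order on vectors\<close>

lemma aff_length_le: "set ps \<subseteq> {0..<k} \<Longrightarrow> aff_length k (aff_word k ps) \<le> length ps"
  unfolding aff_length_def by (rule Least_le) blast

lemma reduced_word:
  assumes "w \<in> aff_group k"
  obtains ps where "set ps \<subseteq> {0..<k}" "aff_word k ps = w" "length ps = aff_length k w"
proof -
  obtain qs where "set qs \<subseteq> {0..<k}" "w = aff_word k qs" using assms by (auto simp: aff_group_def)
  then have "\<exists>n is. set is \<subseteq> {0..<k} \<and> length is = n \<and> aff_word k is = w" by blast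
  from LeastI_ex[OF this] show ?thesis using that unfolding aff_length_def by blast
qed

text \<open>The exchange property in terms of the Bruhat order: the reflection deletes a letter of a
  reduced word.\<close>

lemma reflect_descends:
  assumes k: "k \<ge> 2" and ps: "set ps \<subseteq> {0..<k}"
    and b: "b \<in> roots k" "root_pos b" "\<not> root_pos (word_root k ps b)"
  shows "bruhat_step k (reflect b \<circ> aff_word k ps) (aff_word k ps)"
proof -
  define u where "u = aff_word k ps"
  have u: "u \<in> aff_group k" unfolding u_def aff_group_def using ps by blast
  obtain rs where rs: "set rs \<subseteq> {0..<k}" "aff_word k rs = u" "length rs = aff_length k u"
    using reduced_word[OF u] .
  have neg: "\<not> root_pos (word_root k rs b)"
    using word_root_cong[OF k rs(1) ps b(1)] rs(2) b(3) by (simp add: u_def)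
  obtain qs where qs: "set qs \<subseteq> {0..<k}" "length qs < length rs" "reflect b \<circ> u = aff_word k qs"
    using exchange_delete[OF k rs(1) b(1,2) neg] rs(2) by auto
  obtain us p vs where us: "rs = us @ p # vs" "reflect b = aff_word k (us @ p # rev us)"
    using exchange[OF k rs(1) b(1,2) neg] by blast
  have us': "set us \<subseteq> {0..<k}" "p < k" using us rs by auto
  \<comment> \<open>Bruhat steps multiply on the right, so the reflection on the left is conjugated by \<open>u\<close>.\<close>
  define c where "c = aff_word k (rev rs @ us)"
  have c: "c \<in> aff_group k" unfolding c_def by (rule aff_groupI) (use us' rs in auto)
  have cinv: "inv c = aff_word k (rev us @ rs)"
    unfolding c_def using inv_aff_word[OF k, of "rev rs @ us"] us' rs by simp
  define r where "r = c \<circ> aff_gen k p \<circ> inv c"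
  have "r \<in> aff_reflections k" unfolding aff_reflections_def r_def using c us' by blast
  moreover have "u = (reflect b \<circ> u) \<circ> r"
  proof
    fix x
    have ri: "aff_word k (rev us) (aff_word k us z) = z" "aff_word k us (aff_word k (rev us) z) = z"
      "aff_word k rs (aff_word k (rev rs) z) = z" "aff_gen k p (aff_gen k p z) = z" for z
      using aff_word_rev[OF k us'(1)] aff_word_rev'[OF k us'(1)] aff_word_rev'[OF k rs(1)]
        aff_gen_involution[OF k us'(2)] by auto
    show "u x = ((reflect b \<circ> u) \<circ> r) x"
      unfolding r_def cinv unfolding c_def us(2) rs(2)[symmetric] by (simp add: ri)
  qed
  moreover have "aff_length k (reflect b \<circ> u) < aff_length k u"
    using aff_length_le[OF qs(1)] qs rs by simp
  moreover have "reflect b \<circ> u \<in> aff_group k" unfolding qs(3) aff_group_def using qs by blast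
  ultimately show ?thesis using u unfolding bruhat_step_def u_def[symmetric] by blast
qed

lemma reflect_fix: "root_eval b x = 0 \<Longrightarrow> reflect b x = x"
  by (cases b) auto

definition coset :: "nat \<Rightarrow> vec \<Rightarrow> (vec \<Rightarrow> vec) set" where
  "coset k x = {w \<in> aff_group k. w (vec_dom k x) = x}"

lemma coset_nonempty:
  assumes "k \<ge> 2" shows "coset k x \<noteq> {}"
proof -
  have "x \<in> orbit k (vec_dom k x)" using orbit_sym[OF assms] vec_dom_facts[OF assms] by blast
  then show ?thesis by (auto simp: orbit_def coset_def)
qed

lemma min_elt_coset:
  assumes "k \<ge> 2" shows "min_elt k x \<in> coset k x"
    "w \<in> coset k x \<Longrightarrow> aff_length k (min_elt k x) \<le> aff_length k w"
proof -
  have e: "min_elt k x = arg_min (aff_length k) (\<lambda>w. w \<in> coset k x)"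
    by (simp add: min_elt_def coset_def)
  obtain w0 where w0: "w0 \<in> coset k x" using coset_nonempty[OF assms] by blast
  show "min_elt k x \<in> coset k x" unfolding e using arg_min_natI[of "\<lambda>w. w \<in> coset k x"] w0 by blast
  show "w \<in> coset k x \<Longrightarrow> aff_length k (min_elt k x) \<le> aff_length k w"
    unfolding e using arg_min_nat_le[of "\<lambda>w. w \<in> coset k x"] by blast
qed

text \<open>Among the chambers whose closure contains \<open>x\<close>, at most one lies on the positive side of every wall
  through \<open>x\<close>; it is the one of the minimal element.\<close>

lemma coset_unique:
  assumes k: "k \<ge> 2" and ps: "set ps \<subseteq> {0..<k}" "aff_word k ps \<in> coset k x"
    and qs: "set qs \<subseteq> {0..<k}" "aff_word k qs \<in> coset k x"
    and pp: "\<And>b. b \<in> roots k \<Longrightarrow> root_pos b \<Longrightarrow> root_eval b x = 0 \<Longrightarrow> root_pos (word_root k ps b)"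
    and qp: "\<And>b. b \<in> roots k \<Longrightarrow> root_pos b \<Longrightarrow> root_eval b x = 0 \<Longrightarrow> root_pos (word_root k qs b)"
  shows "aff_word k ps = aff_word k qs"
proof -
  define d where "d = vec_dom k x"
  have d: "dominant k d" using vec_dom_facts[OF k] by (simp add: d_def)
  have pd: "aff_word k ps d = x" and qd: "aff_word k qs d = x"
    using ps qs by (auto simp: coset_def d_def)
  let ?w = "rev ps @ qs"
  have w: "set ?w \<subseteq> {0..<k}" using ps qs by simp
  have wd: "aff_word k ?w d = d"
    using aff_word_rev[OF k ps(1), of d] pd qd by simp
  have "aff_word k ?w = id"
  proof (rule pos_word_trivial[OF k w])
    fix b assume b: "b \<in> roots k" "root_pos b"
    define c where "c = word_root k (rev ps) b"
    have c: "c \<in> roots k" unfolding c_def using word_root_mem[OF k _ b(1)] ps by simp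
    have bd: "root_eval b d \<ge> 0" using dominant_root_nonneg[OF d b] .
    have cx: "root_eval c x = root_eval b d"
    proof -
      have "root_eval c x = root_eval b (aff_word k (rev ps) (aff_word k ps d))"
        unfolding c_def using word_root_eval[OF k] ps pd by simp
      then show ?thesis using aff_word_rev[OF k ps(1)] by simp
    qed
    have ev: "root_eval (word_root k qs c) d = root_eval b d"
      using word_root_eval[OF k qs(1)] qd cx by simp
    have mem: "word_root k qs c \<in> roots k" using word_root_mem[OF k qs(1) c] .
    show "root_pos (word_root k ?w b)"
    proof (cases "root_eval b d = 0")
      case False
      show ?thesis
      proof (rule ccontr)
        assume "\<not> root_pos (word_root k ?w b)"
        then have "root_pos (root_neg (word_root k qs c))"
          using root_pos_or_neg[OF mem] by (simp add: c_def)
        then have "0 \<le> root_eval (root_neg (word_root k qs c)) d"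
          using dominant_root_nonneg[OF d] root_neg_mem[OF mem] by blast
        moreover have "root_eval (root_neg z) y = - root_eval z y" for z y by (cases z) simp
        ultimately show False using ev bd False by simp
      qed
    next
      case True
      have "root_pos c"
      proof (rule ccontr)
        assume "\<not> root_pos c"
        then have n: "root_pos (root_neg c)" using root_pos_or_neg[OF c] by simp
        have "root_eval (root_neg c) x = 0" using cx True by (cases c) simp
        then have "root_pos (word_root k ps (root_neg c))"
          using pp[OF root_neg_mem[OF c] n] by blast
        then have "root_pos (root_neg (word_root k ps c))" using word_root_neg[OF k] by simp
        moreover have "word_root k ps c = b"
        proof -
          have "word_root k (rev ps @ ps) b = word_root k [] b"
          proof (rule word_root_cong[OF k _ _ b(1)])
            show "aff_word k (rev ps @ ps) = aff_word k []"
              using aff_word_rev[OF k ps(1)] by auto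
          qed (use ps in auto)
          then show ?thesis by (simp add: c_def)
        qed
        ultimately show False using root_pos_or_neg[OF b(1)] b(2) by simp
      qed
      then show ?thesis using qp[OF c] cx True by (simp add: c_def)
    qed
  qed
  then have "aff_word k (rev ps) (aff_word k qs x) = x" for x
    by (metis aff_word_append comp_apply id_apply)
  then have "aff_word k ps x = aff_word k qs x" for x
    using aff_word_rev'[OF k ps(1)] by metis
  then show ?thesis by blast
qed

lemma reflect_coset:
  assumes "k \<ge> 2" "w \<in> coset k x" "root_eval b x = 0" "reflect b \<circ> w \<in> aff_group k"
  shows "reflect b \<circ> w \<in> coset k x"
  using assms reflect_fix[of b x] by (auto simp: coset_def)

text \<open>As long as some wall through \<open>x\<close> has the chamber of \<open>w\<close> on its negative side, reflecting in it
  stays in the coset and goes down in the Bruhat order; when no such wall is left, \<open>w\<close> is the minimal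
  element.\<close>

lemma min_elt_le:
  assumes k: "k \<ge> 2" and "w \<in> coset k x" shows "bruhat_le k (min_elt k x) w"
  using assms(2)
proof (induction "aff_length k w" arbitrary: w rule: less_induct)
  case less
  have neg_step: "\<exists>v\<in>coset k x. bruhat_step k v (aff_word k ps)"
    if "set ps \<subseteq> {0..<k}" "aff_word k ps \<in> coset k x" "b \<in> roots k" "root_pos b"
      "root_eval b x = 0" "\<not> root_pos (word_root k ps b)" for ps b
  proof -
    have s: "bruhat_step k (reflect b \<circ> aff_word k ps) (aff_word k ps)"
      using reflect_descends[OF k that(1,3,4,6)] .
    then have "reflect b \<circ> aff_word k ps \<in> aff_group k" by (simp add: bruhat_step_def)
    then show ?thesis using reflect_coset[OF k that(2,5)] s by blast
  qed
  have "w \<in> aff_group k" using less.prems by (simp add: coset_def)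
  then obtain ps where ps: "w = aff_word k ps" "set ps \<subseteq> {0..<k}" by (auto simp: aff_group_def)
  have "min_elt k x \<in> aff_group k" using min_elt_coset(1)[OF k] by (simp add: coset_def)
  then obtain qs where qs: "min_elt k x = aff_word k qs" "set qs \<subseteq> {0..<k}" by (auto simp: aff_group_def)
  have qp: "root_pos (word_root k qs b)" if b: "b \<in> roots k" "root_pos b" "root_eval b x = 0" for b
  proof (rule ccontr)
    assume "\<not> root_pos (word_root k qs b)"
    then obtain v where "v \<in> coset k x" "bruhat_step k v (min_elt k x)"
      using neg_step[OF qs(2), of b] b min_elt_coset(1)[OF k, of x] qs(1) by auto
    then show False using min_elt_coset(2)[OF k, of v x] by (simp add: bruhat_step_def)
  qed
  show ?case
  proof (cases "\<exists>b\<in>roots k. root_pos b \<and> root_eval b x = 0 \<and> \<not> root_pos (word_root k ps b)")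
    case True
    then obtain b where b: "b \<in> roots k" "root_pos b" "root_eval b x = 0"
      "\<not> root_pos (word_root k ps b)" by blast
    obtain v where v: "v \<in> coset k x" "bruhat_step k v w"
      using neg_step[OF ps(2) _ b] less.prems ps(1) by blast
    then have "bruhat_le k (min_elt k x) v" using less.hyps by (simp add: bruhat_step_def)
    then show ?thesis using v(2) unfolding bruhat_le_def by simp
  next
    case False
    have "aff_word k ps = aff_word k qs"
    proof (rule coset_unique[OF k ps(2) _ qs(2)])
      show "aff_word k ps \<in> coset k x" using less.prems ps(1) by simp
      show "aff_word k qs \<in> coset k x" using min_elt_coset(1)[OF k, of x] qs(1) by simp
    qed (use False qp in blast)+
    then show ?thesis using ps qs by (simp add: bruhat_le_def)
  qed
qed

text \<open>A root negative at \<open>y\<close> is also negative on the chamber of the minimal element of \<open>y\<close>, so the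
  reflection takes that element to a smaller one, which lies above the minimal element of the
  reflected vector.\<close>

lemma reflect_vec_le:
  assumes k: "k \<ge> 2" and b: "b \<in> roots k" "root_pos b" "root_eval b y < 0"
  shows "vec_le k (reflect b y) y"
proof -
  have m: "min_elt k y \<in> coset k y" using min_elt_coset(1)[OF k] .
  then obtain ps where ps: "min_elt k y = aff_word k ps" "set ps \<subseteq> {0..<k}"
    by (auto simp: aff_group_def coset_def)
  have d: "dominant k (vec_dom k y)" using vec_dom_facts[OF k] by blast
  have "root_eval (word_root k ps b) (vec_dom k y) < 0"
    using word_root_eval[OF k ps(2)] b(3) m ps(1) by (simp add: coset_def)
  then have "\<not> root_pos (word_root k ps b)"
    using dominant_root_nonneg[OF d word_root_mem[OF k ps(2) b(1)]] by linarith
  then have st: "bruhat_step k (reflect b \<circ> min_elt k y) (min_elt k y)"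
    using reflect_descends[OF k ps(2) b(1,2)] ps(1) by simp
  then have g: "reflect b \<circ> min_elt k y \<in> aff_group k" by (simp add: bruhat_step_def)
  have my: "min_elt k y (vec_dom k y) = y" using m by (simp add: coset_def)
  have "reflect b y = (reflect b \<circ> min_elt k y) (vec_dom k y)" using my by simp
  then have "reflect b y \<in> orbit k (vec_dom k y)" unfolding orbit_def using g by blast
  then have o: "reflect b y \<in> orbit k y" using orbit_trans vec_dom_facts(1)[OF k] by blast
  then have "reflect b \<circ> min_elt k y \<in> coset k (reflect b y)"
    using g my vec_dom_orbit[OF k o] by (simp add: coset_def)
  then have "bruhat_le k (min_elt k (reflect b y)) (reflect b \<circ> min_elt k y)"
    by (rule min_elt_le[OF k])
  then have "bruhat_le k (min_elt k (reflect b y)) (min_elt k y)"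
    using st unfolding bruhat_le_def by simp
  then show ?thesis using o by (simp add: vec_le_def)
qed

text \<open>The reflections that go down, in coordinates: they move two entries closer together or exchange
  them so that the larger one comes first.\<close>

definition lower :: "nat \<Rightarrow> vec \<Rightarrow> vec \<Rightarrow> bool" where
  "lower k x y \<longleftrightarrow> (\<exists>i j c d. 1 \<le> i \<and> i < j \<and> j \<le> k \<and> x = y(i := c, j := d) \<and>
     c + d = y i + y j \<and> (y i < c \<and> c \<le> y j \<or> y j < c \<and> c < y i))"

abbreviation lek :: "nat \<Rightarrow> vec \<Rightarrow> vec \<Rightarrow> bool" where
  "lek k \<equiv> (lower k)\<^sup>*\<^sup>*"

lemma lower_vec_le:
  assumes k: "k \<ge> 2" and "lower k x y" shows "vec_le k x y"
proof -
  obtain i j c d where ij: "1 \<le> i" "i < j" "j \<le> k" "x = y(i := c, j := d)"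
    "c + d = y i + y j" "y i < c \<and> c \<le> y j \<or> y j < c \<and> c < y i"
    using assms(2) unfolding lower_def by blast
  show ?thesis
  proof (cases "y i < c \<and> c \<le> y j")
    case True
    let ?b = "(i, j, y j - c)"
    have d: "d = y i + y j - c" using ij by simp
    have "x = reflect ?b y" using ij d by (auto simp: fun_eq_iff)
    moreover have "?b \<in> roots k" "root_pos ?b" "root_eval ?b y < 0"
      using True ij by (auto simp: roots_def)
    ultimately show ?thesis using reflect_vec_le[OF k] by blast
  next
    case False
    then have F: "y j < c" "c < y i" using ij by auto
    let ?b = "(j, i, y i - d)"
    have d: "d = y i + y j - c" using ij by simp
    have "x = reflect ?b y" using ij d by (auto simp: fun_eq_iff)
    moreover have "?b \<in> roots k" "root_pos ?b" "root_eval ?b y < 0"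
      using F ij d by (auto simp: roots_def)
    ultimately show ?thesis using reflect_vec_le[OF k] by blast
  qed
qed

lemma lek_vec_le:
  assumes k: "k \<ge> 2" and "lek k x y" shows "vec_le k x y"
  using assms(2)
proof (induction rule: rtranclp_induct)
  case base
  show ?case by (simp add: vec_le_def orbit_refl bruhat_le_def)
next
  case (step y z)
  then have "vec_le k x y" "vec_le k y z" using lower_vec_le[OF k] by auto
  then have "x \<in> orbit k y" "y \<in> orbit k z" "bruhat_le k (min_elt k x) (min_elt k z)"
    by (auto simp: vec_le_def bruhat_le_def)
  then show ?case using orbit_trans[of x k y z] by (simp add: vec_le_def)
qed

section \<open>Strictness and sorting for the order on vectors\<close>

definition pot_less :: "nat \<Rightarrow> vec \<Rightarrow> vec \<Rightarrow> bool" where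
  "pot_less k x y \<longleftrightarrow> (\<Sum>r=1..k. (x r)\<^sup>2) < (\<Sum>r=1..k. (y r)\<^sup>2) \<or>
     (\<Sum>r=1..k. (x r)\<^sup>2) = (\<Sum>r=1..k. (y r)\<^sup>2) \<and>
     (\<Sum>r=1..k. int r * x r) < (\<Sum>r=1..k. int r * y r)"

lemma pot_less_irrefl: "\<not> pot_less k x x"
  by (simp add: pot_less_def)

lemma pot_less_trans: "pot_less k x y \<Longrightarrow> pot_less k y z \<Longrightarrow> pot_less k x z"
  by (auto simp: pot_less_def)

text \<open>Moving two entries closer together decreases the sum of squares; exchanging them preserves it and
  moves weight to the left.\<close>

lemma lower_pot_less:
  assumes "lower k x y" shows "pot_less k x y"
proof -
  obtain i j c d where ij: "1 \<le> i" "i < j" "j \<le> k" "x = y(i := c, j := d)"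
    "c + d = y i + y j" "y i < c \<and> c \<le> y j \<or> y j < c \<and> c < y i"
    using assms unfolding lower_def by blast
  have m: "finite {1..k}" "i \<in> {1..k}" "j \<in> {1..k}" "i \<noteq> j" using ij by auto
  define a where "a = y i"
  define b where "b = y j"
  have d: "d = a + b - c" using ij by (simp add: a_def b_def)
  have sq: "(\<Sum>r=1..k. (x r)\<^sup>2) = (\<Sum>r=1..k. (y r)\<^sup>2) - a\<^sup>2 - b\<^sup>2 + c\<^sup>2 + d\<^sup>2"
    using sum_upd2[OF m, of "\<lambda>_ z. z\<^sup>2"] ij by (simp add: a_def b_def)
  have ln: "(\<Sum>r=1..k. int r * x r) = (\<Sum>r=1..k. int r * y r) - int i * a - int j * b + int i * c + int j * d"
    using sum_upd2[OF m, of "\<lambda>r z. int r * z"] ij by (simp add: a_def b_def)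
  have e: "a\<^sup>2 + b\<^sup>2 - c\<^sup>2 - d\<^sup>2 = 2 * ((c - b) * (a - c))"
    unfolding d by (simp add: power2_eq_square algebra_simps)
  have e': "int i * a + int j * b - int i * c - int j * d = (int j - int i) * (c - a)"
    unfolding d by (simp add: algebra_simps)
  from ij(6) consider "a < c" "c < b" | "a < c" "c = b" | "b < c" "c < a"
    by (fastforce simp: a_def b_def)
  then show ?thesis
  proof cases
    case 1
    then have "0 < (c - b) * (a - c)" by (simp add: mult_neg_neg)
    then show ?thesis using sq e by (simp add: pot_less_def)
  next
    case 2
    then have "0 < (int j - int i) * (c - a)" using ij by simp
    moreover have "d = a" using 2 d by simp
    ultimately show ?thesis using sq ln e' 2 by (simp add: pot_less_def)
  next
    case 3
    then have "0 < (c - b) * (a - c)" by simp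
    then show ?thesis using sq e by (simp add: pot_less_def)
  qed
qed

lemma lek_pot: "lek k x y \<Longrightarrow> x = y \<or> pot_less k x y"
  by (induction rule: rtranclp_induct) (auto dest: lower_pot_less pot_less_trans)

lemma lower_lek_pot: "lower k x y \<Longrightarrow> lek k y z \<Longrightarrow> pot_less k x z"
  using lower_pot_less lek_pot pot_less_trans by blast

definition sort_at :: "nat \<Rightarrow> vec \<Rightarrow> vec" where
  "sort_at p x = (if x p < x (Suc p) then x \<circ> transpose p (Suc p) else x)"

lemma lower_swap:
  assumes "1 \<le> p" "p < k" "z p < z (Suc p)" shows "lower k (z \<circ> transpose p (Suc p)) z"
  unfolding lower_def
  by (rule exI[of _ p], rule exI[of _ "Suc p"], rule exI[of _ "z (Suc p)"], rule exI[of _ "z p"])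
     (use assms in \<open>auto simp: fun_eq_iff transpose_def\<close>)

lemma sort_at_lek: "1 \<le> p \<Longrightarrow> p < k \<Longrightarrow> lek k (sort_at p x) x"
  using lower_swap by (auto simp: sort_at_def)

text \<open>Sorting at \<open>p\<close> picks the smaller of \<open>x\<close> and its image under the generator; that this is monotone is
  the lifting property of the Bruhat order.\<close>

lemma lower_sort_at:
  assumes p: "1 \<le> p" "p < k" and "lower k x y" shows "lek k (sort_at p x) (sort_at p y)"
proof -
  let ?t = "transpose p (Suc p)"
  obtain i j c d where ij: "1 \<le> i" "i < j" "j \<le> k" "x = y(i := c, j := d)"
    "c + d = y i + y j" "y i < c \<and> c \<le> y j \<or> y j < c \<and> c < y i"
    using assms unfolding lower_def by blast
  consider (same) "i = p" "j = Suc p" | (up) "\<not> (i = p \<and> j = Suc p)" "y p < y (Suc p)"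
    | (down) "y p \<ge> y (Suc p)" "\<not> (i = p \<and> j = Suc p)" by linarith
  then show ?thesis
  proof cases
    case same
    define M where "M = max (y p) (y (Suc p))"
    define m where "m = min (y p) (y (Suc p))"
    have sy: "sort_at p y = y(p := M, Suc p := m)"
      by (auto simp: sort_at_def M_def m_def fun_eq_iff transpose_def)
    have sx: "sort_at p x = y(p := max c d, Suc p := min c d)"
      using same ij by (auto simp: sort_at_def fun_eq_iff transpose_def)
    have sum: "max c d + min c d = M + m" using ij same by (simp add: M_def m_def)
    show ?thesis
    proof (cases "max c d = M")
      case True
      then show ?thesis using sum by (simp add: sx sy)
    next
      case False
      have "c + d = y p + y (Suc p)" "y p < c \<and> c \<le> y (Suc p) \<or> y (Suc p) < c \<and> c < y p"
        "max c d \<noteq> max (y p) (y (Suc p))" using ij False same by (simp_all add: M_def)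
      then have "m < max c d" "max c d < M" unfolding M_def m_def max_def min_def
        by (simp_all split: if_splits)
      then have "lower k (sort_at p x) (sort_at p y)" unfolding lower_def
        by (intro exI[of _ p] exI[of _ "Suc p"] exI[of _ "max c d"] exI[of _ "min c d"])
          (use p sum in \<open>auto simp: sx sy fun_eq_iff\<close>)
      then show ?thesis by blast
    qed
  next
    case up
    have "1 \<le> ?t i" "?t j \<le> k" using ij p by (auto simp: transpose_def)
    moreover have "?t i < ?t j" using ij up(1) by (auto simp: transpose_def)
    moreover have "x \<circ> ?t = (y \<circ> ?t)(?t i := c, ?t j := d)"
    proof -
      have "?t r = u \<longleftrightarrow> r = ?t u" for r u by (metis transpose_involutory)
      then show ?thesis by (auto simp: ij(4) fun_eq_iff)
    qed
    moreover have "(y \<circ> ?t) (?t i) = y i" "(y \<circ> ?t) (?t j) = y j" by simp_all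
    ultimately have "lower k (x \<circ> ?t) (y \<circ> ?t)" using ij(5,6) unfolding lower_def by metis
    moreover have "lek k (sort_at p x) (x \<circ> ?t)"
    proof (cases "x p < x (Suc p)")
      case True
      then show ?thesis by (simp add: sort_at_def)
    next
      case False
      have tt: "(x \<circ> ?t) \<circ> ?t = x" by (simp add: fun_eq_iff)
      show ?thesis
      proof (cases "x p = x (Suc p)")
        case True
        then have "x \<circ> ?t = x" by (auto simp: fun_eq_iff transpose_def)
        then show ?thesis by (simp add: sort_at_def True)
      next
        case False
        then have "lower k ((x \<circ> ?t) \<circ> ?t) (x \<circ> ?t)"
          using \<open>\<not> x p < x (Suc p)\<close> by (intro lower_swap p) simp
        then show ?thesis using \<open>\<not> x p < x (Suc p)\<close> unfolding tt by (simp add: sort_at_def)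
      qed
    qed
    moreover have "sort_at p y = y \<circ> ?t" using up by (simp add: sort_at_def)
    ultimately show ?thesis by (simp add: rtranclp.rtrancl_into_rtrancl)
  next
    case down
    then have "sort_at p y = y" by (simp add: sort_at_def)
    then show ?thesis using sort_at_lek[OF p, of x] assms(3) by (simp add: rtranclp.rtrancl_into_rtrancl)
  qed
qed

lemma lek_sort_at:
  assumes "1 \<le> p" "p < k" "lek k x y" shows "lek k (sort_at p x) (sort_at p y)"
  using assms(3)
proof (induction rule: rtranclp_induct)
  case (step y z)
  then show ?case using lower_sort_at[OF assms(1,2)] rtranclp_trans by meson
qed simp

section \<open>Monomial substitutions\<close>

lemma lookup_cst_mult [simp]: "lookup (cst c * f) m = c * lookup f m"
proof -
  have "cst c * f = Poly_Mapping.map ((*) c) f"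
    unfolding cst_def by (rule mult_map_scale_conv_mult[symmetric])
  then show ?thesis by (simp add: Poly_Mapping.map.rep_eq when_def)
qed

lemma cst_simps:
  "cst 0 = 0" "cst 1 = 1" "cst (a + b) = cst a + cst b" "cst (a - b) = cst a - cst b"
  "cst (a * b) = cst a * cst b"
  by (simp_all add: cst_def single_add single_diff mult_single)

lemma cst_power: "cst (a ^ n) = cst a ^ n"
  by (induction n) (simp_all add: cst_simps)

lemma pol_sum_monomials: "f = (\<Sum>m\<in>keys f. single m (lookup f m))"
  by (rule poly_mapping_eqI) (simp add: lookup_sum lookup_single when_def in_keys_iff)

lemma pol_induct [case_names single add]:
  fixes f :: "'a \<Rightarrow>\<^sub>0 'b::comm_monoid_add"
  assumes "\<And>m c. P (single m c)" "\<And>f g. P f \<Longrightarrow> P g \<Longrightarrow> P (f + g)"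
  shows "P f"
proof -
  have 0: "P 0" using assms(1)[of undefined 0] by simp
  have "P (\<Sum>m\<in>A. single m (c m))" if "finite A" for A and c :: "'a \<Rightarrow> 'b"
    using that by (induction A rule: finite_induct) (auto intro: assms 0)
  moreover have "f = (\<Sum>m\<in>keys f. single m (lookup f m))"
    by (rule poly_mapping_eqI) (simp add: lookup_sum lookup_single when_def in_keys_iff)
  ultimately show ?thesis by (metis finite_keys)
qed

definition push :: "(nat \<Rightarrow> nat) \<Rightarrow> mon \<Rightarrow> mon" where
  "push \<rho> m = (\<Sum>i\<in>keys m. single (\<rho> i) (lookup m i))"

lemma var_power: "var i ^ n = single (single i n) 1"
  by (induction n) (simp_all add: var_def mult_single single_add[symmetric])

lemma prod_single:
  "finite A \<Longrightarrow> (\<Prod>i\<in>A. single (h i) (c i :: 'a::comm_semiring_1)) =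
     single (\<Sum>i\<in>A. h i) (\<Prod>i\<in>A. c i)"
  by (induction A rule: finite_induct) (simp_all add: mult_single)

lemma lookup_pol_subst:
  assumes "\<And>m. m \<in> keys f \<Longrightarrow> push \<rho> m = m' \<longleftrightarrow> m = m0"
    and "\<sigma> = (\<lambda>i. cst (\<kappa> i) * var (\<rho> i))"
  shows "lookup (pol_subst \<sigma> f) m' = lookup f m0 *
    (\<Prod>i\<in>keys m0. \<kappa> i ^ lookup m0 i)"
proof -
  let ?C = "\<lambda>m. (\<Prod>i\<in>keys m. \<kappa> i ^ lookup m i)"
  have P: "(\<Prod>i\<in>keys m. \<sigma> i ^ lookup m i) = single (push \<rho> m) (?C m)" for m
  proof -
    have "\<sigma> i ^ n = single (single (\<rho> i) n) (\<kappa> i ^ n)" for i n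
      unfolding assms(2) power_mult_distrib var_power cst_power[symmetric]
      by (simp add: cst_def mult_single)
    then show ?thesis by (simp add: prod_single push_def)
  qed
  have "lookup (pol_subst \<sigma> f) m' =
      (\<Sum>m\<in>keys f. lookup f m * (?C m when push \<rho> m = m'))"
    unfolding pol_subst_def P by (simp add: lookup_sum lookup_single)
  also have "\<dots> = (\<Sum>m\<in>keys f. if m = m0 then lookup f m * ?C m else 0)"
    by (rule sum.cong) (use assms(1) in \<open>auto simp: when_def\<close>)
  also have "\<dots> = lookup f m0 * ?C m0"
    by (simp add: in_keys_iff)
  finally show ?thesis .
qed

lemma lookup_push:
  assumes "\<And>i. i \<in> keys m \<Longrightarrow> \<rho> i = r \<longleftrightarrow> i = r'"
  shows "lookup (push \<rho> m) r = lookup m r'"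
proof -
  have "lookup (push \<rho> m) r =
      (\<Sum>i\<in>keys m. if i = r' then lookup m i else 0)"
    unfolding push_def lookup_sum
    by (rule sum.cong) (use assms in \<open>auto simp: lookup_single when_def\<close>)
  also have "\<dots> = lookup m r'" by (simp add: in_keys_iff)
  finally show ?thesis .
qed

abbreviation swap_mon :: "nat \<Rightarrow> mon \<Rightarrow> mon" where
  "swap_mon j m \<equiv> Poly_Mapping.map_key (transpose j (Suc j)) m"

lemma lookup_swap_mon [simp]:
  "lookup (swap_mon j m) r = lookup m (transpose j (Suc j) r)"
  by (simp add: map_key.rep_eq)

lemma swap_mon_swap_mon [simp]: "swap_mon j (swap_mon j m) = m"
  by (rule poly_mapping_eqI) simp

lemma swap_mon_add: "swap_mon j (m + n) = swap_mon j m + swap_mon j n"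
  by (rule poly_mapping_eqI) (simp add: lookup_add)

lemma lookup_s_pol [simp]: "lookup (s_pol j f) m = lookup f (swap_mon j m)"
proof -
  have P: "push (transpose j (Suc j)) n = swap_mon j n" for n
  proof (rule poly_mapping_eqI)
    fix r
    have "transpose j (Suc j) i = r \<longleftrightarrow> i = transpose j (Suc j) r" for i
      by (metis transpose_involutory)
    then show "lookup (push (transpose j (Suc j)) n) r = lookup (swap_mon j n) r"
      by (simp add: lookup_push)
  qed
  have "push (transpose j (Suc j)) n = m \<longleftrightarrow> n = swap_mon j m" for n
    unfolding P by (metis swap_mon_swap_mon)
  then show ?thesis
    unfolding s_pol_def by (subst lookup_pol_subst[where \<kappa> = "\<lambda>_. 1"]) (auto simp: cst_simps)
qed

lemma lookup_proj:
  "lookup (proj k f) m = (if k \<in> keys m then 0 else lookup f m)"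
proof -
  have "push (\<lambda>i. i) n = n" for n
    by (rule poly_mapping_eqI) (simp add: lookup_push)
  then have "lookup (proj k f) m = lookup f m *
    (\<Prod>i\<in>keys m. (if i = k then 0 else 1) ^ lookup m i)"
    unfolding proj_def by (intro lookup_pol_subst[where \<rho> = "\<lambda>i. i"]) (auto simp: cst_simps)
  also have "(\<Prod>i\<in>keys m. (if i = k then 0 else 1) ^ lookup m i) =
      (if k \<in> keys m then 0 else 1 :: K)"
  proof (cases "k \<in> keys m")
    case True
    then show ?thesis by (auto simp: in_keys_iff intro!: prod_zero)
  next
    case False
    then show ?thesis by (auto intro!: prod.neutral)
  qed
  finally show ?thesis by simp
qed

lemma s_pol_add: "s_pol j (f + g) = s_pol j f + s_pol j g"
  by (rule poly_mapping_eqI) (simp add: lookup_add)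

lemma s_pol_diff: "s_pol j (f - g) = s_pol j f - s_pol j g"
  by (rule poly_mapping_eqI) (simp add: lookup_minus)

lemma s_pol_s_pol [simp]: "s_pol j (s_pol j f) = f"
  by (rule poly_mapping_eqI) simp

lemma s_pol_single: "s_pol j (single m c) = single (swap_mon j m) c"
  by (rule poly_mapping_eqI) (auto simp: lookup_single when_def)

lemma s_pol_mult: "s_pol j (f * g) = s_pol j f * s_pol j g"
proof (induction f rule: pol_induct)
  case (single m c)
  show ?case
    by (induction g rule: pol_induct)
      (simp_all add: s_pol_single mult_single swap_mon_add s_pol_add distrib_left)
qed (simp add: s_pol_add distrib_right)

lemma s_pol_var: "s_pol j (var i) = var (transpose j (Suc j) i)"
proof -
  have "swap_mon j (single i (1::nat)) = single (transpose j (Suc j) i) 1"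
    by (rule poly_mapping_eqI) (auto simp: lookup_single when_def)
  then show ?thesis by (simp add: var_def s_pol_single)
qed

lemma s_pol_cst: "s_pol j (cst c) = cst c"
proof -
  have "swap_mon j 0 = (0 :: mon)" by (rule poly_mapping_eqI) simp
  then show ?thesis by (simp add: cst_def s_pol_single)
qed

lemmas s_pol_hom = s_pol_add s_pol_diff s_pol_mult s_pol_var s_pol_cst

section \<open>Demazure--Lusztig operators\<close>

definition xdiff :: "nat \<Rightarrow> pol" where "xdiff j = var j - var (Suc j)"

lemma single_inject:
  assumes "c \<noteq> 0" "single a c = single b c" shows "a = b"
  using assms(1) arg_cong[OF assms(2), of keys] by simp

lemma var_inject: "var i = var j \<longleftrightarrow> i = j"
proof
  assume "var i = var j"
  then have "single i (1::nat) = single j 1"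
    unfolding var_def by (rule single_inject[of "1::K", rotated]) simp
  then show "i = j" by (rule single_inject[of "1::nat", rotated]) simp
qed simp

lemma xdiff_nz: "xdiff j \<noteq> 0"
  by (simp add: xdiff_def var_inject)

text \<open>The polynomials \<open>f\<close> with this property form a subring, since
  \<open>fg - s(fg) = (f - s f) g + s f (g - s g)\<close>, and it contains constants and variables.\<close>

lemma divided_difference_exists: "\<exists>g. xdiff j * g = f - s_pol j f"
proof (induction f rule: pol_induct)
  case (single m c)
  define D where "D f \<longleftrightarrow> (\<exists>g. xdiff j * g = f - s_pol j f)" for f
  have mult: "D (f * g)" if fg: "D f" "D g" for f g
  proof -
    obtain u v where uv: "xdiff j * u = f - s_pol j f" "xdiff j * v = g - s_pol j g"
      using fg by (auto simp: D_def)
    have "xdiff j * (u * g + s_pol j f * v) = (xdiff j * u) * g + s_pol j f * (xdiff j * v)"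
      by (simp add: algebra_simps)
    also have "\<dots> = f * g - s_pol j (f * g)"
      unfolding uv by (simp add: s_pol_mult algebra_simps)
    finally show ?thesis by (auto simp: D_def)
  qed
  have cst: "D (cst a)" for a unfolding D_def by (rule exI[of _ 0]) (simp add: s_pol_cst)
  have var: "D (var i)" for i
  proof -
    have "xdiff j * (if i = j then 1 else if i = Suc j then - 1 else 0) = var i - s_pol j (var i)"
      by (auto simp: s_pol_var xdiff_def transpose_def)
    then show ?thesis by (auto simp: D_def)
  qed
  have power: "D (f ^ n)" if "D f" for f n
    by (induction n) (use cst[of 1] mult that in \<open>auto simp: cst_simps\<close>)
  have prod: "D (\<Prod>i\<in>A. var i ^ e i)" if "finite A" for A and e :: "nat \<Rightarrow> nat"
    using that by (induction A rule: finite_induct) (use cst[of 1] mult power var in \<open>auto simp: cst_simps\<close>)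
  have "single m c = cst c * (\<Prod>i\<in>keys m. var i ^ lookup m i)"
    using pol_sum_monomials[of m] by (simp add: var_power prod_single cst_def mult_single)
  then show ?case using mult[OF cst prod] D_def by simp
next
  case (add f g)
  then obtain u v where "xdiff j * u = f - s_pol j f" "xdiff j * v = g - s_pol j g" by blast
  then have "xdiff j * (u + v) = f + g - s_pol j (f + g)" by (simp add: s_pol_add distrib_left)
  then show ?case by blast
qed

abbreviation tP :: pol where "tP \<equiv> cst tK"

text \<open>Clearing the denominator characterises \<open>T\<^sub>j\<close> by an identity in a domain; the algebraic relations
  between these operators are then polynomial identities.\<close>

lemma T_op_char:
  "xdiff j * T_op j f = (1 - tP) * var j * f + (tP * var j - var (Suc j)) * s_pol j f"
proof -
  obtain g where g: "xdiff j * g = f - s_pol j f" using divided_difference_exists by blast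
  have "(THE g. (var j - var (Suc j)) * g = f - s_pol j f) = g"
  proof (rule the_equality)
    show "(var j - var (Suc j)) * g = f - s_pol j f" using g by (simp add: xdiff_def)
    fix h assume "(var j - var (Suc j)) * h = f - s_pol j f"
    then have "xdiff j * h = xdiff j * g" using g by (simp add: xdiff_def)
    then show "h = g" using xdiff_nz by simp
  qed
  then have "xdiff j * T_op j f = xdiff j * s_pol j f + cst (1 - tK) * var j * (xdiff j * g)"
    by (simp add: T_op_def distrib_left mult.left_commute mult.assoc)
  also have "\<dots> = (1 - tP) * var j * f + (tP * var j - var (Suc j)) * s_pol j f"
    unfolding g by (simp add: xdiff_def cst_simps algebra_simps)
  finally show ?thesis .
qed

lemma T_op_eqI:
  assumes "xdiff j * g = (1 - tP) * var j * f + (tP * var j - var (Suc j)) * s_pol j f"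
  shows "T_op j f = g"
proof -
  have "xdiff j * T_op j f = xdiff j * g" using assms T_op_char by simp
  then show ?thesis using xdiff_nz by simp
qed

lemma T_op_add: "T_op j (f + g) = T_op j f + T_op j g"
  by (rule T_op_eqI) (simp add: distrib_left T_op_char s_pol_add)

lemma T_op_diff: "T_op j (f - g) = T_op j f - T_op j g"
  by (rule T_op_eqI) (simp add: right_diff_distrib T_op_char s_pol_diff)

lemma T_op_cst_mult: "T_op j (cst c * f) = cst c * T_op j f"
proof (rule T_op_eqI)
  have "xdiff j * (cst c * T_op j f) = cst c * (xdiff j * T_op j f)" by (simp add: mult.left_commute)
  also have "\<dots> = (1 - tP) * var j * (cst c * f) + (tP * var j - var (Suc j)) * s_pol j (cst c * f)"
    unfolding T_op_char by (simp add: s_pol_hom algebra_simps)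
  finally show "xdiff j * (cst c * T_op j f) =
    (1 - tP) * var j * (cst c * f) + (tP * var j - var (Suc j)) * s_pol j (cst c * f)" .
qed

lemma s_pol_xdiff: "s_pol j (xdiff j) = - xdiff j"
  by (simp add: xdiff_def s_pol_diff s_pol_var)

lemma s_pol_T_op:
  "xdiff j * s_pol j (T_op j f) = - ((1 - tP) * var (Suc j) * s_pol j f + (tP * var (Suc j) - var j) * f)"
proof -
  have "s_pol j (xdiff j * T_op j f) =
    (1 - tP) * var (Suc j) * s_pol j f + (tP * var (Suc j) - var j) * f"
    unfolding T_op_char by (simp add: s_pol_hom cst_simps(2)[symmetric] del: cst_simps(2))
  then have "- (xdiff j * s_pol j (T_op j f)) =
    (1 - tP) * var (Suc j) * s_pol j f + (tP * var (Suc j) - var j) * f"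
    by (simp add: s_pol_mult s_pol_xdiff)
  then show ?thesis by (metis minus_minus)
qed

lemma T_op_quadratic: "T_op j (T_op j f) = (1 - tP) * T_op j f + tP * f"
proof (rule T_op_eqI)
  let ?D = "xdiff j" and ?x = "var j" and ?y = "var (Suc j)"
  define S where "S = s_pol j f"
  define A where "A = T_op j f"
  define B where "B = s_pol j (T_op j f)"
  have a: "?D * A = (1 - tP) * ?x * f + (tP * ?x - ?y) * S"
    unfolding A_def S_def by (rule T_op_char)
  have b: "?D * B = - ((1 - tP) * ?y * S + (tP * ?y - ?x) * f)"
    unfolding B_def S_def by (rule s_pol_T_op)
  have D: "?D = ?x - ?y" by (simp add: xdiff_def)
  have "?D * (?D * ((1 - tP) * A + tP * f)) = ?D * ((1 - tP) * (?D * A) + ?D * (tP * f))"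
    by (simp add: algebra_simps)
  also have "\<dots> = (1 - tP) * ?x * (?D * A) + (tP * ?x - ?y) * (?D * B)"
    unfolding a b unfolding D by (simp add: algebra_simps)
  also have "\<dots> = ?D * ((1 - tP) * ?x * A + (tP * ?x - ?y) * B)"
    by (simp add: algebra_simps)
  finally show "?D * ((1 - tP) * T_op j f + tP * f) =
    (1 - tP) * ?x * T_op j f + (tP * ?x - ?y) * s_pol j (T_op j f)"
    using xdiff_nz[of j] unfolding A_def B_def by simp
qed

lemma tK_nz [simp]: "tK \<noteq> 0"
  by (simp add: tK_def eq_fract Zero_fract_def)

definition T_inv :: "nat \<Rightarrow> pol \<Rightarrow> pol" where
  "T_inv j f = cst (1 / tK) * (T_op j f - (1 - tP) * f)"

lemma cst_inv: "cst (1 / tK) * (tP * f) = f"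
proof -
  have "cst (1 / tK) * tP = 1" unfolding cst_simps(5)[symmetric] by (simp add: cst_simps)
  then show ?thesis by (simp add: mult.assoc[symmetric])
qed

lemma one_minus_tP: "1 - tP = cst (1 - tK)" by (simp add: cst_simps)

lemma T_op_T_inv: "T_op j (T_inv j f) = f"
proof -
  have "T_op j (T_inv j f) = cst (1 / tK) * (T_op j (T_op j f) - (1 - tP) * T_op j f)"
    unfolding T_inv_def one_minus_tP by (simp only: T_op_cst_mult T_op_diff)
  then show ?thesis by (simp add: T_op_quadratic cst_inv)
qed

lemma T_inv_T_op: "T_inv j (T_op j f) = f"
  by (simp add: T_inv_def T_op_quadratic cst_inv)

text \<open>A polynomial is symmetric in \<open>x\<^sub>j, x\<^bsub>j+1\<^esub>\<close> iff it is fixed by \<open>T\<^sub>j\<close>; this trades symmetry, which is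
  awkward to carry through \<open>T\<^sub>i\<close>, for braid relations.\<close>

lemma T_op_fix: "T_op j f = f \<longleftrightarrow> s_pol j f = f"
proof
  assume "s_pol j f = f"
  then show "T_op j f = f" by (intro T_op_eqI) (simp add: xdiff_def algebra_simps)
next
  assume "T_op j f = f"
  then have "xdiff j * f = (1 - tP) * var j * f + (tP * var j - var (Suc j)) * s_pol j f"
    using T_op_char by metis
  then have "(tP * var j - var (Suc j)) * (f - s_pol j f) = 0"
    by (simp add: xdiff_def algebra_simps)
  moreover have "tP * var j \<noteq> var (Suc j)"
  proof
    let ?m = "single (Suc j) (1::nat)"
    assume "tP * var j = var (Suc j)"
    then have "lookup (tP * var j) ?m = lookup (var (Suc j)) ?m" by simp
    moreover have "single j (1::nat) \<noteq> ?m"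
      using single_inject[of "1::nat" j "Suc j"] by auto
    ultimately show False by (simp add: var_def lookup_single_not_eq)
  qed
  ultimately show "s_pol j f = f" by simp
qed

lemma T_inv_fix: "s_pol j f = f \<Longrightarrow> T_inv j f = f"
  using T_inv_T_op[of j f] T_op_fix[of j f] by simp

lemma s_pol_commute:
  assumes "Suc i < j \<or> Suc j < i" shows "s_pol i (s_pol j f) = s_pol j (s_pol i f)"
proof (rule poly_mapping_eqI)
  fix m
  have "swap_mon j (swap_mon i m) = swap_mon i (swap_mon j m)"
    by (rule poly_mapping_eqI) (use assms in \<open>auto simp: transpose_def\<close>)
  then show "lookup (s_pol i (s_pol j f)) m = lookup (s_pol j (s_pol i f)) m"
    by simp
qed

lemma s_pol_T_op_far:
  assumes "Suc i < j \<or> Suc j < i" shows "s_pol i (T_op j f) = T_op j (s_pol i f)"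
proof (rule T_op_eqI[symmetric])
  have "s_pol i (xdiff j * T_op j f) = xdiff j * s_pol i (T_op j f)"
    using assms by (auto simp: s_pol_hom xdiff_def transpose_def)
  moreover have "s_pol i ((1 - tP) * var j * f + (tP * var j - var (Suc j)) * s_pol j f)
    = (1 - tP) * var j * s_pol i f + (tP * var j - var (Suc j)) * s_pol j (s_pol i f)"
    using assms s_pol_commute[OF assms, of f] unfolding one_minus_tP
    by (auto simp: s_pol_hom transpose_def)
  ultimately show "xdiff j * s_pol i (T_op j f) =
    (1 - tP) * var j * s_pol i f + (tP * var j - var (Suc j)) * s_pol j (s_pol i f)"
    unfolding T_op_char by simp
qed

lemma s_pol_T_inv_far:
  assumes "Suc i < j \<or> Suc j < i" shows "s_pol i (T_inv j f) = T_inv j (s_pol i f)"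
  unfolding T_inv_def one_minus_tP by (simp add: s_pol_hom s_pol_T_op_far[OF assms])

text \<open>After multiplication by all differences of the three variables both sides are combinations of the
  six images of \<open>f\<close> under permutations of these variables, with the same coefficients.\<close>

lemma T_op_braid:
  "T_op j (T_op (Suc j) (T_op j f)) = T_op (Suc j) (T_op j (T_op (Suc j) f))"
proof -
  let ?k = "Suc j"
  define x y z where "x = var j" and "y = var ?k" and "z = var (Suc ?k)"
  define p q where "p = s_pol j" and "q = s_pol ?k"
  have pv: "p x = y" "p y = x" "p z = z" "q x = x" "q y = z" "q z = y"
    by (simp_all add: p_def q_def x_def y_def z_def s_pol_var transpose_def)
  have ph: "p (g + h) = p g + p h" "p (g - h) = p g - p h" "p (g * h) = p g * p h" "p tP = tP"
    "p 1 = 1" "p (p g) = g" for g h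
    using s_pol_cst[of j 1] by (simp_all add: p_def s_pol_hom cst_simps)
  have qh: "q (g + h) = q g + q h" "q (g - h) = q g - q h" "q (g * h) = q g * q h" "q tP = tP"
    "q 1 = 1" "q (q g) = g" for g h
    using s_pol_cst[of ?k 1] by (simp_all add: q_def s_pol_hom cst_simps)
  have qpq: "q (p (q g)) = p (q (p g))" for g
  proof (rule poly_mapping_eqI)
    fix m
    have "swap_mon ?k (swap_mon j (swap_mon ?k m)) = swap_mon j (swap_mon ?k (swap_mon j m))"
      by (rule poly_mapping_eqI) (auto simp: transpose_def)
    then show "lookup (q (p (q g))) m = lookup (p (q (p g))) m"
      by (simp add: p_def q_def)
  qed
  have T: "(x - y) * T_op j g = (1 - tP) * x * g + (tP * x - y) * p g" for g
    using T_op_char[of j g] by (simp add: xdiff_def x_def y_def p_def)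
  have U: "(y - z) * T_op ?k g = (1 - tP) * y * g + (tP * y - z) * q g" for g
    using T_op_char[of ?k g] by (simp add: xdiff_def y_def z_def q_def)
  have qT: "(x - z) * q (T_op j g) = (1 - tP) * x * q g + (tP * x - z) * q (p g)" for g
    using arg_cong[OF T[of g], of q] by (simp add: qh pv)
  have pqT: "(y - z) * p (q (T_op j g)) = (1 - tP) * y * p (q g) + (tP * y - z) * p (q (p g))" for g
    using arg_cong[OF qT[of g], of p] by (simp add: ph pv)
  have pT: "(y - x) * p (T_op j g) = (1 - tP) * y * p g + (tP * y - x) * g" for g
    using arg_cong[OF T[of g], of p] by (simp add: ph pv)
  have pU: "(x - z) * p (T_op ?k g) = (1 - tP) * x * p g + (tP * x - z) * p (q g)" for g
    using arg_cong[OF U[of g], of p] by (simp add: ph pv)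
  have qU: "(z - y) * q (T_op ?k g) = (1 - tP) * z * q g + (tP * z - y) * g" for g
    using arg_cong[OF U[of g], of q] by (simp add: qh pv)
  have qpU: "(x - y) * q (p (T_op ?k g)) = (1 - tP) * x * q (p g) + (tP * x - y) * q (p (q g))" for g
    using arg_cong[OF pU[of g], of q] by (simp add: qh pv)
  have nz: "x - y \<noteq> 0" "y - z \<noteq> 0" "x - z \<noteq> 0"
    by (simp_all add: x_def y_def z_def var_inject)
  define A B C where "A = T_op j f" and "B = T_op ?k A" and "C = T_op j B"
  define A' B' C' where "A' = T_op ?k f" and "B' = T_op j A'" and "C' = T_op ?k B'"
  define D where "D = (x - y) * (y - z) * (x - z)"
  have AA: "(x - y) * A = (1 - tP) * x * f + (tP * x - y) * p f"
    "(x - z) * q A = (1 - tP) * x * q f + (tP * x - z) * q (p f)"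
    "(y - x) * p A = (1 - tP) * y * p f + (tP * y - x) * f"
    "(y - z) * p (q A) = (1 - tP) * y * p (q f) + (tP * y - z) * p (q (p f))"
    unfolding A_def by (rule T qT pT pqT)+
  have BB: "(y - z) * B = (1 - tP) * y * A + (tP * y - z) * q A"
    "(x - z) * p B = (1 - tP) * x * p A + (tP * x - z) * p (q A)"
    unfolding B_def by (rule U pU)+
  have CC: "(x - y) * C = (1 - tP) * x * B + (tP * x - y) * p B"
    unfolding C_def by (rule T)
  have AA': "(y - z) * A' = (1 - tP) * y * f + (tP * y - z) * q f"
    "(x - z) * p A' = (1 - tP) * x * p f + (tP * x - z) * p (q f)"
    "(z - y) * q A' = (1 - tP) * z * q f + (tP * z - y) * f"
    "(x - y) * q (p A') = (1 - tP) * x * q (p f) + (tP * x - y) * p (q (p f))"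
    unfolding A'_def qpq[symmetric] by (rule U pU qU qpU)+
  have BB': "(x - y) * B' = (1 - tP) * x * A' + (tP * x - y) * p A'"
    "(x - z) * q B' = (1 - tP) * x * q A' + (tP * x - z) * q (p A')"
    unfolding B'_def by (rule T qT)+
  have CC': "(y - z) * C' = (1 - tP) * y * B' + (tP * y - z) * q B'"
    unfolding C'_def by (rule U)
  have DB: "D * B = (1 - tP) * y * (x - z) * ((1 - tP) * x * f + (tP * x - y) * p f)
    + (tP * y - z) * (x - y) * ((1 - tP) * x * q f + (tP * x - z) * q (p f))"
    unfolding AA(1,2)[symmetric] D_def using BB(1) by algebra
  have DpB: "D * p B = (1 - tP) * x * (z - y) * ((1 - tP) * y * p f + (tP * y - x) * f)
    + (tP * x - z) * (x - y) * ((1 - tP) * y * p (q f) + (tP * y - z) * p (q (p f)))"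
    unfolding AA(3,4)[symmetric] D_def using BB(2) by algebra
  have DB': "D * B' = (1 - tP) * x * (x - z) * ((1 - tP) * y * f + (tP * y - z) * q f)
    + (tP * x - y) * (y - z) * ((1 - tP) * x * p f + (tP * x - z) * p (q f))"
    unfolding AA'(1,2)[symmetric] D_def using BB'(1) by algebra
  have DqB': "D * q B' = (1 - tP) * x * (y - x) * ((1 - tP) * z * q f + (tP * z - y) * f)
    + (tP * x - z) * (y - z) * ((1 - tP) * x * q (p f) + (tP * x - y) * p (q (p f)))"
    unfolding AA'(3,4)[symmetric] D_def using BB'(2) by algebra
  have "D * ((x - y) * (y - z) * C) =
      (y - z) * ((1 - tP) * x * (D * B) + (tP * x - y) * (D * p B))"
    using CC by algebra
  also have "\<dots> = (x - y) * ((1 - tP) * y * (D * B') + (tP * y - z) * (D * q B'))"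
    unfolding DB DpB DB' DqB' by algebra
  also have "\<dots> = D * ((x - y) * (y - z) * C')"
    using CC' by algebra
  finally have "C = C'" using nz by (simp add: D_def)
  then show ?thesis by (simp add: C_def B_def A_def C'_def B'_def A'_def)
qed

section \<open>Coefficients of the operators\<close>

definition upd2 :: "nat \<Rightarrow> nat \<Rightarrow> nat \<Rightarrow> mon \<Rightarrow> mon" where
  "upd2 j a b m = Poly_Mapping.update j a (Poly_Mapping.update (Suc j) b m)"

lemma lookup_upd2:
  "lookup (upd2 j a b m) r =
     (if r = j then a else if r = Suc j then b else lookup m r)"
  by (simp add: upd2_def lookup_update)

text \<open>The coefficient of \<open>x\<^sub>j\<^sup>c x\<^bsub>j+1\<^esub>\<^sup>d\<close> in the image under \<open>T\<^sub>j\<close> of \<open>x\<^sub>j\<^sup>a x\<^bsub>j+1\<^esub>\<^sup>b\<close>, where \<open>c + d = a + b\<close>.\<close>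

definition weight :: "nat \<Rightarrow> nat \<Rightarrow> nat \<Rightarrow> K" where
  "weight a b c = (if c = b then 1 else 0)
     + (1 - tK) * ((if b < c \<and> c \<le> a then 1 else 0) - (if a < c \<and> c \<le> b then 1 else 0))"

definition T_ser :: "nat \<Rightarrow> ser \<Rightarrow> ser" where
  "T_ser j F m = (let c = lookup m j; s = c + lookup m (Suc j) in
     \<Sum>a\<le>s. weight a (s - a) c * F (upd2 j a (s - a) m))"

text \<open>By the quadratic relation this is \<open>t T\<^sub>j\<^sup>-\<^sup>1\<close>, whose coefficients are polynomial in \<open>t\<close>.\<close>

definition tau_ser :: "nat \<Rightarrow> ser \<Rightarrow> ser" where
  "tau_ser j F m = T_ser j F m - (1 - tK) * F m"

lemma geometric_block:
  fixes x y :: "'a::comm_ring_1"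
  assumes "b \<le> a"
  shows "(x - y) * (\<Sum>e\<in>{b<..a}. x ^ e * y ^ (a + b - e)) = x * (x ^ a * y ^ b - x ^ b * y ^ a)"
  using assms
proof (induction a rule: dec_induct)
  case (step n)
  have "{b<..Suc n} = insert (Suc n) {b<..n}" using step by auto
  moreover have "(\<Sum>e\<in>{b<..n}. x ^ e * y ^ (Suc n + b - e)) = y * (\<Sum>e\<in>{b<..n}. x ^ e * y ^ (n + b - e))"
    unfolding sum_distrib_left
  proof (rule sum.cong)
    fix e assume "e \<in> {b<..n}"
    then have "Suc n + b - e = Suc (n + b - e)" by auto
    then show "x ^ e * y ^ (Suc n + b - e) = y * (x ^ e * y ^ (n + b - e))" by (simp add: mult.left_commute)
  qed simp
  ultimately have "(x - y) * (\<Sum>e\<in>{b<..Suc n}. x ^ e * y ^ (Suc n + b - e)) =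
      (x - y) * (x ^ Suc n * y ^ b) + y * ((x - y) * (\<Sum>e\<in>{b<..n}. x ^ e * y ^ (n + b - e)))"
    by (simp add: algebra_simps)
  also have "\<dots> = x * (x ^ Suc n * y ^ b - x ^ b * y ^ Suc n)"
    unfolding step.IH by (simp add: algebra_simps)
  finally show ?case .
qed simp

text \<open>The generating function of the weights satisfies the identity that characterises \<open>T\<^sub>j\<close>: the
  divided difference of a monomial is a block of a geometric series.\<close>

lemma weight_sum:
  fixes x y :: pol
  shows "(x - y) * (\<Sum>e\<le>a + b. cst (weight a b e) * (x ^ e * y ^ (a + b - e))) =
    (1 - tP) * x * (x ^ a * y ^ b) + (tP * x - y) * (x ^ b * y ^ a)"
proof -
  let ?g = "\<lambda>e. x ^ e * y ^ (a + b - e)"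
  have ind: "(\<Sum>e\<le>a + b. (if e \<in> A then ?g e else 0)) = sum ?g A" if "A \<subseteq> {..a + b}" for A
    using sum.inter_restrict[of "{..a + b}" ?g A] that by (simp add: Int_absorb1)
  have "cst (weight a b e) * ?g e = (if e \<in> {b} then ?g e else 0)
      + (1 - tP) * ((if e \<in> {b<..a} then ?g e else 0) - (if e \<in> {a<..b} then ?g e else 0))" for e
    by (simp add: weight_def cst_simps algebra_simps)
  then have "(\<Sum>e\<le>a + b. cst (weight a b e) * ?g e) =
      (\<Sum>e\<le>a + b. (if e \<in> {b} then ?g e else 0))
      + (1 - tP) * ((\<Sum>e\<le>a + b. (if e \<in> {b<..a} then ?g e else 0))
        - (\<Sum>e\<le>a + b. (if e \<in> {a<..b} then ?g e else 0)))"
    by (simp only: sum.distrib sum_distrib_left[symmetric] sum_subtractf)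
  also have "\<dots> = x ^ b * y ^ a + (1 - tP) * (sum ?g {b<..a} - sum ?g {a<..b})"
    by (subst (1 2 3) ind) auto
  finally have E: "(\<Sum>e\<le>a + b. cst (weight a b e) * ?g e) =
      x ^ b * y ^ a + (1 - tP) * (sum ?g {b<..a} - sum ?g {a<..b})" .
  have e: "(x - y) * (\<Sum>e\<le>a + b. cst (weight a b e) * ?g e) =
      (x - y) * (x ^ b * y ^ a) + (1 - tP) * ((x - y) * sum ?g {b<..a} - (x - y) * sum ?g {a<..b})"
    unfolding E by (simp add: algebra_simps)
  have h: "(x - y) * sum ?g {b<..a} - (x - y) * sum ?g {a<..b} = x * (x ^ a * y ^ b - x ^ b * y ^ a)"
  proof (cases "b \<le> a")
    case True
    then show ?thesis using geometric_block[OF True, of x y] by simp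
  next
    case False
    then show ?thesis using geometric_block[of a b x y] by (simp add: add.commute algebra_simps)
  qed
  show ?thesis unfolding e h by (simp add: algebra_simps)
qed

lemma T_op_single:
  defines "a \<equiv> \<lambda>m j. lookup m j"
  shows "T_op j (single m v) =
    (\<Sum>e\<le>a m j + a m (Suc j). single (upd2 j e (a m j + a m (Suc j) - e) m)
       (v * weight (a m j) (a m (Suc j)) e))"
proof -
  let ?a = "lookup m j" and ?b = "lookup m (Suc j)"
  define z where "z = single (upd2 j 0 0 m) v"
  have u: "single (upd2 j e d m) (v * w) = z * (cst w * (var j ^ e * var (Suc j) ^ d))" for e d w
  proof -
    have "upd2 j e d m = upd2 j 0 0 m + (single j e + single (Suc j) d)"
      by (rule poly_mapping_eqI) (simp add: lookup_upd2 lookup_add lookup_single when_def)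
    then show ?thesis by (simp add: z_def var_power mult_single cst_def)
  qed
  have m: "upd2 j ?a ?b m = m" by (rule poly_mapping_eqI) (simp add: lookup_upd2)
  have s: "swap_mon j m = upd2 j ?b ?a m"
    by (rule poly_mapping_eqI) (auto simp: lookup_upd2 transpose_def)
  have f: "single m v = z * (var j ^ ?a * var (Suc j) ^ ?b)"
    using u[of ?a ?b 1] m by (simp add: cst_simps)
  have sf: "s_pol j (single m v) = z * (var j ^ ?b * var (Suc j) ^ ?a)"
    using u[of ?b ?a 1] by (simp add: cst_simps s_pol_single s)
  show ?thesis unfolding a_def
  proof (rule T_op_eqI)
    have "xdiff j * (\<Sum>e\<le>?a + ?b. single (upd2 j e (?a + ?b - e) m) (v * weight ?a ?b e)) =
      z * ((var j - var (Suc j)) * (\<Sum>e\<le>?a + ?b. cst (weight ?a ?b e) * (var j ^ e * var (Suc j) ^ (?a + ?b - e))))"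
      unfolding u xdiff_def sum_distrib_left[symmetric] by (simp add: mult.left_commute)
    also have "\<dots> = (1 - tP) * var j * single m v +
      (tP * var j - var (Suc j)) * s_pol j (single m v)"
      unfolding weight_sum sf unfolding f by (simp add: algebra_simps)
    finally show "xdiff j * (\<Sum>e\<le>?a + ?b. single (upd2 j e (?a + ?b - e) m) (v * weight ?a ?b e)) =
      (1 - tP) * var j * single m v + (tP * var j - var (Suc j)) * s_pol j (single m v)" .
  qed
qed

lemma T_ser_add: "T_ser j (\<lambda>m. F m + G m) m = T_ser j F m + T_ser j G m"
  by (simp add: T_ser_def Let_def distrib_left sum.distrib)

lemma T_ser_scale: "T_ser j (\<lambda>m. c * F m) = (\<lambda>m. c * T_ser j F m)"
  by (simp add: T_ser_def Let_def sum_distrib_left mult.left_commute fun_eq_iff)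

lemma upd2_eq_iff:
  "upd2 j a b m = m' \<longleftrightarrow> lookup m' j = a \<and> lookup m' (Suc j) = b \<and>
     (\<forall>r. r \<noteq> j \<longrightarrow> r \<noteq> Suc j \<longrightarrow> lookup m r = lookup m' r)"
proof
  assume "upd2 j a b m = m'"
  then show "lookup m' j = a \<and> lookup m' (Suc j) = b \<and>
     (\<forall>r. r \<noteq> j \<longrightarrow> r \<noteq> Suc j \<longrightarrow> lookup m r = lookup m' r)"
    by (simp add: lookup_upd2 flip: \<open>upd2 j a b m = m'\<close>)
next
  assume "lookup m' j = a \<and> lookup m' (Suc j) = b \<and>
     (\<forall>r. r \<noteq> j \<longrightarrow> r \<noteq> Suc j \<longrightarrow> lookup m r = lookup m' r)"
  then show "upd2 j a b m = m'" by (intro poly_mapping_eqI) (simp add: lookup_upd2)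
qed

lemma lookup_T_op: "lookup (T_op j f) = T_ser j (lookup f)"
proof (rule ext)
  fix m'
  show "lookup (T_op j f) m' = T_ser j (lookup f) m'"
  proof (induction f rule: pol_induct)
    case (single m v)
    let ?a = "lookup m j" and ?b = "lookup m (Suc j)"
    let ?c = "lookup m' j" and ?d = "lookup m' (Suc j)"
    define rest where "rest \<longleftrightarrow>
      (\<forall>r. r \<noteq> j \<longrightarrow> r \<noteq> Suc j \<longrightarrow> lookup m r = lookup m' r)"
    define agree where "agree \<longleftrightarrow> ?a + ?b = ?c + ?d \<and> rest"
    have l: "upd2 j e (?a + ?b - e) m = m' \<longleftrightarrow> agree \<and> e = ?c" if "e \<le> ?a + ?b" for e
    proof -
      have "upd2 j e (?a + ?b - e) m = m' \<longleftrightarrow> ?c = e \<and> ?d = ?a + ?b - e \<and> rest"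
        by (simp only: upd2_eq_iff rest_def)
      then show ?thesis using that by (auto simp: agree_def)
    qed
    have r: "upd2 j e (?c + ?d - e) m' = m \<longleftrightarrow> agree \<and> e = ?a" if "e \<le> ?c + ?d" for e
    proof -
      have "upd2 j e (?c + ?d - e) m' = m \<longleftrightarrow> ?a = e \<and> ?b = ?c + ?d - e \<and> rest"
        by (simp only: upd2_eq_iff rest_def) (metis (full_types))
      then show ?thesis using that by (auto simp: agree_def)
    qed
    have "lookup (T_op j (single m v)) m' =
        (\<Sum>e\<le>?a + ?b. if e = ?c then (if agree then v * weight ?a ?b e else 0) else 0)"
      unfolding T_op_single lookup_sum
      by (rule sum.cong) (use l in \<open>auto simp: lookup_single when_def\<close>)
    also have "\<dots> = (if agree then v * weight ?a ?b ?c else 0)"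
      by (auto simp: agree_def)
    also have "\<dots> = (\<Sum>e\<le>?c + ?d. if e = ?a then (if agree then v * weight e (?c + ?d - e) ?c else 0) else 0)"
    proof (cases agree)
      case True
      then have "?c + ?d - ?a = ?b" "?a \<le> ?c + ?d" by (auto simp: agree_def)
      then show ?thesis using True by simp
    qed simp
    also have "\<dots> = T_ser j (lookup (single m v)) m'"
      unfolding T_ser_def Let_def
      by (rule sum.cong) (use r in \<open>auto simp: lookup_single when_def mult.commute eq_commute[of m]\<close>)
    finally show ?case .
  next
    case (add f g)
    have "lookup (f + g) = (\<lambda>m. lookup f m + lookup g m)"
      by (simp add: fun_eq_iff lookup_add)
    then show ?case by (simp add: T_op_add lookup_add T_ser_add add)
  qed
qed

lemma lookup_T_inv:
  "lookup (T_inv j f) = (\<lambda>m. 1 / tK * tau_ser j (lookup f) m)"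
  unfolding T_inv_def one_minus_tP by (simp add: fun_eq_iff lookup_minus lookup_T_op tau_ser_def)

lemma keys_upd2:
  assumes "j \<in> S" "Suc j \<in> S"
  shows "keys (upd2 j a b m) \<subseteq> S \<longleftrightarrow> keys m \<subseteq> S"
  using assms unfolding subset_iff in_keys_iff lookup_upd2 by metis

lemma T_ser_nz:
  assumes "T_ser j F m \<noteq> 0"
  obtains a where "a \<le> lookup m j + lookup m (Suc j)"
    "weight a (lookup m j + lookup m (Suc j) - a) (lookup m j) \<noteq> 0"
    "F (upd2 j a (lookup m j + lookup m (Suc j) - a) m) \<noteq> 0"
proof -
  obtain a where "a \<in> {..lookup m j + lookup m (Suc j)}"
    "weight a (lookup m j + lookup m (Suc j) - a) (lookup m j) *
      F (upd2 j a (lookup m j + lookup m (Suc j) - a) m) \<noteq> 0"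
    using assms unfolding T_ser_def Let_def by (rule sum.not_neutral_contains_not_neutral)
  then show ?thesis using that by auto
qed

lemma T_op_Pol:
  assumes "1 \<le> j" "j < k" "f \<in> Pol k" shows "T_op j f \<in> Pol k"
proof -
  have "keys m \<subseteq> {1..k}" if nz: "lookup (T_op j f) m \<noteq> 0" for m
  proof -
    obtain a b where "lookup f (upd2 j a b m) \<noteq> 0"
      using nz unfolding lookup_T_op by (rule T_ser_nz)
    then have "keys (upd2 j a b m) \<subseteq> {1..k}"
      using assms(3) by (simp add: Pol_def in_keys_iff)
    then show ?thesis using keys_upd2[of j "{1..k}"] assms by simp
  qed
  then show ?thesis by (simp add: Pol_def in_keys_iff)
qed

lemma Pol_scale: "f \<in> Pol k \<Longrightarrow> cst c * f \<in> Pol k"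
  by (auto simp: Pol_def in_keys_iff)

lemma Pol_diff: "f \<in> Pol k \<Longrightarrow> g \<in> Pol k \<Longrightarrow> f - g \<in> Pol k"
  unfolding Pol_def in_keys_iff mem_Collect_eq Ball_def lookup_minus by (metis diff_0_right)

lemma T_inv_Pol: "1 \<le> j \<Longrightarrow> j < k \<Longrightarrow> f \<in> Pol k \<Longrightarrow> T_inv j f \<in> Pol k"
  unfolding T_inv_def one_minus_tP by (intro Pol_scale Pol_diff T_op_Pol)

lemma inv_into_T_op:
  assumes "1 \<le> j" "j < k" "f \<in> Pol k" shows "inv_into (Pol k) (T_op j) f = T_inv j f"
proof (rule inv_into_f_eq)
  show "inj_on (T_op j) (Pol k)" by (rule inj_on_inverseI) (rule T_inv_T_op)
qed (use assms T_inv_Pol T_op_T_inv in auto)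

lemma fold_T_inv_Pol:
  assumes "1 \<le> i" "n \<le> k" "f \<in> Pol k"
  shows "fold T_inv [i..<n] f \<in> Pol k"
  using assms(2) by (induction n) (use assms(1,3) T_inv_Pol in auto)

lemma fold_inv_into:
  assumes "1 \<le> i" "n \<le> k" "f \<in> Pol k"
  shows "fold (\<lambda>j. inv_into (Pol k) (T_op j)) [i..<n] f = fold T_inv [i..<n] f"
  using assms(2) by (induction n) (use assms(1,3) fold_T_inv_Pol inv_into_T_op in auto)

text \<open>The cyclic shift of exponents undoing the substitution in the definition of \<open>varpi\<close>.\<close>

definition rot :: "nat \<Rightarrow> mon \<Rightarrow> mon" where
  "rot k = push (\<lambda>i. if i = 1 then k else i - 1)"

lemma lookup_rot:
  assumes "keys m \<subseteq> {1..k}"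
  shows "lookup (rot k m) r =
    (if r = k then lookup m 1 else if r = 0 then 0 else lookup m (Suc r))"
proof -
  have b: "1 \<le> i \<and> i \<le> k" if "i \<in> keys m" for i using assms that by auto
  consider "r = k" | "r \<noteq> k" "r = 0" | "r \<noteq> k" "r \<noteq> 0" by blast
  then show ?thesis
  proof cases
    case 1
    have "lookup (rot k m) r = lookup m 1"
      unfolding rot_def
    proof (rule lookup_push)
      fix i assume "i \<in> keys m"
      then show "(if i = 1 then k else i - 1) = r \<longleftrightarrow> i = 1" using b[of i] 1 by auto
    qed
    then show ?thesis using 1 by simp
  next
    case 2
    have "lookup m 0 = 0" using b[of 0] by (auto simp: in_keys_iff)
    moreover have "lookup (rot k m) r = lookup m 0"
      unfolding rot_def
    proof (rule lookup_push)
      fix i assume "i \<in> keys m"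
      then show "(if i = 1 then k else i - 1) = r \<longleftrightarrow> i = 0" using b[of i] 2 by auto
    qed
    ultimately show ?thesis using 2 by simp
  next
    case 3
    have "lookup (rot k m) r = lookup m (Suc r)"
      unfolding rot_def
    proof (rule lookup_push)
      fix i assume "i \<in> keys m"
      then show "(if i = 1 then k else i - 1) = r \<longleftrightarrow> i = Suc r" using b[of i] 3 by auto
    qed
    then show ?thesis using 3 by simp
  qed
qed

lemma keys_rot:
  assumes "keys m \<subseteq> {1..k}" shows "keys (rot k m) \<subseteq> {1..k}"
proof
  fix r assume "r \<in> keys (rot k m)"
  then have "lookup (rot k m) r \<noteq> 0" by (simp add: in_keys_iff)
  then have "r = k \<and> 1 \<in> keys m \<or> r \<noteq> 0 \<and> Suc r \<in> keys m"
    unfolding lookup_rot[OF assms] by (auto simp: in_keys_iff split: if_splits)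
  then show "r \<in> {1..k}" using assms by auto
qed

definition varpi_ser :: "nat \<Rightarrow> ser \<Rightarrow> ser" where
  "varpi_ser k F m = (if keys m \<subseteq> {1..k} \<and> lookup m 1 > 0
     then qK ^ lookup m 1 * F (rot k m) else 0)"

lemma lookup_pr1:
  "lookup (pr1 f) m = (if 1 \<in> keys m then lookup f m else 0)"
proof -
  have "lookup (pr1 f) m = (\<Sum>n\<in>keys f. if n = m then
      (if 1 \<in> keys m then lookup f m else 0) else 0)"
    unfolding pr1_def lookup_sum by (rule sum.cong) (auto simp: lookup_single when_def)
  then show ?thesis by (simp add: in_keys_iff)
qed

lemma lookup_varpi:
  assumes "1 \<le> k" "f \<in> Pol k"
  shows "lookup (varpi k f) = varpi_ser k (lookup f)"
proof (rule ext)
  fix m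
  let ?s = "\<lambda>i. if i = k then cst qK * var 1 else var (Suc i)"
  let ?\<kappa> = "\<lambda>i. if i = k then qK else 1" and ?\<rho> = "\<lambda>i. if i = k then 1 else Suc i"
  have s: "?s = (\<lambda>i. cst (?\<kappa> i) * var (?\<rho> i))" by (auto simp: cst_simps)
  have kf: "keys n \<subseteq> {1..k}" if "n \<in> keys f" for n
    using assms(2) that by (simp add: Pol_def)
  have p1: "lookup (push ?\<rho> n) 1 = lookup n k"
    and pS: "1 \<le> r \<Longrightarrow> r < k \<Longrightarrow> lookup (push ?\<rho> n) (Suc r) = lookup n r"
    and p0: "r \<notin> {1..k} \<Longrightarrow> lookup (push ?\<rho> n) r = 0"
    if n: "keys n \<subseteq> {1..k}" for n r
  proof -
    have b: "1 \<le> i \<and> i \<le> k" if "i \<in> keys n" for i using n that by auto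
    show "lookup (push ?\<rho> n) 1 = lookup n k"
    proof (rule lookup_push)
      fix i assume "i \<in> keys n"
      then show "?\<rho> i = 1 \<longleftrightarrow> i = k" using b[of i] by auto
    qed
    show "lookup (push ?\<rho> n) (Suc r) = lookup n r" if "1 \<le> r" "r < k"
    proof (rule lookup_push)
      fix i assume "i \<in> keys n"
      then show "?\<rho> i = Suc r \<longleftrightarrow> i = r" using b[of i] that by auto
    qed
    show "lookup (push ?\<rho> n) r = 0" if "r \<notin> {1..k}"
    proof -
      have "lookup (push ?\<rho> n) r = lookup n 0"
      proof (rule lookup_push)
        fix i assume "i \<in> keys n"
        then show "?\<rho> i = r \<longleftrightarrow> i = 0" using b[of i] that assms(1) by auto
      qed
      also have "\<dots> = 0" using b[of 0] by (auto simp: in_keys_iff)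
      finally show ?thesis .
    qed
  qed
  show "lookup (varpi k f) m = varpi_ser k (lookup f) m"
  proof (cases "keys m \<subseteq> {1..k}")
    case True
    have "push ?\<rho> n = m \<longleftrightarrow> n = rot k m" if "n \<in> keys f" for n
    proof
      note n = kf[OF that]
      assume e: "push ?\<rho> n = m"
      show "n = rot k m"
      proof (rule poly_mapping_eqI)
        fix r
        consider "r = k" | "1 \<le> r" "r < k" | "r \<notin> {1..k}" by fastforce
        then show "lookup n r = lookup (rot k m) r"
        proof cases
          case 1 then show ?thesis using p1[OF n] e by (simp add: lookup_rot[OF True])
        next
          case 2 then show ?thesis using pS[OF n, of r] e by (simp add: lookup_rot[OF True])
        next
          case 3 then show ?thesis using n keys_rot[OF True] by (metis in_keys_iff subset_iff)
        qed
      qed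
    next
      assume e: "n = rot k m"
      note n = keys_rot[OF True]
      show "push ?\<rho> n = m"
      proof (rule poly_mapping_eqI)
        fix r
        consider "r = 1" | "2 \<le> r" "r \<le> k" | "r \<notin> {1..k}" using assms(1) by fastforce
        then show "lookup (push ?\<rho> n) r = lookup m r"
        proof cases
          case 1 then show ?thesis using p1[OF n] unfolding e by (simp add: lookup_rot[OF True])
        next
          case 2
          then obtain u where "r = Suc u" "1 \<le> u" "u < k" by (cases r) auto
          then show ?thesis using pS[OF n, of u] unfolding e by (simp add: lookup_rot[OF True])
        next
          case 3 then show ?thesis using p0[OF n] True unfolding e by (metis in_keys_iff subset_iff)
        qed
      qed
    qed
    note L = lookup_pol_subst[OF this s]
    have "(\<Prod>i\<in>keys (rot k m). ?\<kappa> i ^ lookup (rot k m) i) =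
        (\<Prod>i\<in>keys (rot k m). if i = k then qK ^ lookup m 1 else 1)"
      by (rule prod.cong) (auto simp: lookup_rot[OF True])
    also have "\<dots> = qK ^ lookup m 1"
      using lookup_rot[OF True, of k] by (auto simp: in_keys_iff)
    finally show ?thesis
      using L True by (auto simp: varpi_def varpi_ser_def lookup_pr1 in_keys_iff)
  next
    case False
    let ?z = "single 0 1 :: mon"
    have z: "?z \<notin> keys f" using kf[of ?z] by auto
    have "push ?\<rho> n = m \<longleftrightarrow> n = ?z" if n: "n \<in> keys f" for n
    proof -
      obtain r where "r \<in> keys m" "r \<notin> {1..k}" using False by blast
      then have "push ?\<rho> n \<noteq> m" using p0[OF kf[OF n], of r] by (auto simp: in_keys_iff)
      then show ?thesis using n z by auto
    qed
    from lookup_pol_subst[OF this s] show ?thesis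
      using z False by (simp add: varpi_def varpi_ser_def lookup_pr1 in_keys_iff)
  qed
qed

lemma varpi_Pol:
  assumes "1 \<le> k" "f \<in> Pol k" shows "varpi k f \<in> Pol k"
proof -
  have "keys m \<subseteq> {1..k}" if "lookup (varpi k f) m \<noteq> 0" for m
    using that unfolding lookup_varpi[OF assms] by (simp add: varpi_ser_def split: if_splits)
  then show ?thesis by (simp add: Pol_def in_keys_iff)
qed

section \<open>The finite operators on coefficients\<close>

lemma tau_ser_scale: "tau_ser j (\<lambda>m. c * F m) = (\<lambda>m. c * tau_ser j F m)"
  by (simp add: tau_ser_def T_ser_scale fun_eq_iff algebra_simps)

lemma fold_T_ser_scale: "fold T_ser js (\<lambda>m. c * F m) = (\<lambda>m. c * fold T_ser js F m)"
  by (induction js arbitrary: F) (simp_all add: T_ser_scale)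

lemma varpi_ser_scale: "varpi_ser k (\<lambda>m. c * F m) = (\<lambda>m. c * varpi_ser k F m)"
  by (auto simp: varpi_ser_def fun_eq_iff)

lemma lookup_fold_T_op: "lookup (fold T_op js f) = fold T_ser js (lookup f)"
  by (induction js arbitrary: f) (simp_all add: lookup_T_op)

lemma lookup_fold_T_inv:
  assumes "i \<le> n"
  shows "lookup (fold T_inv [i..<n] f) =
    (\<lambda>m. (1 / tK) ^ (n - i) * fold tau_ser [i..<n] (lookup f) m)"
  using assms
proof (induction n rule: dec_induct)
  case (step n)
  have "Suc n - i = Suc (n - i)" using step by simp
  then show ?case using step
    by (simp add: lookup_T_inv tau_ser_scale)
qed simp

lemma fold_T_op_Pol:
  assumes "n \<le> k" "f \<in> Pol k" shows "fold T_op [1..<n] f \<in> Pol k"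
  using assms(1) by (induction n) (use assms(2) T_op_Pol in auto)

lemma Y_fin_Pol:
  assumes "1 \<le> i" "i \<le> k" "f \<in> Pol k" shows "Y_fin i k f \<in> Pol k"
  unfolding Y_fin_def using assms
  by (intro Pol_scale fold_T_op_Pol varpi_Pol) (simp_all add: fold_inv_into fold_T_inv_Pol)

lemma lookup_Y_fin:
  assumes "1 \<le> i" "i \<le> k" "f \<in> Pol k"
  shows "lookup (Y_fin i k f) =
    (\<lambda>m. tK * fold T_ser [1..<i] (varpi_ser k (fold tau_ser [i..<k] (lookup f))) m)"
proof -
  have "tK ^ (k + 1 - i) * (1 / tK) ^ (k - i) = tK"
    using assms(2) by (simp add: Suc_diff_le power_divide)
  moreover have "varpi k (fold T_inv [i..<k] f) \<in> Pol k"
    using assms by (intro varpi_Pol fold_T_inv_Pol) auto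
  ultimately show ?thesis
    using assms unfolding Y_fin_def fold_inv_into[OF assms(1) order_refl assms(3)]
    by (simp add: fun_eq_iff lookup_fold_T_op lookup_varpi fold_T_inv_Pol lookup_fold_T_inv
        varpi_ser_scale fold_T_ser_scale mult.assoc[symmetric] del: power_divide)
qed

lemma lookup_le_mdeg: "lookup m i \<le> mdeg m"
  unfolding mdeg_def by (cases "i \<in> keys m") (auto simp: in_keys_iff intro: member_le_sum)

lemma finite_bounded_mons: "finite {m. keys m \<subseteq> {1..k::nat} \<and> mdeg m \<le> d}"
proof (rule finite_imageD)
  have "lookup ` {m. keys m \<subseteq> {1..k} \<and> mdeg m \<le> d} \<subseteq>
      {f. \<forall>x. (x \<in> {1..k} \<longrightarrow> f x \<in> {..d}) \<and> (x \<notin> {1..k} \<longrightarrow> f x = 0)}"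
  proof clarsimp
    fix m :: mon and x assume m: "keys m \<subseteq> {Suc 0..k}" "mdeg m \<le> d"
    show "(Suc 0 \<le> x \<and> x \<le> k \<longrightarrow> lookup m x \<le> d) \<and>
        ((Suc 0 \<le> x \<longrightarrow> \<not> x \<le> k) \<longrightarrow> lookup m x = 0)"
      using m lookup_le_mdeg[of m x] by (auto simp: in_keys_iff subset_iff)
  qed
  then show "finite (lookup ` {m. keys m \<subseteq> {1..k} \<and> mdeg m \<le> d})"
    by (rule finite_subset) (intro finite_set_of_finite_funs; simp)
qed (simp add: inj_on_def lookup_inject)

lemma lookup_Proj:
  assumes "F \<in> P_inf"
  shows "lookup (Proj k F) m = (if keys m \<subseteq> {1..k} then F m else 0)"
proof -
  obtain d where d: "\<And>m. F m \<noteq> 0 \<Longrightarrow> mdeg m \<le> d" using assms by (auto simp: P_inf_def)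
  have "{m. (if keys m \<subseteq> {1..k} then F m else 0) \<noteq> 0}
      \<subseteq> {m. keys m \<subseteq> {1..k} \<and> mdeg m \<le> d}"
    using d by auto
  then have "finite {m. (if keys m \<subseteq> {1..k} then F m else 0) \<noteq> 0}"
    by (rule finite_subset[OF _ finite_bounded_mons])
  then show ?thesis unfolding Proj_def by simp
qed

lemma Proj_Pol: "F \<in> P_inf \<Longrightarrow> Proj k F \<in> Pol k"
  by (simp add: Pol_def Ball_def in_keys_iff[of _ "Proj k F"] lookup_Proj)

text \<open>The coefficients at monomials in \<open>x\<^sub>1, \<dots>, x\<^sub>k\<close> of \<open>T\<^sub>j\<close> applied to a series depend only on such
  coefficients of the series, so the truncation can be dropped before computing.\<close>

lemma T_ser_cong:
  assumes "1 \<le> j" "j < k" "\<And>m. keys m \<subseteq> {1..k} \<Longrightarrow> F m = G m" "keys m \<subseteq> {1..k}"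
  shows "T_ser j F m = T_ser j G m"
proof -
  have "F (upd2 j a b m) = G (upd2 j a b m)" for a b
    using assms keys_upd2[of j "{1..k}" a b m] by simp
  then show ?thesis by (simp add: T_ser_def)
qed

lemma fold_tau_ser_cong:
  assumes "1 \<le> i" "n \<le> k" "\<And>m. keys m \<subseteq> {1..k} \<Longrightarrow> F m = G m" "keys m \<subseteq> {1..k}"
  shows "fold tau_ser [i..<n] F m = fold tau_ser [i..<n] G m"
  using assms(2,4)
proof (induction n arbitrary: m)
  case (Suc n)
  have IH: "fold tau_ser [i..<n] F m = fold tau_ser [i..<n] G m"
    if "keys m \<subseteq> {1..k}" for m using Suc that by simp
  show ?case
  proof (cases "i \<le> n")
    case True
    have "T_ser n (fold tau_ser [i..<n] F) m = T_ser n (fold tau_ser [i..<n] G) m"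
      by (rule T_ser_cong[of n k]) (use assms(1) True Suc.prems IH in auto)
    then show ?thesis using True IH Suc.prems by (simp add: tau_ser_def[of n])
  qed (use assms Suc.prems in simp)
qed (use assms in simp)

definition Y_ser :: "nat \<Rightarrow> nat \<Rightarrow> ser \<Rightarrow> ser" where
  "Y_ser i k F = fold T_ser [1..<i] (varpi_ser k (fold tau_ser [i..<k] F))"

lemma lookup_Y_fin_Proj:
  assumes "1 \<le> i" "i \<le> k" "F \<in> P_inf"
  shows "lookup (Y_fin i k (Proj k F)) m = tK * Y_ser i k F m"
proof -
  have "fold tau_ser [i..<k] (lookup (Proj k F)) m = fold tau_ser [i..<k] F m"
    if "keys m \<subseteq> {1..k}" for m
    by (rule fold_tau_ser_cong[of i k k]) (use assms that in \<open>auto simp: lookup_Proj\<close>)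
  from this[OF keys_rot] have "varpi_ser k (fold tau_ser [i..<k] (lookup (Proj k F))) =
      varpi_ser k (fold tau_ser [i..<k] F)"
    unfolding varpi_ser_def fun_eq_iff by simp
  then show ?thesis
    using lookup_Y_fin[OF assms(1,2) Proj_Pol[OF assms(3)]] by (simp add: Y_ser_def)
qed

section \<open>Symmetry of the image\<close>

lemma s_pol_fold_T_inv_far:
  assumes "\<And>r. r \<in> set js \<Longrightarrow> Suc j < r \<or> Suc r < j" "s_pol j f = f"
  shows "s_pol j (fold T_inv js f) = fold T_inv js f"
  using assms
  by (induction js arbitrary: f) (simp_all add: s_pol_T_inv_far)

lemma s_pol_fold_T_op_far:
  assumes "\<And>r. r \<in> set js \<Longrightarrow> Suc j < r \<or> Suc r < j" "s_pol j f = f"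
  shows "s_pol j (fold T_op js f) = fold T_op js f"
  using assms
  by (induction js arbitrary: f) (simp_all add: s_pol_T_op_far)

text \<open>For \<open>g = T\<^bsub>p+1\<^esub>\<^sup>-\<^sup>1 T\<^sub>p\<^sup>-\<^sup>1 h\<close> the braid relation gives \<open>T\<^sub>p T\<^bsub>p+1\<^esub> T\<^sub>p g = T\<^bsub>p+1\<^esub> h = h = T\<^sub>p T\<^bsub>p+1\<^esub> g\<close>,
  and \<open>T\<^sub>p T\<^bsub>p+1\<^esub>\<close> is injective.\<close>

lemma T_inv_braid_sym:
  assumes "s_pol (Suc p) h = h"
  shows "s_pol p (T_inv (Suc p) (T_inv p h)) = T_inv (Suc p) (T_inv p h)"
proof -
  let ?g = "T_inv (Suc p) (T_inv p h)"
  have g: "T_op p (T_op (Suc p) ?g) = h" by (simp add: T_op_T_inv)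
  have "T_op p (T_op (Suc p) (T_op p ?g)) = T_op (Suc p) h"
    using T_op_braid[of p ?g] g by simp
  also have "\<dots> = T_op p (T_op (Suc p) ?g)" using assms g T_op_fix[of "Suc p" h] by simp
  finally have "T_op p ?g = ?g" by (metis T_inv_T_op)
  then show ?thesis using T_op_fix by blast
qed

text \<open>The inverse operators shift the variables one step to the left, so they turn symmetry in
  \<open>x\<^bsub>p+1\<^esub>, x\<^bsub>p+2\<^esub>\<close> into symmetry in \<open>x\<^sub>p, x\<^bsub>p+1\<^esub>\<close>; the substitution in \<open>varpi\<close> undoes the shift.\<close>

lemma s_pol_fold_T_inv:
  assumes "i \<le> p" "Suc p < k" "s_pol (Suc p) f = f"
  shows "s_pol p (fold T_inv [i..<k] f) = fold T_inv [i..<k] f"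
proof -
  have "[i..<k] = [i..<p] @ [p, Suc p] @ [Suc (Suc p)..<k]"
    using assms upt_add_eq_append[of i p "k - p"] by (simp add: upt_conv_Cons)
  then have e: "fold T_inv [i..<k] f =
      fold T_inv [Suc (Suc p)..<k] (T_inv (Suc p) (T_inv p (fold T_inv [i..<p] f)))"
    by simp
  have "s_pol (Suc p) (fold T_inv [i..<p] f) = fold T_inv [i..<p] f"
    by (rule s_pol_fold_T_inv_far) (use assms in auto)
  then have "s_pol p (T_inv (Suc p) (T_inv p (fold T_inv [i..<p] f))) =
      T_inv (Suc p) (T_inv p (fold T_inv [i..<p] f))"
    by (rule T_inv_braid_sym)
  then show ?thesis unfolding e by (intro s_pol_fold_T_inv_far) auto
qed

lemma keys_swap_mon:
  assumes "j \<in> S" "Suc j \<in> S"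
  shows "keys (swap_mon j m) \<subseteq> S \<longleftrightarrow> keys m \<subseteq> S"
proof -
  have "keys (swap_mon j m) \<subseteq> S" if "keys m \<subseteq> S" for m
  proof
    fix r assume "r \<in> keys (swap_mon j m)"
    then have "transpose j (Suc j) r \<in> S" using that by (auto simp: in_keys_iff)
    then show "r \<in> S" using assms by (auto simp: transpose_def split: if_splits)
  qed
  from this[of m] this[of "swap_mon j m"] show ?thesis by auto
qed

lemma rot_swap_mon:
  assumes "1 \<le> p" "Suc p < k" "keys m \<subseteq> {1..k}"
  shows "rot k (swap_mon (Suc p) m) = swap_mon p (rot k m)"
proof (rule poly_mapping_eqI)
  fix r
  have "keys (swap_mon (Suc p) m) \<subseteq> {1..k}"
    using keys_swap_mon[of "Suc p" "{1..k}" m] assms by simp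
  then show "lookup (rot k (swap_mon (Suc p) m)) r = lookup (swap_mon p (rot k m)) r"
    using assms by (auto simp: lookup_rot transpose_def)
qed

lemma s_pol_varpi:
  assumes "1 \<le> p" "Suc p < k" "g \<in> Pol k" "s_pol p g = g"
  shows "s_pol (Suc p) (varpi k g) = varpi k g"
proof (rule poly_mapping_eqI)
  fix m
  have "lookup g (swap_mon p n) = lookup g n" for n
    using assms(4) lookup_s_pol by metis
  moreover have "lookup (swap_mon (Suc p) m) 1 = lookup m 1"
    using assms(1) by (simp add: transpose_def)
  ultimately show "lookup (s_pol (Suc p) (varpi k g)) m = lookup (varpi k g) m"
    using assms keys_swap_mon[of "Suc p" "{1..k}" m] rot_swap_mon[of p k m]
    by (auto simp: lookup_varpi varpi_ser_def)
qed

lemma s_pol_Y_fin: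
  assumes "1 \<le> i" "i < j" "j < k" "f \<in> Pol k" "s_pol j f = f"
  shows "s_pol j (Y_fin i k f) = Y_fin i k f"
proof -
  obtain p where p: "j = Suc p" "i \<le> p" "1 \<le> p" using assms by (cases j) auto
  let ?g = "fold T_inv [i..<k] f"
  have "s_pol p ?g = ?g" using s_pol_fold_T_inv[of i p k f] assms p by simp
  then have "s_pol j (varpi k ?g) = varpi k ?g"
    unfolding p(1) by (intro s_pol_varpi) (use assms p fold_T_inv_Pol in auto)
  then have "s_pol j (fold T_op [1..<i] (varpi k ?g)) = fold T_op [1..<i] (varpi k ?g)"
    by (rule s_pol_fold_T_op_far[rotated]) (use assms in auto)
  then show ?thesis
    unfolding Y_fin_def fold_inv_into[OF assms(1) order_refl assms(4)] by (simp add: s_pol_mult s_pol_cst)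
qed

section \<open>Triangularity of the finite operators\<close>

definition vec_mon :: "mon \<Rightarrow> vec" where "vec_mon m = (\<lambda>r. int (lookup m r))"

text \<open>While \<open>t T\<^sub>i\<^sup>-\<^sup>1, t T\<^bsub>i+1\<^esub>\<^sup>-\<^sup>1, \<dots>\<close> are applied, the entry that started at position \<open>i\<close> travels to
  the right and is at position \<open>p\<close> after the first \<open>p - i\<close> operators.  \<open>pull_right\<close> puts it back.
  After the cyclic shift it is at position \<open>1\<close> and travels back to \<open>i\<close>; the monomials are
  compared after \<open>pull_left\<close>.  With this bookkeeping every operator is triangular by itself.\<close>

definition pull_right :: "nat \<Rightarrow> nat \<Rightarrow> vec \<Rightarrow> vec" where
  "pull_right i p x = (\<lambda>r. if r = i then x p else if i < r \<and> r \<le> p then x (r - 1) else x r)"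

definition pull_left :: "nat \<Rightarrow> nat \<Rightarrow> vec \<Rightarrow> vec" where
  "pull_left i p x = (\<lambda>r. if r = i then x p else if p \<le> r \<and> r < i then x (Suc r) else x r)"

text \<open>Here \<open>P\<close> is the current pull-back: the monomials of \<open>F\<close> stay below \<open>Z\<close>, and the coefficient of
  the monomial whose pull-back is \<open>z\<close> is under control.\<close>

definition bounded_by :: "nat \<Rightarrow> (vec \<Rightarrow> vec) \<Rightarrow> vec set \<Rightarrow> ser \<Rightarrow> bool" where
  "bounded_by k P Z F \<longleftrightarrow>
     (\<forall>m. keys m \<subseteq> {1..k} \<longrightarrow> F m \<noteq> 0 \<longrightarrow> (\<exists>z\<in>Z. lek k (P (vec_mon m)) z))"

definition top_coeff :: "nat \<Rightarrow> (vec \<Rightarrow> vec) \<Rightarrow> vec \<Rightarrow> ser \<Rightarrow> K \<Rightarrow> bool" where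
  "top_coeff k P z F v \<longleftrightarrow>
     (\<forall>m. keys m \<subseteq> {1..k} \<longrightarrow> P (vec_mon m) = z \<longrightarrow> F m = v)"

text \<open>The step common to both directions of travel.  Here \<open>P\<close> and \<open>Q\<close> are the pull-backs before and
  after an operator with weights \<open>w\<close>.  The contribution with the two exponents exchanged keeps the
  pull-back, all others lower it; by maximality of \<open>z\<close> only the first reaches \<open>z\<close>.\<close>

lemma triangular_step:
  assumes j: "1 \<le> j" "j < k"
    and G: "\<And>m. G m = (\<Sum>a\<le>lookup m j + lookup m (Suc j).
        w a (lookup m j + lookup m (Suc j) - a) (lookup m j) *
        F (upd2 j a (lookup m j + lookup m (Suc j) - a) m))"
    and main: "\<And>m. Q (vec_mon m) =
        P (vec_mon (upd2 j (lookup m (Suc j)) (lookup m j) m))"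
    and down: "\<And>m a b. w a b (lookup m j) \<noteq> 0 \<Longrightarrow> lookup m j \<noteq> b \<Longrightarrow>
        a + b = lookup m j + lookup m (Suc j) \<Longrightarrow>
        lower k (Q (vec_mon m)) (P (vec_mon (upd2 j a b m)))"
    and bF: "bounded_by k P Z F" and tF: "top_coeff k P z F v"
    and max: "\<And>y. y \<in> Z \<Longrightarrow> \<not> pot_less k z y"
    and top: "\<And>m. Q (vec_mon m) = z \<Longrightarrow>
        w (lookup m (Suc j)) (lookup m j) (lookup m j) = u"
  shows "bounded_by k Q Z G" "top_coeff k Q z G (u * v)"
proof -
  have b: "\<exists>y\<in>Z. lek k (P (vec_mon (upd2 j a b m))) y"
    if "keys m \<subseteq> {1..k}" "F (upd2 j a b m) \<noteq> 0" for m a b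
    using bF that keys_upd2[of j "{1..k}" a b m] j unfolding bounded_by_def by simp
  show "bounded_by k Q Z G"
    unfolding bounded_by_def
  proof (intro allI impI)
    fix m assume m: "keys m \<subseteq> {1..k}" and nz: "G m \<noteq> 0"
    let ?c = "lookup m j" and ?d = "lookup m (Suc j)"
    obtain a where a: "a \<in> {..?c + ?d}" "w a (?c + ?d - a) ?c * F (upd2 j a (?c + ?d - a) m) \<noteq> 0"
      using nz unfolding G by (rule sum.not_neutral_contains_not_neutral)
    then have w: "w a (?c + ?d - a) ?c \<noteq> 0" and f: "F (upd2 j a (?c + ?d - a) m) \<noteq> 0" by auto
    obtain y where y: "y \<in> Z" "lek k (P (vec_mon (upd2 j a (?c + ?d - a) m))) y" using b[OF m f] by blast
    show "\<exists>y\<in>Z. lek k (Q (vec_mon m)) y"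
    proof (cases "?c = ?c + ?d - a")
      case True
      then have "a = ?d" using a(1) by simp
      then show ?thesis using y True main[of m] by auto
    next
      case False
      then have "lower k (Q (vec_mon m)) (P (vec_mon (upd2 j a (?c + ?d - a) m)))"
        using down[OF w] a(1) by simp
      then show ?thesis using y by (meson converse_rtranclp_into_rtranclp)
    qed
  qed
  show "top_coeff k Q z G (u * v)"
    unfolding top_coeff_def
  proof (intro allI impI)
    fix m assume m: "keys m \<subseteq> {1..k}" and z: "Q (vec_mon m) = z"
    let ?c = "lookup m j" and ?d = "lookup m (Suc j)"
    have "w a (?c + ?d - a) ?c * F (upd2 j a (?c + ?d - a) m) = (if a = ?d then u * v else 0)"
      if a: "a \<in> {..?c + ?d}" for a
    proof (cases "a = ?d")
      case True
      have "F (upd2 j ?d ?c m) = v"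
        using tF main[of m] z m keys_upd2[of j "{1..k}" ?d ?c m] j unfolding top_coeff_def by simp
      then show ?thesis using True top[OF z] by simp
    next
      case False
      have "w a (?c + ?d - a) ?c = 0 \<or> F (upd2 j a (?c + ?d - a) m) = 0"
      proof (rule ccontr)
        assume "\<not> ?thesis"
        then have "lower k z (P (vec_mon (upd2 j a (?c + ?d - a) m)))"
          and f: "F (upd2 j a (?c + ?d - a) m) \<noteq> 0"
          using down[of a "?c + ?d - a" m] a False z by auto
        then show False using b[OF m f] max lower_lek_pot by blast
      qed
      then show ?thesis using False by auto
    qed
    then have "G m = (\<Sum>a\<le>?c + ?d. if a = ?d then u * v else 0)"
      unfolding G by (intro sum.cong) auto
    then show "G m = u * v" by simp
  qed
qed

definition tau_weight :: "nat \<Rightarrow> nat \<Rightarrow> nat \<Rightarrow> K" where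
  "tau_weight a b c = weight a b c - (1 - tK) * (if c = a then 1 else 0)"

lemma tau_ser_weight:
  "tau_ser j F m = (\<Sum>a\<le>lookup m j + lookup m (Suc j).
     tau_weight a (lookup m j + lookup m (Suc j) - a) (lookup m j) *
     F (upd2 j a (lookup m j + lookup m (Suc j) - a) m))"
proof -
  let ?c = "lookup m j" and ?d = "lookup m (Suc j)"
  have m: "upd2 j ?c ?d m = m" by (simp add: upd2_eq_iff)
  have "(\<Sum>a\<le>?c + ?d. (1 - tK) * (if ?c = a then 1 else 0) * F (upd2 j a (?c + ?d - a) m)) =
      (\<Sum>a\<le>?c + ?d. if ?c = a then (1 - tK) * F m else 0)"
    by (rule sum.cong) (auto simp: m)
  also have "\<dots> = (1 - tK) * F m" by simp
  finally show ?thesis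
    by (simp add: tau_ser_def T_ser_def tau_weight_def Let_def left_diff_distrib sum_subtractf)
qed

lemma tau_weight_nz:
  assumes "tau_weight a b c \<noteq> 0" "c \<noteq> b" shows "b < c \<and> c < a \<or> a \<le> c \<and> c < b"
  using assms by (auto simp: tau_weight_def weight_def split: if_splits)

lemma weight_nz:
  assumes "weight a b c \<noteq> 0" "c \<noteq> b" shows "b < c \<and> c \<le> a \<or> a < c \<and> c < b"
  using assms by (auto simp: weight_def split: if_splits)

lemma tau_weight_top: "tau_weight a b b = (if a \<le> b then tK else 1)"
  by (auto simp: tau_weight_def weight_def)

lemma weight_top: "weight a b b = (if a < b then tK else 1)"
  by (auto simp: weight_def)

lemma lowerI:
  assumes "1 \<le> i" "i < j" "j \<le> k" "c + d = y i + y j"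
    "y i < c \<and> c \<le> y j \<or> y j < c \<and> c < y i"
    "x i = c" "x j = d" "\<And>r. r \<noteq> i \<Longrightarrow> r \<noteq> j \<Longrightarrow> x r = y r"
  shows "lower k x y"
proof -
  have "x = y(i := c, j := d)" using assms(6-8) by auto
  then show ?thesis unfolding lower_def using assms(1-5) by blast
qed

lemma fold_tau_triangular:
  assumes i: "1 \<le> i" "i \<le> p" "p \<le> k"
    and F: "bounded_by k id Z F" "top_coeff k id z F v"
    and max: "\<And>y. y \<in> Z \<Longrightarrow> \<not> pot_less k z y"
  shows "bounded_by k (pull_right i p) Z (fold tau_ser [i..<p] F) \<and>
    top_coeff k (pull_right i p) z (fold tau_ser [i..<p] F) (tK ^ card {r \<in> {i<..p}. z i \<le> z r} * v)"
  using i(2,3)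
proof (induction p rule: dec_induct)
  case base
  have "pull_right i i = id" by (auto simp: pull_right_def fun_eq_iff)
  then show ?case using F by (simp add: id_def)
next
  case (step p)
  let ?F = "fold tau_ser [i..<p] F"
  have e: "fold tau_ser [i..<Suc p] F = tau_ser p ?F" using step by simp
  define u where "u = (if z i \<le> z (Suc p) then tK else 1)"
  have s: "{r \<in> {i<..Suc p}. z i \<le> z r} =
      (if z i \<le> z (Suc p) then insert (Suc p) {r \<in> {i<..p}. z i \<le> z r} else {r \<in> {i<..p}. z i \<le> z r})"
    using step by (auto simp: le_Suc_eq)
  have c: "tK ^ card {r \<in> {i<..Suc p}. z i \<le> z r} * v = u * (tK ^ card {r \<in> {i<..p}. z i \<le> z r} * v)"
    unfolding s u_def by simp
  note IH = step.IH[OF Suc_leD[OF step.prems]]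
  have "1 \<le> p" "p < k" using i step by auto
  note T = triangular_step[OF this tau_ser_weight _ _ conjunct1[OF IH] conjunct2[OF IH] max,
      where Q = "pull_right i (Suc p)" and u = u]
  have main: "pull_right i (Suc p) (vec_mon m) =
      pull_right i p (vec_mon (upd2 p (lookup m (Suc p)) (lookup m p) m))" for m
      using step by (auto simp: pull_right_def vec_mon_def lookup_upd2 fun_eq_iff)
    have top: "tau_weight (lookup m (Suc p)) (lookup m p) (lookup m p) = u"
      if "pull_right i (Suc p) (vec_mon m) = z" for m
    proof -
      have "z i = int (lookup m (Suc p))" "z (Suc p) = int (lookup m p)"
        using step unfolding that[symmetric] by (auto simp: pull_right_def vec_mon_def)
      then show ?thesis by (simp add: tau_weight_top u_def)
    qed
    have down: "lower k (pull_right i (Suc p) (vec_mon m)) (pull_right i p (vec_mon (upd2 p a b m)))"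
      if w: "tau_weight a b (lookup m p) \<noteq> 0" "lookup m p \<noteq> b"
        "a + b = lookup m p + lookup m (Suc p)" for a b m
      by (rule lowerI[of i "Suc p" k "int (lookup m (Suc p))" "int (lookup m p)"])
        (use i step tau_weight_nz[OF w(1,2)] w(3) in
          \<open>auto simp: pull_right_def vec_mon_def lookup_upd2\<close>)
  show ?case unfolding e c using T[OF main down _ top] by blast
qed

lemma fold_T_triangular:
  assumes i: "1 \<le> p" "p \<le> i" "i \<le> k"
    and F: "bounded_by k (pull_left i 1) Z F" "top_coeff k (pull_left i 1) z F v"
    and max: "\<And>y. y \<in> Z \<Longrightarrow> \<not> pot_less k z y"
  shows "bounded_by k (pull_left i p) Z (fold T_ser [1..<p] F) \<and>
    top_coeff k (pull_left i p) z (fold T_ser [1..<p] F) (tK ^ card {r \<in> {1..<p}. z i < z r} * v)"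
  using i(1,2)
proof (induction p rule: dec_induct)
  case base
  then show ?case using F by simp
next
  case (step p)
  let ?F = "fold T_ser [1..<p] F"
  have e: "fold T_ser [1..<Suc p] F = T_ser p ?F" using step by simp
  define u where "u = (if z i < z p then tK else 1)"
  have s: "{r \<in> {1..<Suc p}. z i < z r} =
      (if z i < z p then insert p {r \<in> {1..<p}. z i < z r} else {r \<in> {1..<p}. z i < z r})"
    using step by (auto simp: less_Suc_eq)
  have c: "tK ^ card {r \<in> {1..<Suc p}. z i < z r} * v = u * (tK ^ card {r \<in> {1..<p}. z i < z r} * v)"
    unfolding s u_def by simp
  note IH = step.IH[OF Suc_leD[OF step.prems]]
  have "1 \<le> p" "p < k" using i step by auto
  note T = triangular_step[OF this T_ser_def[unfolded Let_def] _ _ conjunct1[OF IH] conjunct2[OF IH] max,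
      where Q = "pull_left i (Suc p)" and u = u]
  have main: "pull_left i (Suc p) (vec_mon m) =
      pull_left i p (vec_mon (upd2 p (lookup m (Suc p)) (lookup m p) m))"
      (is "?l = ?r") for m
    proof
      fix r
      show "?l r = ?r r"
        by (cases "r = p") (use step in \<open>auto simp: pull_left_def vec_mon_def lookup_upd2\<close>)
    qed
    have top: "weight (lookup m (Suc p)) (lookup m p) (lookup m p) = u"
      if "pull_left i (Suc p) (vec_mon m) = z" for m
    proof -
      have "z i = int (lookup m (Suc p))" "z p = int (lookup m p)"
        using step unfolding that[symmetric] by (auto simp: pull_left_def vec_mon_def)
      then show ?thesis by (simp add: weight_top u_def)
    qed
    have down: "lower k (pull_left i (Suc p) (vec_mon m)) (pull_left i p (vec_mon (upd2 p a b m)))"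
      if w: "weight a b (lookup m p) \<noteq> 0" "lookup m p \<noteq> b"
        "a + b = lookup m p + lookup m (Suc p)" for a b m
      by (rule lowerI[of p i k "int (lookup m p)" "int (lookup m (Suc p))"])
        (use i step weight_nz[OF w(1,2)] w(3) in
          \<open>auto simp: pull_left_def vec_mon_def lookup_upd2\<close>)
  show ?case unfolding e c using T[OF main down _ top] by blast
qed

lemma pull_right_rot:
  assumes "1 \<le> i" "i \<le> k" "keys m \<subseteq> {1..k}"
  shows "pull_right i k (vec_mon (rot k m)) = pull_left i 1 (vec_mon m)"
proof
  fix r
  have "lookup m 0 = 0" "k < r \<Longrightarrow> lookup m r = 0"
    "lookup m (Suc k) = 0" "k < r \<Longrightarrow> lookup m (Suc r) = 0"
    using assms(3) by (auto simp: in_keys_iff subset_iff)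
  then show "pull_right i k (vec_mon (rot k m)) r = pull_left i 1 (vec_mon m) r"
    using assms by (auto simp: pull_right_def pull_left_def vec_mon_def lookup_rot)
qed

lemma Y_ser_triangular:
  assumes i: "1 \<le> i" "i \<le> k"
    and F: "bounded_by k id Z F" "top_coeff k id z F v"
    and max: "\<And>y. y \<in> Z \<Longrightarrow> \<not> pot_less k z y"
  shows "bounded_by k id Z (Y_ser i k F)"
    "top_coeff k id z (Y_ser i k F) (tK ^ card {r \<in> {1..<i}. z i < z r} *
       ((if 0 < z i then qK ^ nat (z i) else 0) * (tK ^ card {r \<in> {i<..k}. z i \<le> z r} * v)))"
proof -
  let ?C = "fold tau_ser [i..<k] F" and ?v = "tK ^ card {r \<in> {i<..k}. z i \<le> z r} * v"
  let ?q = "if 0 < z i then qK ^ nat (z i) else 0"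
  have C: "bounded_by k (pull_right i k) Z ?C" "top_coeff k (pull_right i k) z ?C ?v"
    using fold_tau_triangular[OF i(1,2) order_refl F max] by auto
  have "bounded_by k (pull_left i 1) Z (varpi_ser k ?C)"
    unfolding bounded_by_def
  proof (intro allI impI)
    fix m assume m: "keys m \<subseteq> {1..k}" "varpi_ser k ?C m \<noteq> 0"
    then have "?C (rot k m) \<noteq> 0" by (auto simp: varpi_ser_def split: if_splits)
    then show "\<exists>y\<in>Z. lek k (pull_left i 1 (vec_mon m)) y"
      using C(1) keys_rot[OF m(1)] pull_right_rot[OF i m(1)] unfolding bounded_by_def by metis
  qed
  moreover have "top_coeff k (pull_left i 1) z (varpi_ser k ?C) (?q * ?v)"
    unfolding top_coeff_def
  proof (intro allI impI)
    fix m assume m: "keys m \<subseteq> {1..k}" "pull_left i 1 (vec_mon m) = z"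
    then have "?C (rot k m) = ?v"
      using C(2) keys_rot[OF m(1)] pull_right_rot[OF i m(1)] unfolding top_coeff_def by metis
    moreover have "z i = int (lookup m 1)"
      unfolding m(2)[symmetric] by (simp add: pull_left_def vec_mon_def)
    ultimately show "varpi_ser k ?C m = ?q * ?v" using m(1) by (simp add: varpi_ser_def)
  qed
  ultimately have "bounded_by k (pull_left i i) Z (Y_ser i k F) \<and>
      top_coeff k (pull_left i i) z (Y_ser i k F) (tK ^ card {r \<in> {1..<i}. z i < z r} * (?q * ?v))"
    unfolding Y_ser_def using fold_T_triangular[OF i(1) order_refl i(2)] max by blast
  moreover have "pull_left i i = id" by (auto simp: pull_left_def fun_eq_iff)
  ultimately show "bounded_by k id Z (Y_ser i k F)"
    "top_coeff k id z (Y_ser i k F) (tK ^ card {r \<in> {1..<i}. z i < z r} * (?q * ?v))" by auto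
qed

section \<open>The \<open>t\<close>-adic topology\<close>

lemma ordK_Fract:
  assumes "A \<noteq> 0" "B \<noteq> 0"
  shows "ordK (Fract A B) = ereal (real (order 0 A) - real (order 0 B))"
proof -
  have nz: "Fract A B \<noteq> 0" using assms by (simp add: Zero_fract_def eq_fract)
  show ?thesis unfolding ordK_def if_not_P[OF nz]
  proof (rule the_equality)
    fix v assume "\<exists>A' B'. A' \<noteq> 0 \<and> B' \<noteq> 0 \<and> Fract A B = Fract A' B' \<and>
      v = ereal (real (order 0 A') - real (order 0 B'))"
    then obtain A' B' where A': "A' \<noteq> 0" "B' \<noteq> 0" "Fract A B = Fract A' B'"
      "v = ereal (real (order 0 A') - real (order 0 B'))" by blast
    then have "A * B' = A' * B" using assms by (simp add: eq_fract)
    then have "order 0 (A * B') = order 0 (A' * B)" by simp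
    then have "order 0 A + order 0 B' = order 0 A' + order 0 B"
      using assms A' by (simp add: order_mult)
    then show "v = ereal (real (order 0 A) - real (order 0 B))" using A'(4) by simp
  qed (use assms in blast)
qed

lemma K_cases:
  obtains A B where "x = Fract A B" "B \<noteq> (0 :: rat poly poly)" "A = 0 \<longleftrightarrow> x = 0"
proof -
  obtain A B where "x = Fract A B" "B \<noteq> 0" by (cases x)
  moreover from this have "A = 0 \<longleftrightarrow> x = 0" by (simp add: Zero_fract_def eq_fract)
  ultimately show ?thesis using that by blast
qed

lemma ordK_finite: "x \<noteq> 0 \<Longrightarrow> \<exists>r::real. ordK x = ereal r"
  by (cases x rule: K_cases) (metis ordK_Fract)

lemma ordK_zero [simp]: "ordK 0 = \<infinity>" by (simp add: ordK_def)

lemma ordK_mult: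
  assumes "x \<noteq> 0" "y \<noteq> 0" shows "ordK (x * y) = ordK x + ordK y"
proof -
  obtain A B where x: "x = Fract A B" "B \<noteq> 0" "A \<noteq> 0" using assms by (cases x rule: K_cases) auto
  obtain C D where y: "y = Fract C D" "D \<noteq> 0" "C \<noteq> 0" using assms by (cases y rule: K_cases) auto
  show ?thesis using x y by (simp add: ordK_Fract order_mult)
qed

lemma ordK_add_gt:
  assumes "ereal r < ordK x" "ereal r < ordK y" shows "ereal r < ordK (x + y)"
proof (cases "x = 0 \<or> y = 0 \<or> x + y = 0")
  case True
  then show ?thesis using assms by auto
next
  case False
  obtain A B where x: "x = Fract A B" "B \<noteq> 0" "A \<noteq> 0" using False by (cases x rule: K_cases) auto
  obtain C D where y: "y = Fract C D" "D \<noteq> 0" "C \<noteq> 0" using False by (cases y rule: K_cases) auto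
  have xy: "x + y = Fract (A * D + C * B) (B * D)" using x y by simp
  have s: "A * D + C * B \<noteq> 0" using False xy x y by (auto simp: Zero_fract_def eq_fract)
  define n where "n = min (order 0 (A * D)) (order 0 (C * B))"
  have "[:- 0, 1:] ^ n dvd A * D" "[:- 0, 1:] ^ n dvd C * B"
    unfolding order_divides n_def by simp_all
  then have "[:- 0, 1:] ^ n dvd A * D + C * B" by (rule dvd_add)
  then have n: "n \<le> order 0 (A * D + C * B)" unfolding order_divides using s by simp
  have "r < real (order 0 A) - real (order 0 B)" "r < real (order 0 C) - real (order 0 D)"
    using assms x y by (simp_all add: ordK_Fract)
  moreover have "order 0 (A * D) = order 0 A + order 0 D" "order 0 (C * B) = order 0 C + order 0 B"
    "order 0 (B * D) = order 0 B + order 0 D" using x y by (simp_all add: order_mult)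
  ultimately have "r < real (order 0 (A * D + C * B)) - real (order 0 (B * D))"
    using n unfolding n_def min_def by (auto split: if_splits)
  then show ?thesis unfolding xy using s x y by (simp add: ordK_Fract)
qed

lemma K_converges_iff: "K_converges a l \<longleftrightarrow> (\<forall>r. \<forall>\<^sub>F n in sequentially. ereal r < ordK (a n - l))"
  unfolding K_converges_def tendsto_PInfty by simp

lemma K_converges_eventually_const:
  assumes "\<forall>\<^sub>F n in sequentially. a n = l" shows "K_converges a l"
  unfolding K_converges_iff using assms by (auto elim: eventually_mono)

lemma K_converges_const: "K_converges (\<lambda>n. l) l"
  by (rule K_converges_eventually_const) simp

lemma K_converges_add:
  assumes "K_converges a l" "K_converges b m" shows "K_converges (\<lambda>n. a n + b n) (l + m)"
  unfolding K_converges_iff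
proof
  fix r
  have "\<forall>\<^sub>F n in sequentially. ereal r < ordK (a n - l) \<and> ereal r < ordK (b n - m)"
    using assms unfolding K_converges_iff by (auto intro: eventually_conj)
  then show "\<forall>\<^sub>F n in sequentially. ereal r < ordK (a n + b n - (l + m))"
  proof (rule eventually_mono)
    fix n assume "ereal r < ordK (a n - l) \<and> ereal r < ordK (b n - m)"
    then have "ereal r < ordK ((a n - l) + (b n - m))" using ordK_add_gt by blast
    then show "ereal r < ordK (a n + b n - (l + m))" by (simp add: algebra_simps)
  qed
qed

lemma K_converges_mult_left:
  assumes "K_converges a l" shows "K_converges (\<lambda>n. c * a n) (c * l)"
proof (cases "c = 0")
  case True
  then show ?thesis using K_converges_const[of 0] by simp
next
  case False
  then obtain s where s: "ordK c = ereal s" using ordK_finite by blast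
  show ?thesis unfolding K_converges_iff
  proof
    fix r
    have "\<forall>\<^sub>F n in sequentially. ereal (r - s) < ordK (a n - l)"
      using assms unfolding K_converges_iff by blast
    then show "\<forall>\<^sub>F n in sequentially. ereal r < ordK (c * a n - c * l)"
    proof (rule eventually_mono)
      fix n assume n: "ereal (r - s) < ordK (a n - l)"
      show "ereal r < ordK (c * a n - c * l)"
      proof (cases "a n - l = 0")
        case False
        then obtain u where u: "ordK (a n - l) = ereal u" using ordK_finite by blast
        have "ordK (c * (a n - l)) = ereal (s + u)"
          using ordK_mult[OF \<open>c \<noteq> 0\<close> False] s u by simp
        then show ?thesis using n u by (simp add: right_diff_distrib)
      qed simp
    qed
  qed
qed

lemma K_converges_sum:
  assumes "\<And>x. x \<in> A \<Longrightarrow> K_converges (\<lambda>n. a x n) (l x)"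
  shows "K_converges (\<lambda>n. \<Sum>x\<in>A. a x n) (\<Sum>x\<in>A. l x)"
  using assms
  by (induction A rule: infinite_finite_induct) (auto intro: K_converges_add K_converges_const)

lemma K_converges_cong:
  assumes "K_converges a l" "\<forall>\<^sub>F n in sequentially. a n = b n" shows "K_converges b l"
  unfolding K_converges_iff
proof
  fix r
  have "\<forall>\<^sub>F n in sequentially. ereal r < ordK (a n - l) \<and> a n = b n"
    using assms unfolding K_converges_iff by (auto intro: eventually_conj)
  then show "\<forall>\<^sub>F n in sequentially. ereal r < ordK (b n - l)" by (rule eventually_mono) auto
qed

lemma K_converges_cong_ge:
  "K_converges a l \<Longrightarrow> (\<And>n. N \<le> n \<Longrightarrow> a n = b n) \<Longrightarrow> K_converges b l"
  by (rule K_converges_cong) (auto simp: eventually_sequentially)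

lemma K_converges_unique:
  assumes "K_converges a l" "K_converges a m" shows "l = m"
proof (rule ccontr)
  assume "l \<noteq> m"
  then have "m - l \<noteq> 0" by simp
  then obtain r where r: "ordK (m - l) = ereal r" using ordK_finite by blast
  have "K_converges (\<lambda>n. a n + - 1 * a n) (l + - 1 * m)"
    by (intro K_converges_add K_converges_mult_left assms)
  then have "K_converges (\<lambda>n. 0) (l - m)" by simp
  then have "\<forall>\<^sub>F n in sequentially. ereal r < ordK (0 - (l - m))" unfolding K_converges_iff by blast
  then have "ereal r < ordK (m - l)" by simp
  then show False using r by simp
qed

lemma K_converges_tK_power: "K_converges (\<lambda>n. tK ^ n) 0"
proof -
  have o: "ordK (tK ^ n) = ereal (real n)" for n
  proof (induction n)
    case 0
    have "(1::K) = Fract 1 1" by (simp add: One_fract_def)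
    then have "ordK (1::K) = ereal 0"
      using ordK_Fract[of "1 :: rat poly poly" "1 :: rat poly poly"] by simp
    then show ?case by simp
  next
    case (Suc n)
    have "order 0 [:0, 1 :: rat poly:] = 1"
      using order_power_n_n[of "0 :: rat poly" 1] by simp
    then have "ordK tK = ereal 1" unfolding tK_def by (simp add: ordK_Fract)
    then show ?case using Suc ordK_mult[of tK "tK ^ n"] by simp
  qed
  show ?thesis unfolding K_converges_iff
  proof
    fix r
    obtain N :: nat where "r < real N" using reals_Archimedean2 by blast
    then have "\<forall>n\<ge>N. ereal r < ordK (tK ^ n - 0)" by (simp add: o)
    then show "\<forall>\<^sub>F n in sequentially. ereal r < ordK (tK ^ n - 0)"
      unfolding eventually_sequentially by blast
  qed
qed

lemma K_converges_tK_power_shift: "K_converges (\<lambda>n. tK ^ (n - i)) 0"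
proof -
  have "K_converges (\<lambda>n. (1 / tK) ^ i * tK ^ n) ((1 / tK) ^ i * 0)"
    by (intro K_converges_mult_left K_converges_tK_power)
  moreover have "(1 / tK) ^ i * tK ^ n = tK ^ (n - i)" if "i \<le> n" for n
    using that by (simp add: power_divide power_diff)
  ultimately have "K_converges (\<lambda>n. tK ^ (n - i)) ((1 / tK) ^ i * 0)"
    by (rule K_converges_cong_ge)
  then show ?thesis by simp
qed

section \<open>Convergence of coefficients\<close>

lemma T_ser_converges:
  assumes "\<And>m. K_converges (\<lambda>k. G k m) (l m)"
  shows "K_converges (\<lambda>k. T_ser j (G k) m) (T_ser j l m)"
  unfolding T_ser_def Let_def by (intro K_converges_sum K_converges_mult_left assms)

lemma fold_T_ser_converges:
  assumes "\<And>m. K_converges (\<lambda>k. G k m) (l m)"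
  shows "K_converges (\<lambda>k. fold T_ser js (G k) m) (fold T_ser js l m)"
  using assms
proof (induction js arbitrary: G l)
  case (Cons j js)
  have "K_converges (\<lambda>k. fold T_ser js (T_ser j (G k)) m) (fold T_ser js (T_ser j l) m)"
    by (rule Cons.IH) (rule T_ser_converges, rule Cons.prems)
  then show ?case by simp
qed simp

lemma tau_ser_swap:
  assumes "\<And>m. F (swap_mon p m) = F m" "Suc j < p"
  shows "tau_ser j F (swap_mon p m) = tau_ser j F m"
proof -
  have "upd2 j a b (swap_mon p m) = swap_mon p (upd2 j a b m)" for a b
    by (rule poly_mapping_eqI) (use assms(2) in \<open>auto simp: lookup_upd2 transpose_def\<close>)
  then have "F (upd2 j a b (swap_mon p m)) = F (upd2 j a b m)" for a b
    using assms(1) by simp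
  moreover have "lookup (swap_mon p m) j = lookup m j"
    "lookup (swap_mon p m) (Suc j) = lookup m (Suc j)"
    using assms(2) by (auto simp: transpose_def)
  ultimately show ?thesis using assms(1) by (simp add: tau_ser_def T_ser_def)
qed

lemma fold_tau_ser_swap:
  assumes "\<And>m. F (swap_mon p m) = F m" "n < p"
  shows "fold tau_ser [i..<n] F (swap_mon p m) = fold tau_ser [i..<n] F m"
  using assms(2)
proof (induction n arbitrary: m)
  case (Suc n)
  then show ?case using assms(1) tau_ser_swap[of "fold tau_ser [i..<n] F" p n m]
    by (cases "i \<le> n") auto
qed (use assms in simp)

lemma swap_mon_rot:
  assumes "keys m \<subseteq> {1..k}"
  shows "swap_mon k (rot k m) = rot (Suc k) m"
proof (rule poly_mapping_eqI)
  fix r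
  have "keys m \<subseteq> {1..Suc k}" using assms by fastforce
  moreover have "lookup m (Suc k) = 0" "lookup m (Suc (Suc k)) = 0"
    using assms by (auto simp: in_keys_iff subset_iff)
  ultimately show "lookup (swap_mon k (rot k m)) r = lookup (rot (Suc k) m) r"
    using assms by (cases "k = 0") (auto simp: lookup_rot transpose_def)
qed

lemma keys_mono: "keys m \<subseteq> {1..M::nat} \<Longrightarrow> M \<le> k \<Longrightarrow> keys m \<subseteq> {1..k}"
  by fastforce

lemma keys_le_Max:
  "keys m \<subseteq> {1..} \<Longrightarrow> keys m \<subseteq> {1..Max (insert 0 (keys m))}"
  by (auto intro: Max_ge)

text \<open>Beyond the support of \<open>m\<close> the travelling entry can leave a zero behind in two ways only: a
  non-zero entry passes a zero with weight \<open>1\<close>, and a zero is replaced by the next non-zero entry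
  with weight \<open>-(1 - t)\<close>, having passed zeros with weight \<open>t\<close> each.\<close>

lemma coefficient_recursion:
  assumes "1 \<le> i" "i \<le> k" "keys m \<subseteq> {1..k}" "lookup m 1 > 0"
  shows "fold tau_ser [i..<Suc k] F (rot (Suc k) m) =
    fold tau_ser [i..<k] F (rot k m) - (1 - tK) * fold tau_ser [i..<k] F (rot (Suc k) m)"
proof -
  let ?C = "fold tau_ser [i..<k] F" and ?b = "lookup m 1" and ?m = "rot (Suc k) m"
  have k1: "keys m \<subseteq> {1..Suc k}" using keys_mono[OF assms(3)] by simp
  have z: "lookup m (Suc k) = 0" "lookup m (Suc (Suc k)) = 0"
    using assms(3) by (auto simp: in_keys_iff subset_iff)
  have l: "lookup ?m k = 0" "lookup ?m (Suc k) = ?b"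
    using z by (auto simp: lookup_rot[OF k1])
  have u: "upd2 k ?b 0 ?m = rot k m" "upd2 k 0 ?b ?m = ?m"
    unfolding upd2_eq_iff using z assms(1,2)
    by (auto simp: lookup_rot[OF k1] lookup_rot[OF assms(3)])
  have "(\<Sum>a\<le>?b. tau_weight a (?b - a) 0 * ?C (upd2 k a (?b - a) ?m)) =
      (\<Sum>a\<le>?b. (if a = ?b then ?C (rot k m) else 0) + (if a = 0 then - (1 - tK) * ?C ?m else 0))"
  proof (rule sum.cong)
    fix a assume a: "a \<in> {..?b}"
    consider "a = ?b" | "a = 0" | "0 < a" "a < ?b" using a by fastforce
    then show "tau_weight a (?b - a) 0 * ?C (upd2 k a (?b - a) ?m) =
      (if a = ?b then ?C (rot k m) else 0) + (if a = 0 then - (1 - tK) * ?C ?m else 0)"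
    proof cases
      case 1
      then show ?thesis using assms(4) u by (simp add: tau_weight_top)
    next
      case 2
      then show ?thesis using assms(4) u by (simp add: tau_weight_def weight_def)
    next
      case 3
      then have "tau_weight a (?b - a) 0 = 0" using tau_weight_nz[of a "?b - a" 0] by auto
      then show ?thesis using 3 by simp
    qed
  qed simp
  then have "tau_ser k ?C ?m = ?C (rot k m) - (1 - tK) * ?C ?m"
    using assms(4) by (simp add: tau_ser_weight[of k] l sum.distrib algebra_simps)
  then show ?thesis using assms(2) by simp
qed

lemma coefficient_zeros:
  assumes "i \<le> M" "M \<le> p" "p \<le> k" "keys m \<subseteq> {1..M}"
  shows "fold tau_ser [i..<p] F (rot (Suc k) m) = tK ^ (p - M) * fold tau_ser [i..<M] F (rot (Suc k) m)"
  using assms(2,3)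
proof (induction p rule: dec_induct)
  case (step p)
  let ?m = "rot (Suc k) m"
  have k1: "keys m \<subseteq> {1..Suc k}" using keys_mono[OF assms(4)] step by simp
  have "lookup m (Suc p) = 0" "lookup m (Suc (Suc p)) = 0"
    using assms(4) step by (auto simp: in_keys_iff subset_iff)
  then have l: "lookup ?m p = 0" "lookup ?m (Suc p) = 0"
    using step by (auto simp: lookup_rot[OF k1])
  have "upd2 p 0 0 ?m = ?m" unfolding upd2_eq_iff using l by simp
  then have "tau_ser p (fold tau_ser [i..<p] F) ?m = tK * fold tau_ser [i..<p] F ?m"
    by (simp add: tau_ser_weight[of p] l tau_weight_top)
  then show ?case using step assms(1) by (simp add: Suc_diff_le)
qed simp

text \<open>Increasing \<open>k\<close> moves the last exponent of the shifted monomial one position further out, where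
  \<open>G\<close> is symmetric.\<close>

lemma rot_symmetric:
  assumes "\<And>p m. M < p \<Longrightarrow> G (swap_mon p m) = G m" "keys m \<subseteq> {1..M}" "M < k"
  shows "G (rot k m) = G (rot (Suc M) m)"
proof -
  have "Suc M \<le> k" using assms(3) by simp
  then show ?thesis
  proof (induction k rule: dec_induct)
    case (step k)
    then have "swap_mon k (rot k m) = rot (Suc k) m"
      using swap_mon_rot keys_mono[OF assms(2)] by simp
    then show ?case using assms(1)[of k "rot k m"] step by simp
  qed simp
qed

text \<open>The recursion makes the coefficient a constant plus a partial sum of a geometric series in \<open>t\<close>.\<close>

lemma varpi_ser_converges:
  assumes "\<And>p m. L < p \<Longrightarrow> F (swap_mon p m) = F m" "1 \<le> i"
  shows "\<exists>l. K_converges (\<lambda>k. varpi_ser k (fold tau_ser [i..<k] F) m) l"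
proof (cases "keys m \<subseteq> {1..} \<and> lookup m 1 > 0")
  case False
  moreover have "keys m \<subseteq> {1..}" if "keys m \<subseteq> {1..k}" for k using that by auto
  ultimately have "varpi_ser k G m = 0" for k G by (auto simp: varpi_ser_def)
  then show ?thesis using K_converges_const[of 0] by auto
next
  case True
  define M where "M = i + L + Max (insert 0 (keys m))"
  have M: "i \<le> M" "L \<le> M" "keys m \<subseteq> {1..M}"
    using keys_mono[OF keys_le_Max, of m M] True by (auto simp: M_def)
  let ?C = "\<lambda>k. fold tau_ser [i..<k] F"
  define B where "B = ?C M (rot (Suc M) m)"
  have E: "?C k (rot (Suc k) m) = tK ^ (k - M) * B" if "M \<le> k" for k
  proof -
    have "?C M (rot (Suc k) m) = B" unfolding B_def
    proof (rule rot_symmetric[OF _ M(3)])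
      show "?C M (swap_mon p n) = ?C M n" if "M < p" for p n
        by (rule fold_tau_ser_swap) (use assms(1) M(2) that in auto)
    qed (use that in simp)
    then show ?thesis using coefficient_zeros[OF M(1) that order_refl M(3)] by simp
  qed
  have D: "?C k (rot k m) = ?C M (rot M m) - B + B * tK ^ (k - M)" if "M \<le> k" for k
    using that
  proof (induction k rule: dec_induct)
    case (step k)
    have "?C (Suc k) (rot (Suc k) m) = ?C k (rot k m) - (1 - tK) * (tK ^ (k - M) * B)"
      using coefficient_recursion[OF assms(2), of k m F] keys_mono[OF M(3) step(1)] M(1) step True E
      by simp
    then show ?case unfolding step.IH using step by (simp add: Suc_diff_le algebra_simps)
  qed simp
  let ?b = "lookup m 1"
  have "K_converges (\<lambda>k. qK ^ ?b * (?C M (rot M m) - B + B * tK ^ (k - M)))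
      (qK ^ ?b * (?C M (rot M m) - B + B * 0))"
    by (intro K_converges_mult_left K_converges_add K_converges_const K_converges_tK_power_shift)
  moreover have "qK ^ ?b * (?C M (rot M m) - B + B * tK ^ (k - M)) = varpi_ser k (?C k) m" if "M \<le> k" for k
    using D[OF that] keys_mono[OF M(3) that] True by (simp add: varpi_ser_def)
  ultimately show ?thesis by (blast intro: K_converges_cong_ge)
qed

lemma P_symD: "F \<in> P_sym L \<Longrightarrow> L < p \<Longrightarrow> F (swap_mon p m) = F m"
  by (auto simp: P_sym_def s_ser_def fun_eq_iff)

lemma s_pol_Proj:
  assumes "F \<in> P_sym L" "L < j" "j < k" shows "s_pol j (Proj k F) = Proj k F"
proof (rule poly_mapping_eqI)
  fix n
  have F: "F \<in> P_inf" using assms(1) by (simp add: P_sym_def)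
  have "keys (swap_mon j n) \<subseteq> {1..k} \<longleftrightarrow> keys n \<subseteq> {1..k}"
    using keys_swap_mon[of j "{1..k}" n] assms by simp
  then show "lookup (s_pol j (Proj k F)) n = lookup (Proj k F) n"
    using P_symD[OF assms(1,2), of n] by (simp add: lookup_Proj[OF F])
qed

text \<open>If \<open>F\<close> is symmetric from \<open>x\<^sub>i\<close> on, the inverse operators fix it and a power of \<open>t\<close> survives.\<close>

lemma varpi_ser_converges_zero:
  assumes "F \<in> P_sym L" and i: "L < i"
  shows "K_converges (\<lambda>k. varpi_ser k (fold tau_ser [i..<k] F) m) 0"
proof (cases "keys m \<subseteq> {1..} \<and> lookup m 1 > 0")
  case False
  moreover have "keys m \<subseteq> {1..}" if "keys m \<subseteq> {1..k}" for k using that by auto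
  ultimately have "varpi_ser k G m = 0" for k G by (auto simp: varpi_ser_def)
  then show ?thesis using K_converges_const[of 0] by auto
next
  case True
  have F: "F \<in> P_inf" using assms(1) by (simp add: P_sym_def)
  define M where "M = i + Max (insert 0 (keys m))"
  have M: "i \<le> M" "keys m \<subseteq> {1..M}"
    using keys_mono[OF keys_le_Max, of m M] True by (auto simp: M_def)
  have C: "fold tau_ser [i..<k] F n = tK ^ (k - i) * F n"
    if k: "i \<le> k" and n: "keys n \<subseteq> {1..k}" for k n
  proof -
    have "fold T_inv [i..<p] (Proj k F) = Proj k F" if "p \<le> k" for p
      using that
    proof (induction p)
      case (Suc p)
      then show ?case using s_pol_Proj[OF assms(1), of p k] i by (cases "i \<le> p") (simp_all add: T_inv_fix)
    qed simp
    then have "lookup (fold T_inv [i..<k] (Proj k F)) n = lookup (Proj k F) n"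
      by simp
    then have "(1 / tK) ^ (k - i) * fold tau_ser [i..<k] (lookup (Proj k F)) n = F n"
      using n by (simp add: lookup_fold_T_inv[OF k] lookup_Proj[OF F])
    moreover have "fold tau_ser [i..<k] (lookup (Proj k F)) n = fold tau_ser [i..<k] F n"
      by (rule fold_tau_ser_cong[of i k k]) (use i n in \<open>auto simp: lookup_Proj[OF F]\<close>)
    ultimately show ?thesis by (auto simp: power_divide field_simps)
  qed
  let ?b = "lookup m 1"
  have "K_converges (\<lambda>k. qK ^ ?b * F (rot (Suc M) m) * tK ^ (k - i)) (qK ^ ?b * F (rot (Suc M) m) * 0)"
    by (intro K_converges_mult_left K_converges_tK_power_shift)
  moreover have "qK ^ ?b * F (rot (Suc M) m) * tK ^ (k - i) = varpi_ser k (fold tau_ser [i..<k] F) m"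
    if k: "Suc M \<le> k" for k
  proof -
    have m: "keys m \<subseteq> {1..k}" using keys_mono[OF M(2)] k by simp
    have "F (rot k m) = F (rot (Suc M) m)"
      using rot_symmetric[of M F m k] P_symD[OF assms(1)] i M k by simp
    moreover have "fold tau_ser [i..<k] F (rot k m) = tK ^ (k - i) * F (rot k m)"
      by (rule C) (use keys_rot[OF m] M(1) k in auto)
    ultimately show ?thesis using m True by (simp add: varpi_ser_def)
  qed
  ultimately have "K_converges (\<lambda>k. varpi_ser k (fold tau_ser [i..<k] F) m)
      (qK ^ ?b * F (rot (Suc M) m) * 0)"
    by (rule K_converges_cong_ge)
  then show ?thesis by simp
qed

lemma Y_fin_converges:
  assumes "F \<in> P_sym L" "1 \<le> i"
  shows "\<exists>c. \<forall>m. K_converges (\<lambda>k. lookup (Y_fin i k (Proj k F)) m) (c m)"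
    and "L < i \<Longrightarrow> K_converges (\<lambda>k. lookup (Y_fin i k (Proj k F)) m) 0"
proof -
  have F: "F \<in> P_inf" using assms(1) by (simp add: P_sym_def)
  let ?V = "\<lambda>k. varpi_ser k (fold tau_ser [i..<k] F)"
  have Y: "K_converges (\<lambda>k. lookup (Y_fin i k (Proj k F)) m) (tK * fold T_ser [1..<i] l m)"
    if "\<And>m. K_converges (\<lambda>k. ?V k m) (l m)" for l m
  proof -
    have "K_converges (\<lambda>k. tK * fold T_ser [1..<i] (?V k) m) (tK * fold T_ser [1..<i] l m)"
      by (intro K_converges_mult_left fold_T_ser_converges that)
    moreover have "tK * fold T_ser [1..<i] (?V k) m = lookup (Y_fin i k (Proj k F)) m"
      if "i \<le> k" for k
      using lookup_Y_fin_Proj[OF assms(2) that F, of m] by (simp add: Y_ser_def)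
    ultimately show ?thesis by (rule K_converges_cong_ge)
  qed
  have "\<exists>l. \<forall>m. K_converges (\<lambda>k. ?V k m) (l m)"
    by (rule choice) (rule allI, rule varpi_ser_converges[OF P_symD[OF assms(1)] assms(2)])
  then obtain l where l: "\<And>m. K_converges (\<lambda>k. ?V k m) (l m)" by auto
  show "\<exists>c. \<forall>m. K_converges (\<lambda>k. lookup (Y_fin i k (Proj k F)) m) (c m)"
    by (rule exI[of _ "\<lambda>m. tK * fold T_ser [1..<i] l m"]) (rule allI, rule Y, rule l)
  show "K_converges (\<lambda>k. lookup (Y_fin i k (Proj k F)) m) 0" if "L < i"
  proof -
    have "fold T_ser js (\<lambda>m. 0) = (\<lambda>m. 0)" for js
      using fold_T_ser_scale[of js 0 "\<lambda>m. 0"] by simp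
    then show ?thesis
      using Y[of "\<lambda>m. 0" m] varpi_ser_converges_zero[OF assms(1) that] by simp
  qed
qed

section \<open>Monomial functions and sorting\<close>

definition mon_of :: "nat list \<Rightarrow> mon" where "mon_of xs = Abs_poly_mapping (coord xs)"

lemma lookup_mon_of [simp]: "lookup (mon_of xs) = coord xs"
proof -
  have "{j. coord xs j \<noteq> 0} \<subseteq> {..length xs}" by (auto simp: coord_def)
  then have "finite {j. coord xs j \<noteq> 0}" using finite_subset by blast
  then show ?thesis unfolding mon_of_def by simp
qed

definition tail :: "nat \<Rightarrow> mon \<Rightarrow> nat multiset" where
  "tail L m = image_mset (lookup m) (mset_set (keys m \<inter> {L<..}))"

definition in_support :: "nat list \<times> nat list \<Rightarrow> mon \<Rightarrow> bool" where
  "in_support p m \<longleftrightarrow> (\<forall>r\<le>length (fst p). lookup m r = coord (fst p) r) \<and>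
     tail (length (fst p)) m = mset (snd p)"

lemma m_as_eq: "m_as (lam, mu) m = (if in_support (lam, mu) m then 1 else 0)"
proof (cases "\<forall>r\<le>length lam. lookup m r = coord lam r")
  case True
  define b where "b = m - mon_of lam"
  have lb: "lookup b r = (if r \<le> length lam then 0 else lookup m r)" for r
    using True by (simp add: b_def lookup_minus coord_def)
  have m: "m = mon_of lam + b"
    by (rule poly_mapping_eqI) (use True in \<open>auto simp: lookup_add lb coord_def\<close>)
  have k: "keys b = keys m \<inter> {length lam<..}"
    by (auto simp: in_keys_iff lb split: if_splits)
  then have "keys b \<subseteq> {length lam<..}" by simp
  moreover have "image_mset (lookup b) (mset_set (keys b)) = tail (length lam) m"
    unfolding k tail_def by (rule image_mset_cong) (auto simp: lb)
  ultimately have "m_as (lam, mu) m = (if tail (length lam) m = mset mu then 1 else 0)"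
    using m by (auto simp: mon_mult_def m_sym_def mon_of_def[symmetric] b_def[symmetric])
  then show ?thesis using True by (simp add: in_support_def)
next
  case False
  have "m_as (lam, mu) m = 0"
  proof (rule ccontr)
    assume "m_as (lam, mu) m \<noteq> 0"
    then obtain b where b: "m = mon_of lam + b" "keys (m - mon_of lam) \<subseteq> {length lam<..}"
      by (auto simp: mon_mult_def m_sym_def mon_of_def[symmetric] split: if_splits)
    then have "keys b \<subseteq> {length lam<..}" by simp
    then have "lookup b r = 0" if "r \<le> length lam" for r
      using that by (auto simp: in_keys_iff subset_iff)
    then show False using False b(1) by (auto simp: lookup_add)
  qed
  then show ?thesis using False by (auto simp: in_support_def)
qed

lemma tail_swap:
  assumes "L < j" shows "tail L (swap_mon j m) = tail L m"
proof -
  let ?t = "transpose j (Suc j)"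
  let ?A = "keys m \<inter> {L<..}"
  have B: "keys (swap_mon j m) \<inter> {L<..} = ?t ` ?A" (is "?B = _")
  proof
    show "?B \<subseteq> ?t ` ?A"
    proof
      fix r assume r: "r \<in> ?B"
      then have "?t r \<in> ?A" using assms by (auto simp: in_keys_iff transpose_def)
      then have "?t (?t r) \<in> ?t ` ?A" by (rule imageI)
      then show "r \<in> ?t ` ?A" by simp
    qed
    show "?t ` ?A \<subseteq> ?B" using assms by (auto simp: in_keys_iff transpose_def)
  qed
  have "tail L (swap_mon j m) = image_mset (\<lambda>r. lookup m (?t r)) (mset_set (?t ` ?A))"
    unfolding tail_def B by (rule image_mset_cong) simp
  also have "mset_set (?t ` ?A) = image_mset ?t (mset_set ?A)"
    by (rule image_mset_mset_set[symmetric]) (metis inj_onI transpose_involutory)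
  finally show ?thesis by (simp add: tail_def multiset.map_comp comp_def)
qed

lemma in_support_swap:
  assumes "length (fst p) < j" shows "in_support p (swap_mon j m) \<longleftrightarrow> in_support p m"
  using assms by (auto simp: in_support_def tail_swap transpose_def)

lemma desc_eqI:
  fixes xs ys :: "nat list"
  assumes "sorted_wrt (\<ge>) xs" "sorted_wrt (\<ge>) ys" "mset xs = mset ys" shows "xs = ys"
proof -
  have "sorted (rev xs)" "sorted (rev ys)" using assms(1,2) by (simp_all add: sorted_wrt_rev)
  then have "rev xs = rev ys" using assms(3) by (metis mset_rev properties_for_sort)
  then show ?thesis by simp
qed

lemma desc_filter_zeros:
  fixes xs :: "nat list"
  assumes "sorted_wrt (\<ge>) xs"
  shows "\<exists>n. xs = filter (\<lambda>x. x \<noteq> 0) xs @ replicate n 0"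
  using assms
proof (induction xs)
  case (Cons x xs)
  then obtain n where n: "xs = filter (\<lambda>x. x \<noteq> 0) xs @ replicate n 0" by auto
  show ?case
  proof (cases "x = 0")
    case True
    then have "filter (\<lambda>x. x \<noteq> 0) xs = []" using Cons.prems by (auto simp: filter_empty_conv)
    then have "x # xs = filter (\<lambda>x. x \<noteq> 0) (x # xs) @ replicate (Suc n) 0"
      using n True by simp
    then show ?thesis by blast
  next
    case False
    then show ?thesis using n by (intro exI[of _ n]) simp
  qed
qed simp

lemma sorted_support_unique:
  assumes "in_support (lam, mu) m" "is_partition mu" "keys m \<subseteq> {1..k}"
    and "\<And>j. length lam < j \<Longrightarrow> j < k \<Longrightarrow> lookup m (Suc j) \<le> lookup m j"
  shows "m = mon_of (lam @ mu)"
proof -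
  let ?L = "length lam" and ?f = "lookup m"
  define xs where "xs = map ?f [Suc ?L..<Suc k]"
  have mono: "?f b \<le> ?f a" if "?L < a" "a \<le> b" "b \<le> k" for a b
    using that(2,3)
  proof (induction b rule: dec_induct)
    case (step n)
    then show ?case using assms(4)[of n] that(1) by simp
  qed simp
  have "sorted_wrt (\<ge>) xs"
    unfolding sorted_wrt_iff_nth_less xs_def using mono by (simp del: upt_Suc)
  then obtain n where n: "xs = filter (\<lambda>x. x \<noteq> 0) xs @ replicate n 0" using desc_filter_zeros by blast
  have "keys m \<inter> {?L<..} = {r \<in> {Suc ?L..<Suc k}. ?f r \<noteq> 0}"
    using assms(3) by (auto simp: in_keys_iff subset_iff)
  moreover have "mset xs = image_mset ?f (mset_set {Suc ?L..<Suc k})"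
    unfolding xs_def mset_map mset_upt ..
  ultimately have "mset (filter (\<lambda>x. x \<noteq> 0) xs) = tail ?L m"
    by (simp only: tail_def mset_filter filter_mset_image_mset filter_mset_mset_set finite_atLeastLessThan)
  then have "filter (\<lambda>x. x \<noteq> 0) xs = mu"
    using assms(1,2) \<open>sorted_wrt (\<ge>) xs\<close>
    by (intro desc_eqI) (auto simp: in_support_def is_partition_def intro: sorted_wrt_filter)
  then have xs: "xs = mu @ replicate n 0" using n by simp
  show ?thesis
  proof (rule poly_mapping_eqI)
    fix r
    consider "r \<le> ?L" | "?L < r" "r \<le> k" | "k < r" "?L < r" by linarith
    then show "?f r = lookup (mon_of (lam @ mu)) r"
    proof cases
      case 1
      then show ?thesis using assms(1) by (auto simp: in_support_def coord_def nth_append)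
    next
      case 2
      then have "?f r = xs ! (r - Suc ?L)" "r - Suc ?L < length xs"
        by (simp_all add: xs_def del: upt_Suc)
      then show ?thesis using 2 unfolding xs
        by (auto simp: coord_def nth_append split: if_splits)
    next
      case 3
      have "length xs = k - ?L" by (simp add: xs_def del: upt_Suc)
      then have "length mu \<le> k - ?L" unfolding xs by simp
      moreover have "?f r = 0" using 3 assms(3) by (auto simp: in_keys_iff subset_iff)
      ultimately show ?thesis using 3 by (auto simp: coord_def)
    qed
  qed
qed

definition sorting_step :: "nat \<Rightarrow> nat \<Rightarrow> mon \<Rightarrow> mon \<Rightarrow> bool" where
  "sorting_step L k m m' \<longleftrightarrow> (\<exists>j. L < j \<and> j < k \<and>
     lookup m j < lookup m (Suc j) \<and> m' = swap_mon j m)"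

lemma vec_mon_swap: "vec_mon (swap_mon j m) = vec_mon m \<circ> transpose j (Suc j)"
  by (simp add: vec_mon_def fun_eq_iff)

text \<open>Bubble sort.  Along its steps the coefficients of a symmetric polynomial do not change and the order
  decreases, so both questions about a monomial reduce to the one with sorted tail.\<close>

lemma sorting_terminates:
  assumes "in_support (lam, mu) m" "is_partition mu" "keys m \<subseteq> {1..k}"
  shows "(sorting_step (length lam) k)\<^sup>*\<^sup>* m (mon_of (lam @ mu))"
  using assms(1,3)
proof (induction m rule: measure_induct_rule[where f = "\<lambda>m. nat (\<Sum>r=1..k. int r * vec_mon m r)"])
  case (less m)
  show ?case
  proof (cases "\<forall>j. length lam < j \<longrightarrow> j < k \<longrightarrow> lookup m (Suc j) \<le> lookup m j")
    case True
    then have "m = mon_of (lam @ mu)"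
      using sorted_support_unique[OF less.prems(1) assms(2) less.prems(2)] by blast
    then show ?thesis by simp
  next
    case False
    then obtain j where j: "length lam < j" "j < k" "lookup m j < lookup m (Suc j)"
      by (auto simp: not_le)
    let ?x = "vec_mon m"
    have "vec_mon (swap_mon j m) = ?x(j := ?x (Suc j), Suc j := ?x j)"
      by (auto simp: vec_mon_swap fun_eq_iff transpose_def)
    then have "(\<Sum>r=1..k. int r * vec_mon (swap_mon j m) r) = (\<Sum>r=1..k. int r * ?x r) + ?x j - ?x (Suc j)"
      using sum_upd2[of "{1..k}" j "Suc j" "\<lambda>r z. int r * z" ?x "?x (Suc j)" "?x j"] j
      by (simp add: algebra_simps)
    moreover have "?x j < ?x (Suc j)" using j by (simp add: vec_mon_def)
    ultimately have "(\<Sum>r=1..k. int r * vec_mon (swap_mon j m) r) < (\<Sum>r=1..k. int r * ?x r)"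
      by linarith
    moreover have "0 \<le> (\<Sum>r=1..k. int r * vec_mon (swap_mon j m) r)"
      by (simp add: vec_mon_def sum_nonneg)
    ultimately have "nat (\<Sum>r=1..k. int r * vec_mon (swap_mon j m) r) < nat (\<Sum>r=1..k. int r * ?x r)"
      by (simp only: nat_less_eq_zless)
    moreover have "in_support (lam, mu) (swap_mon j m)" using less.prems j by (simp add: in_support_swap)
    moreover have "keys (swap_mon j m) \<subseteq> {1..k}"
      using keys_swap_mon[of j "{1..k}" m] less.prems(2) j by simp
    ultimately have "(sorting_step (length lam) k)\<^sup>*\<^sup>* (swap_mon j m) (mon_of (lam @ mu))"
      by (rule less.IH)
    moreover have "sorting_step (length lam) k m (swap_mon j m)"
      using j by (auto simp: sorting_step_def)
    ultimately show ?thesis by (meson converse_rtranclp_into_rtranclp)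
  qed
qed

lemma sorting_coefficient:
  assumes "(sorting_step L k)\<^sup>*\<^sup>* m m'" "\<And>j. L < j \<Longrightarrow> j < k \<Longrightarrow> s_pol j f = f"
  shows "lookup f m' = lookup f m"
  using assms(1)
proof (induction rule: rtranclp_induct)
  case (step y z)
  then obtain j where "L < j" "j < k" "z = swap_mon j y" by (auto simp: sorting_step_def)
  then have "lookup f z = lookup f y"
    using assms(2)[of j] lookup_s_pol[of j f y] by simp
  then show ?case using step by simp
qed simp

lemma sorting_lek:
  assumes "(sorting_step L k)\<^sup>*\<^sup>* m m'" shows "lek k (vec_mon m') (vec_mon m)"
  using assms
proof (induction rule: rtranclp_induct)
  case (step y z)
  then obtain j where j: "L < j" "j < k" "lookup y j < lookup y (Suc j)"
    "z = swap_mon j y" by (auto simp: sorting_step_def)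
  then have "lower k (vec_mon z) (vec_mon y)"
    unfolding j(4) vec_mon_swap by (intro lower_swap) (auto simp: vec_mon_def)
  then show ?case using step by (meson converse_rtranclp_into_rtranclp)
qed simp

lemma lek_sorting:
  assumes "(sorting_step L k)\<^sup>*\<^sup>* m m'" "lek k x (vec_mon m)"
    and "\<And>j. L < j \<Longrightarrow> j < k \<Longrightarrow> x (Suc j) \<le> x j"
  shows "lek k x (vec_mon m')"
  using assms(1)
proof (induction rule: rtranclp_induct)
  case base
  show ?case by fact
next
  case (step y z)
  then obtain j where j: "L < j" "j < k" "lookup y j < lookup y (Suc j)"
    "z = swap_mon j y" by (auto simp: sorting_step_def)
  have "lek k (sort_at j x) (sort_at j (vec_mon y))" by (rule lek_sort_at) (use j step in auto)
  moreover have "sort_at j x = x" using assms(3)[of j] j by (simp add: sort_at_def)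
  moreover have "sort_at j (vec_mon y) = vec_mon z"
    unfolding j(4) vec_mon_swap using j by (simp add: sort_at_def vec_mon_def)
  ultimately show ?case by simp
qed

section \<open>The basis of series symmetric in almost all variables\<close>

lemma in_support_keys: "in_support p m \<Longrightarrow> keys m \<subseteq> {1..}"
proof
  fix r assume "in_support p m" "r \<in> keys m"
  then show "r \<in> {1..}" by (cases "r = 0") (auto simp: in_support_def coord_def in_keys_iff)
qed

lemma sum_coord: "(\<Sum>r\<le>length xs. coord xs r) = sum_list xs"
  by (simp add: sum.atMost_shift coord_def sum_list_sum_nth atLeast0LessThan)

lemma in_support_mdeg:
  assumes "in_support (lam, mu) m" shows "mdeg m = sum_list lam + sum_list mu"
proof -
  let ?f = "lookup m" and ?K = "keys m" and ?L = "length lam"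
  have "mdeg m = sum ?f (?K \<inter> {..?L}) + sum ?f (?K \<inter> {?L<..})"
    unfolding mdeg_def by (subst sum.union_disjoint[symmetric]) (auto intro: sum.cong)
  also have "sum ?f (?K \<inter> {..?L}) = sum ?f {..?L}"
    by (rule sum.mono_neutral_left) (auto simp: in_keys_iff)
  also have "\<dots> = (\<Sum>r\<le>?L. coord lam r)"
    using assms by (intro sum.cong) (auto simp: in_support_def)
  also have "sum ?f (?K \<inter> {?L<..}) = sum_list mu"
    using assms by (simp add: in_support_def tail_def sum_unfold_sum_mset sum_mset_sum_list)
  finally show ?thesis by (simp add: sum_coord)
qed

lemma m_as_P_sym: "m_as (lam, mu) \<in> P_sym (length lam)"
proof -
  have "m_as (lam, mu) \<in> P_inf"
    unfolding P_inf_def m_as_eq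
    using in_support_keys in_support_mdeg by (auto intro!: exI[of _ "sum_list lam + sum_list mu"])
  moreover have "s_ser i (m_as (lam, mu)) = m_as (lam, mu)" if "length lam < i" for i
    using that by (simp add: s_ser_def fun_eq_iff m_as_eq in_support_swap del: m_as.simps)
  ultimately show ?thesis by (simp add: P_sym_def del: m_as.simps)
qed

lemma support_exists:
  assumes "keys m \<subseteq> {1..}"
  shows "\<exists>lam mu. length lam = L \<and> is_partition mu \<and> in_support (lam, mu) m"
proof (intro exI conjI)
  let ?lam = "map (lookup m) [1..<Suc L]"
  let ?mu = "rev (sorted_list_of_multiset (tail L m))"
  show "length ?lam = L" by simp
  have "0 \<notin># tail L m" by (auto simp: tail_def in_keys_iff)
  then show "is_partition ?mu"
    by (simp add: is_partition_def sorted_wrt_rev)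
  have "lookup m 0 = 0" using assms by (auto simp: in_keys_iff subset_iff)
  moreover have "[1..<Suc L] ! (r - 1) = r" if "1 \<le> r" "r \<le> L" for r
    using that by (simp del: upt_Suc)
  ultimately show "in_support (?lam, ?mu) m"
    by (auto simp: in_support_def coord_def not_less_eq_eq simp del: upt_Suc)
qed

lemma support_unique:
  assumes "in_support (lam, mu) m" "in_support (lam', mu') m" "length lam = length lam'"
    "is_partition mu" "is_partition mu'"
  shows "lam = lam' \<and> mu = mu'"
proof
  show "lam = lam'"
  proof (rule nth_equalityI)
    fix r assume r: "r < length lam"
    then have "coord lam (Suc r) = coord lam' (Suc r)"
      using assms(1-3) by (simp add: in_support_def)
    then show "lam ! r = lam' ! r" using r assms(3) by (simp add: coord_def)
  qed (rule assms(3))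
  show "mu = mu'" using assms by (intro desc_eqI) (auto simp: in_support_def is_partition_def)
qed

definition indices :: "nat \<Rightarrow> nat \<Rightarrow> (nat list \<times> nat list) set" where
  "indices L d = {(lam, mu). length lam = L \<and> is_partition mu \<and> sum_list lam + sum_list mu \<le> d}"

lemma finite_indices: "finite (indices L d)"
proof (rule finite_subset)
  have "length xs \<le> sum_list xs" if "0 \<notin> set xs" for xs :: "nat list"
    using that by (induction xs) auto
  then show "indices L d \<subseteq> {xs. set xs \<subseteq> {..d} \<and> length xs \<le> L} \<times> {xs. set xs \<subseteq> {..d} \<and> length xs \<le> d}"
    using member_le_sum_list by (fastforce simp: indices_def is_partition_def)
  show "finite ({xs. set xs \<subseteq> {..d} \<and> length xs \<le> L} \<times> {xs. set xs \<subseteq> {..d} \<and> length xs \<le> d})"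
    by (intro finite_cartesian_product finite_lists_length_le) auto
qed

lemma sum_m_as:
  assumes "keys m \<subseteq> {1..}" "mdeg m \<le> d"
  shows "(\<Sum>p\<in>indices L d. m_as p m) = 1"
proof -
  obtain lam mu where p: "length lam = L" "is_partition mu" "in_support (lam, mu) m"
    using support_exists[OF assms(1)] by blast
  have "(\<Sum>p\<in>indices L d. m_as p m) = (\<Sum>p\<in>indices L d. if p = (lam, mu) then 1 else 0)"
  proof (rule sum.cong)
    fix q assume q: "q \<in> indices L d"
    obtain a b where ab: "q = (a, b)" by (cases q)
    then have "in_support (a, b) m \<longleftrightarrow> q = (lam, mu)"
      using p q support_unique[of a b m lam mu] by (auto simp: indices_def)
    then show "m_as q m = (if q = (lam, mu) then 1 else 0)" unfolding ab m_as_eq by simp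
  qed simp
  moreover have "(lam, mu) \<in> indices L d"
    using p assms(2) in_support_mdeg by (simp add: indices_def)
  ultimately show ?thesis using finite_indices by simp
qed

text \<open>Sorting the tail takes every monomial to the sorted monomial of exactly one basis element and
  does not change its coefficient in \<open>f\<close>.\<close>

lemma symmetric_expansion:
  assumes "f \<in> Pol k" "\<And>j. L < j \<Longrightarrow> j < k \<Longrightarrow> s_pol j f = f"
    and "\<And>m. m \<in> keys f \<Longrightarrow> mdeg m \<le> d"
  shows "f = (\<Sum>p\<in>indices L d. cst (lookup f (mon_of (fst p @ snd p))) * Proj k (m_as p))"
proof (rule poly_mapping_eqI)
  fix m
  have inf: "m_as p \<in> P_inf" for p using m_as_P_sym[of "fst p" "snd p"] by (simp add: P_sym_def)
  show "lookup f m = lookup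
    (\<Sum>p\<in>indices L d. cst (lookup f (mon_of (fst p @ snd p))) * Proj k (m_as p)) m"
  proof (cases "keys m \<subseteq> {1..k}")
    case True
    have "lookup f (mon_of (fst p @ snd p)) * m_as p m = lookup f m * m_as p m"
      if p: "p \<in> indices L d" for p
    proof (cases "in_support p m")
      case True
      obtain lam mu where "p = (lam, mu)" "length lam = L" "is_partition mu"
        using p by (auto simp: indices_def)
      then have "(sorting_step L k)\<^sup>*\<^sup>* m (mon_of (fst p @ snd p))"
        using sorting_terminates[of lam mu m k] True \<open>keys m \<subseteq> {1..k}\<close> by simp
      then show ?thesis using sorting_coefficient[OF _ assms(2)] by simp
    next
      case False
      then have "m_as p m = 0" using m_as_eq[of "fst p" "snd p" m] by simp
      then show ?thesis by simp
    qed
    then have "(\<Sum>p\<in>indices L d. lookup f (mon_of (fst p @ snd p)) * m_as p m) =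
        lookup f m * (\<Sum>p\<in>indices L d. m_as p m)"
      unfolding sum_distrib_left by (rule sum.cong[OF refl])
    moreover have "(\<Sum>p\<in>indices L d. m_as p m) = 1" if "lookup f m \<noteq> 0"
      by (rule sum_m_as) (use True that assms(3) in \<open>auto simp: in_keys_iff\<close>)
    ultimately show ?thesis using True by (auto simp: lookup_sum lookup_Proj[OF inf])
  next
    case False
    then have "lookup f m = 0" using assms(1) by (auto simp: Pol_def in_keys_iff)
    then show ?thesis using False by (simp add: lookup_sum lookup_Proj[OF inf])
  qed
qed

section \<open>Existence and uniqueness of limits\<close>

lemma represents_Proj:
  assumes "G \<in> P_inf" shows "represents k0 (\<lambda>k. Proj k G) G"
proof -
  have "proj k (Proj k G) = Proj (k - 1) G" if "k0 < k" for k
  proof (rule poly_mapping_eqI)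
    fix m :: mon
    have "keys m \<subseteq> {1..k - 1} \<longleftrightarrow> keys m \<subseteq> {1..k} \<and> k \<notin> keys m"
    proof -
      have e: "{1..k} = insert k {1..k - 1}" "k \<notin> {1..k - 1}" using that by auto
      show ?thesis unfolding e(1) using e(2) by blast
    qed
    then show "lookup (proj k (Proj k G)) m = lookup (Proj (k - 1) G) m"
      by (auto simp: lookup_proj lookup_Proj[OF assms])
  qed
  then show ?thesis unfolding represents_def using assms Proj_Pol by blast
qed

text \<open>In the expansion above only the coefficients vary with \<open>k\<close>, so convergence of coefficients is
  enough and the compatible part of the limit can be taken to be zero.\<close>

lemma has_limit_symmetric:
  assumes "\<And>k. k0 \<le> k \<Longrightarrow> f k \<in> Pol k"
    and "\<And>k j. k0 \<le> k \<Longrightarrow> L < j \<Longrightarrow> j < k \<Longrightarrow> s_pol j (f k) = f k"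
    and "\<And>k m. k0 \<le> k \<Longrightarrow> m \<in> keys (f k) \<Longrightarrow> mdeg m \<le> d"
    and "\<And>m. K_converges (\<lambda>k. lookup (f k) m) (c m)"
  shows "has_limit f (\<lambda>m. \<Sum>p\<in>indices L d. c (mon_of (fst p @ snd p)) * m_as p m)"
proof -
  define N where "N = card (indices L d)"
  obtain h where h: "bij_betw h {1..N} (indices L d)"
    using ex_bij_betw_nat_finite_1[OF finite_indices] unfolding N_def by blast
  have "(replicate L 0, []) \<in> indices L d" by (simp add: indices_def is_partition_def sum_list_replicate)
  then have N: "1 \<le> N" unfolding N_def using finite_indices by (metis One_nat_def Suc_leI card_gt_0_iff empty_iff)
  have inf: "m_as p \<in> P_inf" and as: "m_as p \<in> P_as" for p
    using m_as_P_sym[of "fst p" "snd p"] by (auto simp: P_sym_def P_as_def simp del: m_as.simps)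
  let ?a = "\<lambda>i k. lookup (f k) (mon_of (fst (h i) @ snd (h i)))"
  have zero: "(\<lambda>m. 0) \<in> P_inf" "Proj k (\<lambda>m. 0) = 0" for k
    by (simp_all add: P_inf_def Proj_def)
  show ?thesis unfolding has_limit_def
  proof (intro exI conjI allI impI ballI)
    show "N \<ge> 1" by (rule N)
    show "represents k0 (\<lambda>k. 0) (\<lambda>m. 0)" using represents_Proj[OF zero(1)] zero(2) by simp
    fix i
    show "represents k0 (\<lambda>k. Proj k (m_as (h i))) (m_as (h i))" by (rule represents_Proj[OF inf])
    show "m_as (h i) \<in> P_as" by (rule as)
    show "K_converges (?a i) (c (mon_of (fst (h i) @ snd (h i))))" by (rule assms(4))
  next
    fix k assume k: "k0 \<le> k"
    have "f k = (\<Sum>p\<in>indices L d. cst (lookup (f k) (mon_of (fst p @ snd p))) * Proj k (m_as p))"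
      by (rule symmetric_expansion) (use assms k in auto)
    also have "\<dots> = (\<Sum>i=1..N. cst (?a i k) * Proj k (m_as (h i)))"
      by (rule sum.reindex_bij_betw[OF h, symmetric])
    finally show "f k = 0 + (\<Sum>i=1..N. cst (?a i k) * Proj k (m_as (h i)))" by simp
  next
    show "(\<lambda>m. \<Sum>p\<in>indices L d. c (mon_of (fst p @ snd p)) * m_as p m) =
      (\<lambda>m. 0 + (\<Sum>i=1..N. c (mon_of (fst (h i) @ snd (h i))) * m_as (h i) m))"
      unfolding sum.reindex_bij_betw[OF h, symmetric] by simp
  qed
qed

text \<open>A limit is determined by its coefficients, which are the limits of those of the sequence; this
  gives independence of the chosen decomposition.\<close>

lemma has_limit_coefficients:
  assumes "has_limit f F"
  shows "keys m \<subseteq> {1..} \<Longrightarrow> K_converges (\<lambda>k. lookup (f k) m) (F m)"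
    and "\<not> keys m \<subseteq> {1..} \<Longrightarrow> F m = 0"
proof -
  obtain k0 N h g a H G l where E: "N \<ge> (1::nat) \<and>
      (\<forall>k\<ge>k0. f k = h k + (\<Sum>i=1..N. cst (a i k) * g i k)) \<and> represents k0 h H \<and>
      (\<forall>i\<in>{1..N}. represents k0 (g i) (G i) \<and> G i \<in> P_as \<and> K_converges (a i) (l i)) \<and>
      F = (\<lambda>m. H m + (\<Sum>i=1..N. l i * G i m))"
    using assms unfolding has_limit_def by (elim exE)
  have f: "f k = h k + (\<Sum>i=1..N. cst (a i k) * g i k)" if "k0 \<le> k" for k using E that by blast
  have H: "represents k0 h H" using E by blast
  have G: "represents k0 (g i) (G i) \<and> K_converges (a i) (l i)" if "i \<in> {1..N}" for i using E that by blast
  have F: "F = (\<lambda>m. H m + (\<Sum>i=1..N. l i * G i m))" using E by blast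
  show "F m = 0" if "\<not> keys m \<subseteq> {1..}"
  proof -
    have "H m = 0" using H that by (auto simp: represents_def P_inf_def)
    moreover have "G i m = 0" if "i \<in> {1..N}" for i
      using G[OF that] \<open>\<not> keys m \<subseteq> {1..}\<close> by (auto simp: represents_def P_inf_def)
    ultimately show ?thesis by (simp add: F)
  qed
  assume "keys m \<subseteq> {1..}"
  note M = keys_mono[OF keys_le_Max[OF this]]
  let ?M = "Max (insert 0 (keys m)) + k0"
  have rep: "lookup (h k) m = H m" if "represents k0 h H" "?M \<le> k" for h H k
  proof -
    have "keys m \<subseteq> {1..k}" by (rule M) (use that(2) in linarith)
    moreover have "H \<in> P_inf" "Proj k H = h k" using that by (auto simp: represents_def)
    ultimately show ?thesis using lookup_Proj[of H k m] by simp
  qed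
  have "K_converges (\<lambda>k. H m + (\<Sum>i=1..N. G i m * a i k)) (H m + (\<Sum>i=1..N. G i m * l i))"
    by (intro K_converges_add K_converges_const K_converges_sum K_converges_mult_left) (use G in blast)
  moreover have "H m + (\<Sum>i=1..N. G i m * a i k) = lookup (f k) m" if "?M \<le> k" for k
  proof -
    have "lookup (f k) m = H m + (\<Sum>i=1..N. a i k * lookup (g i k) m)"
      using f[of k] that rep[OF H that] by (simp add: lookup_add lookup_sum)
    also have "(\<Sum>i=1..N. a i k * lookup (g i k) m) = (\<Sum>i=1..N. G i m * a i k)"
      by (rule sum.cong) (use G rep that in \<open>auto simp: mult.commute\<close>)
    finally show ?thesis by simp
  qed
  ultimately show "K_converges (\<lambda>k. lookup (f k) m) (F m)"
    unfolding F by (auto intro: K_converges_cong_ge simp: mult.commute)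
qed

lemma has_limit_unique:
  assumes "has_limit f F" "has_limit f G" shows "F = G"
proof
  fix m
  show "F m = G m"
    using has_limit_coefficients[OF assms(1), of m] has_limit_coefficients[OF assms(2), of m]
    by (metis K_converges_unique)
qed

lemma limit_operator_eqI: "has_limit (\<lambda>k. A k (Proj k f)) F \<Longrightarrow> limit_operator A f = F"
  unfolding limit_operator_def by (rule the_equality) (auto intro: has_limit_unique)

section \<open>Leading terms of the finite operators on the basis\<close>

lemma vec_of_mon_of: "vec_of xs = vec_mon (mon_of xs)"
  by (simp add: vec_of_def vec_mon_def)

lemma vec_mon_inject: "vec_mon m = vec_mon n \<longleftrightarrow> m = n"
  by (auto simp: vec_mon_def fun_eq_iff intro: poly_mapping_eqI)

lemma keys_mon_of: "length xs \<le> k \<Longrightarrow> keys (mon_of xs) \<subseteq> {1..k}"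
  by (auto simp: in_keys_iff coord_def split: if_splits)

lemma tail_mon_of:
  "tail (length xs) (mon_of (xs @ ys)) = filter_mset (\<lambda>x. x \<noteq> 0) (mset ys)"
proof -
  let ?L = "length xs" and ?f = "coord (xs @ ys)"
  have ys: "ys = map ?f [Suc ?L..<Suc ?L + length ys]"
    by (rule nth_equalityI) (auto simp: coord_def nth_append simp del: upt_Suc)
  have "keys (mon_of (xs @ ys)) \<inter> {?L<..} = {r \<in> {Suc ?L..<Suc ?L + length ys}. ?f r \<noteq> 0}"
    by (auto simp: in_keys_iff coord_def split: if_splits)
  moreover have "mset ys = image_mset ?f (mset_set {Suc ?L..<Suc ?L + length ys})"
    by (subst ys) (simp only: mset_map mset_upt)
  ultimately show ?thesis
    by (simp only: tail_def lookup_mon_of filter_mset_image_mset filter_mset_mset_set finite_atLeastLessThan)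
qed

lemma in_support_mon_of:
  assumes "filter_mset (\<lambda>x. x \<noteq> 0) (mset ys) = mset mu" shows "in_support (xs, mu) (mon_of (xs @ ys))"
  using assms by (auto simp: in_support_def tail_mon_of coord_def nth_append)

lemma filter_mset_positive: "0 \<notin> set xs \<Longrightarrow> filter_mset ((<) (0::nat)) (mset xs) = mset xs"
  by (induction xs) auto

lemma in_support_self: "is_partition mu \<Longrightarrow> in_support (lam, mu) (mon_of (lam @ mu))"
  by (rule in_support_mon_of) (simp add: is_partition_def filter_mset_positive)

lemma lower_sum: "lower k x y \<Longrightarrow> (\<Sum>r=1..k. x r) = (\<Sum>r=1..k. y r)"
  unfolding lower_def using sum_upd2[of "{1..k}" _ _ "\<lambda>_ z. z" y] by fastforce

lemma lek_sum: "lek k x y \<Longrightarrow> (\<Sum>r=1..k. x r) = (\<Sum>r=1..k. y r)"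
  by (induction rule: rtranclp_induct) (auto dest: lower_sum)

lemma mdeg_vec_mon:
  assumes "keys m \<subseteq> {1..k}" shows "int (mdeg m) = (\<Sum>r=1..k. vec_mon m r)"
proof -
  have "mdeg m = (\<Sum>r=1..k. lookup m r)"
    unfolding mdeg_def by (rule sum.mono_neutral_left) (use assms in \<open>auto simp: in_keys_iff\<close>)
  then show ?thesis by (simp add: vec_mon_def)
qed

definition leading_coeff :: "nat \<Rightarrow> nat \<Rightarrow> mon \<Rightarrow> K" where
  "leading_coeff i k n = tK ^ card {r \<in> {1..<i}. lookup n i < lookup n r} *
     ((if 0 < lookup n i then qK ^ lookup n i else 0) *
      tK ^ card {r \<in> {i<..k}. lookup n i \<le> lookup n r})"

text \<open>The leading coefficient is read off at a maximal monomial of the truncated basis element; at a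
  smaller one several monomials of the basis element could contribute.\<close>

lemma Y_ser_m_as:
  assumes mu: "is_partition mu" and k: "length (lam @ mu) \<le> k" and i: "1 \<le> i" "i \<le> k"
  shows "\<And>m. keys m \<subseteq> {1..k} \<Longrightarrow> Y_ser i k (m_as (lam, mu)) m \<noteq> 0 \<Longrightarrow>
      \<exists>n. keys n \<subseteq> {1..k} \<and> in_support (lam, mu) n \<and> lek k (vec_mon m) (vec_mon n)"
    and "\<exists>n. keys n \<subseteq> {1..k} \<and> in_support (lam, mu) n \<and>
      Y_ser i k (m_as (lam, mu)) n = leading_coeff i k n"
proof -
  let ?F = "m_as (lam, mu)"
  define S where "S = {n. keys n \<subseteq> {1..k} \<and> in_support (lam, mu) n}"
  define Z where "Z = vec_mon ` S"
  have "S \<subseteq> {n. keys n \<subseteq> {1..k} \<and> mdeg n \<le> sum_list lam + sum_list mu}"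
    unfolding S_def using in_support_mdeg by auto
  then have fin: "finite Z" unfolding Z_def using finite_bounded_mons finite_subset by blast
  have "mon_of (lam @ mu) \<in> S" unfolding S_def using keys_mon_of[OF k] in_support_self[OF mu] by simp
  then have ne: "Z \<noteq> {}" unfolding Z_def by blast
  have "asymp_on Z (pot_less k)"
    by (rule asymp_onI) (use pot_less_irrefl pot_less_trans in blast)
  moreover have "transp_on Z (pot_less k)"
    by (rule transp_onI) (rule pot_less_trans)
  ultimately obtain z where z: "z \<in> Z" "\<And>y. y \<in> Z \<Longrightarrow> y \<noteq> z \<Longrightarrow> \<not> pot_less k z y"
    using Finite_Set.bex_max_element[OF fin _ _ ne, of "pot_less k"] by auto
  then have max: "\<not> pot_less k z y" if "y \<in> Z" for y using that pot_less_irrefl by blast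
  obtain n where n: "n \<in> S" "z = vec_mon n" using z(1) by (auto simp: Z_def)
  have B: "bounded_by k id Z ?F"
    unfolding bounded_by_def m_as_eq Z_def S_def by (auto split: if_splits)
  have T: "top_coeff k id z ?F 1"
    unfolding top_coeff_def m_as_eq using n by (auto simp: S_def vec_mon_inject)
  note Y = Y_ser_triangular[OF i B T max]
  show "\<exists>n. keys n \<subseteq> {1..k} \<and> in_support (lam, mu) n \<and> lek k (vec_mon m) (vec_mon n)"
    if "keys m \<subseteq> {1..k}" "Y_ser i k ?F m \<noteq> 0" for m
    using Y(1) that unfolding bounded_by_def Z_def S_def by auto
  show "\<exists>n. keys n \<subseteq> {1..k} \<and> in_support (lam, mu) n \<and>
      Y_ser i k (m_as (lam, mu)) n = leading_coeff i k n"
  proof (intro exI conjI)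
    show "keys n \<subseteq> {1..k}" "in_support (lam, mu) n" using n by (auto simp: S_def)
    have "z r = int (lookup n r)" for r by (simp add: n vec_mon_def)
    moreover have "id (vec_mon n) = z" by (simp add: n)
    ultimately show "Y_ser i k (m_as (lam, mu)) n = leading_coeff i k n"
      using Y(2) n(1) unfolding top_coeff_def leading_coeff_def by (simp add: S_def del: m_as.simps)
  qed
qed

lemma sorting_card:
  assumes "(sorting_step L k)\<^sup>*\<^sup>* m m'" "i \<le> L"
  shows "card {r \<in> {i<..k}. v \<le> lookup m' r} = card {r \<in> {i<..k}. v \<le> lookup m r}"
  using assms(1)
proof (induction rule: rtranclp_induct)
  case (step y z)
  then obtain j where j: "L < j" "j < k" "z = swap_mon j y" by (auto simp: sorting_step_def)
  let ?t = "transpose j (Suc j)"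
  let ?A = "{r \<in> {i<..k}. v \<le> lookup y r}" and ?B = "{r \<in> {i<..k}. v \<le> lookup z r}"
  have t: "?t r \<in> {i<..k} \<longleftrightarrow> r \<in> {i<..k}" for r
    using j assms(2) by (auto simp: transpose_def)
  have B: "r \<in> ?B \<longleftrightarrow> ?t r \<in> ?A" for r
    unfolding mem_Collect_eq t j(3) lookup_swap_mon ..
  have "?B = ?t ` ?A"
  proof (intro equalityI subsetI)
    fix r assume "r \<in> ?B"
    then have "?t (?t r) \<in> ?t ` ?A" unfolding B by (rule imageI)
    then show "r \<in> ?t ` ?A" by (simp only: transpose_involutory)
  next
    fix r assume "r \<in> ?t ` ?A"
    then obtain s where "s \<in> ?A" "r = ?t s" by (rule imageE)
    then show "r \<in> ?B" unfolding B by (simp only: transpose_involutory)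
  qed
  moreover have "inj_on ?t ?A" by (rule inj_on_inverseI) (rule transpose_involutory)
  ultimately have "card ?B = card ?A" by (simp only: card_image)
  then show ?case using step.IH by simp
qed simp

lemma u_stat_eq:
  assumes "1 \<le> i" "i \<le> length xs" "length xs \<le> k" "0 < coord xs i"
  shows "u_stat xs i = Suc (card {r \<in> {1..<i}. coord xs i < coord xs r}
    + card {r \<in> {i<..k}. coord xs i \<le> coord xs r})"
proof -
  have "{j. 1 \<le> j \<and> j \<le> i \<and> coord xs i < coord xs j} = {r \<in> {1..<i}. coord xs i < coord xs r}"
    by (auto simp: le_less)
  moreover have "{j. i \<le> j \<and> j \<le> length xs \<and> coord xs i \<le> coord xs j} =
      insert i {r \<in> {i<..k}. coord xs i \<le> coord xs r}"
    using assms by (auto simp: coord_def split: if_splits)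
  ultimately show ?thesis by (simp add: u_stat_def)
qed

text \<open>The degree bound needed for the expansion comes from triangularity, since the order compares only
  vectors with the same sum.\<close>

lemma Y_op_expansion:
  assumes mu: "is_partition mu" and i: "1 \<le> i"
    and c: "\<And>m. K_converges (\<lambda>k. lookup (Y_fin i k (Proj k (m_as (lam, mu)))) m) (c m)"
  shows "Y_op i (m_as (lam, mu)) =
    (\<lambda>m. \<Sum>p\<in>indices (max i (length lam)) (sum_list lam + sum_list mu). c (mon_of (fst p @ snd p)) * m_as p m)"
  unfolding Y_op_def
proof (rule limit_operator_eqI, rule has_limit_symmetric)
  let ?F = "m_as (lam, mu)" and ?k0 = "i + length (lam @ mu)"
  have F: "?F \<in> P_sym (length lam)" by (rule m_as_P_sym)
  then have Fi: "?F \<in> P_inf" by (simp add: P_sym_def)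
  fix k assume k: "?k0 \<le> k"
  then have ik: "i \<le> k" "length (lam @ mu) \<le> k" by auto
  show P: "Y_fin i k (Proj k ?F) \<in> Pol k" by (rule Y_fin_Pol[OF i ik(1) Proj_Pol[OF Fi]])
  show "s_pol j (Y_fin i k (Proj k ?F)) = Y_fin i k (Proj k ?F)" if "max i (length lam) < j" "j < k" for j
    by (rule s_pol_Y_fin) (use i that Proj_Pol[OF Fi] s_pol_Proj[OF F] in auto)
  fix m assume m: "m \<in> keys (Y_fin i k (Proj k ?F))"
  then have km: "keys m \<subseteq> {1..k}" using P by (simp add: Pol_def)
  have "Y_ser i k ?F m \<noteq> 0"
    using m lookup_Y_fin_Proj[OF i ik(1) Fi, of m] by (auto simp: in_keys_iff simp del: m_as.simps)
  then obtain n where n: "keys n \<subseteq> {1..k}" "in_support (lam, mu) n" "lek k (vec_mon m) (vec_mon n)"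
    using Y_ser_m_as(1)[OF mu ik(2) i ik(1) km] by blast
  then have "int (mdeg m) = int (mdeg n)"
    unfolding mdeg_vec_mon[OF km] mdeg_vec_mon[OF n(1)] by (intro lek_sum)
  then show "mdeg m \<le> sum_list lam + sum_list mu" using in_support_mdeg[OF n(2)] by simp
qed (rule c)

section \<open>Strict compositions suffice\<close>

lemma K_span_scale_add:
  assumes "F \<in> K_span B" "G \<in> K_span B" shows "(\<lambda>m. a * F m + b * G m) \<in> K_span B"
proof -
  obtain S u where S: "finite S" "S \<subseteq> B" "F = (\<lambda>m. \<Sum>H\<in>S. u H * H m)"
    using assms(1) by (auto simp: K_span_def)
  obtain T v where T: "finite T" "T \<subseteq> B" "G = (\<lambda>m. \<Sum>H\<in>T. v H * H m)"
    using assms(2) by (auto simp: K_span_def)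
  let ?w = "\<lambda>H. a * (if H \<in> S then u H else 0) + b * (if H \<in> T then v H else 0)"
  have "(\<lambda>m. a * F m + b * G m) = (\<lambda>m. \<Sum>H\<in>S \<union> T. ?w H * H m)"
  proof
    fix m
    have "(\<Sum>H\<in>S. u H * H m) = (\<Sum>H\<in>S \<union> T. (if H \<in> S then u H else 0) * H m)"
      using S(1) T(1) by (intro sum.mono_neutral_cong_left) auto
    moreover have "(\<Sum>H\<in>T. v H * H m) = (\<Sum>H\<in>S \<union> T. (if H \<in> T then v H else 0) * H m)"
      using S(1) T(1) by (intro sum.mono_neutral_cong_left) auto
    ultimately have "a * F m + b * G m =
        a * (\<Sum>H\<in>S \<union> T. (if H \<in> S then u H else 0) * H m) +
        b * (\<Sum>H\<in>S \<union> T. (if H \<in> T then v H else 0) * H m)"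
      unfolding S(3) T(3) by (simp only:)
    also have "\<dots> = (\<Sum>H\<in>S \<union> T. ?w H * H m)"
      unfolding sum_distrib_left sum.distrib[symmetric] by (rule sum.cong) (auto simp: algebra_simps)
    finally show "a * F m + b * G m = (\<Sum>H\<in>S \<union> T. ?w H * H m)" .
  qed
  then show ?thesis unfolding K_span_def using S T by (intro CollectI exI[of _ "S \<union> T"] exI[of _ ?w]) auto
qed

lemma K_span_zero: "(\<lambda>m. 0) \<in> K_span B"
  unfolding K_span_def by (intro CollectI exI[of _ "{}"]) simp

lemma K_span_base: "F \<in> B \<Longrightarrow> F \<in> K_span B"
  unfolding K_span_def by (intro CollectI exI[of _ "{F}"] exI[of _ "\<lambda>_. 1"]) simp

lemma K_span_sum:
  assumes "\<And>x. x \<in> A \<Longrightarrow> a x \<noteq> 0 \<Longrightarrow> F x \<in> K_span B" shows "(\<lambda>m. \<Sum>x\<in>A. a x * F x m) \<in> K_span B"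
  using assms
proof (induction A rule: infinite_finite_induct)
  case (insert x A)
  have IH: "(\<lambda>m. \<Sum>x\<in>A. a x * F x m) \<in> K_span B" using insert by simp
  show ?case
  proof (cases "a x = 0")
    case True
    then show ?thesis using IH insert.hyps by simp
  next
    case False
    then have "(\<lambda>m. a x * F x m + 1 * (\<Sum>x\<in>A. a x * F x m)) \<in> K_span B"
      using insert.prems IH by (intro K_span_scale_add) auto
    then show ?thesis using insert.hyps by simp
  qed
qed (simp_all add: K_span_zero)

lemma coord_append: "r \<le> length xs \<Longrightarrow> coord (xs @ ys) r = coord xs r"
  by (auto simp: coord_def nth_append)

text \<open>A trailing zero is removed by distinguishing the exponent of the last of the first variables in a
  monomial of the function without that zero.\<close>

lemma m_as_append_zero:
  assumes "0 \<notin> set nu"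
  shows "m_as (al @ [0], nu) m = m_as (al, nu) m - (\<Sum>c\<in>set nu. m_as (al @ [c], remove1 c nu) m)"
proof (cases "\<forall>r\<le>length al. lookup m r = coord al r")
  case False
  then obtain r where r: "r \<le> length al" "lookup m r \<noteq> coord al r" by blast
  then have "\<not> in_support (al @ [x], nu') m" for x nu'
    using coord_append[of r al "[x]"] by (auto simp: in_support_def intro!: exI[of _ r])
  moreover have "\<not> in_support (al, nu) m" using False by (simp add: in_support_def)
  ultimately show ?thesis unfolding m_as_eq by simp
next
  case True
  let ?n = "Suc (length al)"
  let ?v = "lookup m ?n"
  have s: "in_support (al @ [x], nu') m \<longleftrightarrow> ?v = x \<and> tail ?n m = mset nu'" for x nu'
  proof -
    have "(\<forall>r\<le>?n. lookup m r = coord (al @ [x]) r) \<longleftrightarrow>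
        (\<forall>r\<le>length al. lookup m r = coord (al @ [x]) r) \<and> ?v = coord (al @ [x]) ?n"
      by (auto simp: le_Suc_eq)
    also have "\<dots> \<longleftrightarrow> ?v = x" using True by (simp add: coord_append) (simp add: coord_def)
    finally show ?thesis by (simp add: in_support_def)
  qed
  have s0: "in_support (al, nu) m \<longleftrightarrow> tail (length al) m = mset nu"
    using True by (simp add: in_support_def)
  have t: "tail (length al) m = (if ?v = 0 then tail ?n m else add_mset ?v (tail ?n m))"
  proof -
    have e: "{length al<..} = insert ?n {?n<..}" by auto
    show ?thesis unfolding tail_def e Int_insert_right by (simp add: in_keys_iff)
  qed
  show ?thesis
  proof (cases "?v = 0")
    case True
    then have "(\<Sum>c\<in>set nu. m_as (al @ [c], remove1 c nu) m) = 0"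
      using assms by (intro sum.neutral) (auto simp: m_as_eq s simp del: m_as.simps)
    then show ?thesis using True unfolding m_as_eq s s0 t by simp
  next
    case False
    have "(\<Sum>c\<in>set nu. m_as (al @ [c], remove1 c nu) m) =
        (\<Sum>c\<in>set nu. if c = ?v then (if tail ?n m = mset nu - {#?v#} then 1 else 0) else 0)"
      unfolding m_as_eq s by (intro sum.cong) auto
    also have "\<dots> = (if ?v \<in> set nu \<and> tail ?n m = mset nu - {#?v#} then 1 else 0)" by simp
    also have "?v \<in> set nu \<and> tail ?n m = mset nu - {#?v#} \<longleftrightarrow> add_mset ?v (tail ?n m) = mset nu"
    proof (cases "?v \<in># mset nu")
      case True
      then obtain N where "mset nu = add_mset ?v N" by (metis multi_member_split)
      moreover have "?v \<in> set nu" using True by simp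
      ultimately show ?thesis by auto
    next
      case False
      then have "add_mset ?v (tail ?n m) \<noteq> mset nu" by (metis union_single_eq_member)
      then show ?thesis using False by simp
    qed
    also have "(if add_mset ?v (tail ?n m) = mset nu then 1 else 0) = m_as (al, nu) m"
      unfolding m_as_eq s0 t using False by simp
    finally show ?thesis using False unfolding m_as_eq s by simp
  qed
qed

lemma coord_list_update: "coord (xs[p := a]) r = (if r = Suc p \<and> p < length xs then a else coord xs r)"
  by (auto simp: coord_def nth_list_update)

lemma lower_move_left:
  assumes "0 < c" "length (be @ [0] @ M @ [c] @ N) \<le> k"
  shows "lower k (vec_of (be @ [c] @ M @ [0] @ N)) (vec_of (be @ [0] @ M @ [c] @ N))"
proof -
  let ?p = "length be" and ?q = "Suc (length be + length M)"
  define b where "b = be @ [0] @ M @ [0] @ N"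
  have u: "be @ [x] @ M @ [y] @ N = b[?p := x, ?q := y]" for x y
    using list_update_length[of be 0 "M @ [0] @ N" x] list_update_length[of "be @ [x] @ M" 0 N y]
    by (simp add: b_def)
  have l: "?p < length b" "?q < length b" by (simp_all add: b_def)
  have co: "vec_of (be @ [x] @ M @ [y] @ N) r =
      (if r = Suc ?q then int y else if r = Suc ?p then int x else vec_of b r)" for x y r
    unfolding u vec_of_def coord_list_update using l by simp
  show ?thesis
    by (rule lowerI[of "Suc ?p" "Suc ?q" k "int c" 0]) (use assms in \<open>simp_all only: co, simp_all\<close>)
qed

text \<open>Removing a trailing zero produces, besides the function without it, functions in which a part
  \<open>c\<close> of the partition has moved to the place of the zero.  These are strictly smaller, hence also
  different from the leading term: exchanging \<open>0\<close> and \<open>c\<close> goes down, and sorting the rest does not go up.\<close>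

lemma m_as_in_span:
  fixes lam mu
  defines "B \<equiv> m_as ` {p \<in> Lambda_as. as_less p (lam, mu)}"
  assumes k: "k \<ge> 2" "length (lam @ mu) \<le> k"
    and "length al \<le> length lam" "is_partition nu" "length lam + length nu \<le> k"
    and "lek k (vec_of (al @ replicate (length lam - length al) 0 @ nu)) (vec_of (lam @ mu))"
    and "(al, nu) \<noteq> (lam, mu)"
  shows "m_as (al, nu) \<in> K_span B"
  using assms(4-)
proof (induction al rule: rev_induct)
  have strict: "m_as (al, nu) \<in> B"
    if "strict_comp al" "length al \<le> length lam" "is_partition nu" "length lam + length nu \<le> k"
      "lek k (vec_of (al @ replicate (length lam - length al) 0 @ nu)) (vec_of (lam @ mu))"
      "(al, nu) \<noteq> (lam, mu)" for al nu
  proof -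
    have "comp_le (al @ replicate (length lam - length al) 0 @ nu) (lam @ mu)"
      unfolding comp_le_def using lek_vec_le[OF k(1) that(5)] k that(2,4)
      by (intro exI[of _ k]) auto
    then have "as_less (al, nu) (lam, mu)" using that by (simp add: as_less_def)
    then show ?thesis unfolding B_def using that by (auto simp: Lambda_as_def simp del: m_as.simps)
  qed
  {
    case Nil
    then show ?case using strict[of "[]" nu] by (intro K_span_base) (auto simp: strict_comp_def)
  next
    case (snoc z be)
    show ?case
    proof (cases "z = 0")
      case False
      then show ?thesis using strict[of "be @ [z]" nu] snoc.prems by (intro K_span_base) (auto simp: strict_comp_def)
    next
      case True
      let ?r = "length lam - Suc (length be)"
      let ?xs = "be @ [0] @ replicate ?r 0 @ nu"
      have rep: "replicate (length lam - length be) (0::nat) = 0 # replicate ?r 0"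
        using snoc.prems(1) by (simp add: Suc_diff_Suc flip: replicate_Suc)
      have xs: "lek k (vec_of ?xs) (vec_of (lam @ mu))" using snoc.prems(4) True by simp
      have nu0: "0 \<notin> set nu" using snoc.prems(2) by (simp add: is_partition_def)
      have "m_as (be, nu) \<in> K_span B"
        by (rule snoc.IH) (use snoc.prems xs rep in auto)
      moreover have "m_as (be @ [c], remove1 c nu) \<in> K_span B" if c: "c \<in> set nu" for c
      proof -
        obtain nu1 nu2 where nu: "nu = nu1 @ c # nu2" "c \<notin> set nu1" using split_list_first[OF c] by blast
        have c0: "0 < c" using c nu0 by (cases "c = 0") auto
        have re: "remove1 c nu = nu1 @ nu2" using nu by (simp add: remove1_append)
        have "is_partition (nu1 @ nu2)"
          using snoc.prems(2) unfolding nu(1) by (auto simp: is_partition_def sorted_wrt_append)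
        then have part: "is_partition (remove1 c nu)" unfolding re .
        let ?ys = "(be @ [c] @ replicate ?r 0) @ (nu1 @ [0] @ nu2)"
        let ?zs = "(be @ [c] @ replicate ?r 0) @ remove1 c nu"
        have len: "length (be @ [c] @ replicate ?r 0) = length lam" using snoc.prems(1) by simp
        have ylen: "length ?ys \<le> k" using len snoc.prems(3) nu(1) by simp
        have low: "lower k (vec_of ?ys) (vec_of ?xs)"
          using lower_move_left[of c be "replicate ?r 0 @ nu1" nu2 k] c0 ylen nu(1) by simp
        have "in_support (be @ [c] @ replicate ?r 0, remove1 c nu) (mon_of ?ys)"
          unfolding re using nu0 nu(1) by (intro in_support_mon_of) (simp add: filter_mset_positive)
        then have "(sorting_step (length lam) k)\<^sup>*\<^sup>* (mon_of ?ys) (mon_of ?zs)"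
          using sorting_terminates[OF _ part keys_mon_of[OF ylen]] len by metis
        then have z: "lek k (vec_of ?zs) (vec_of ?ys)" unfolding vec_of_mon_of by (rule sorting_lek)
        have "pot_less k (vec_of ?ys) (vec_of (lam @ mu))" using lower_lek_pot[OF low xs] .
        then have pot: "pot_less k (vec_of ?zs) (vec_of (lam @ mu))"
          using lek_pot[OF z] pot_less_trans by auto
        have "lek k (vec_of ?zs) (vec_of (lam @ mu))"
          using z low xs by (meson converse_rtranclp_into_rtranclp rtranclp_trans)
        moreover have "(be @ [c], remove1 c nu) \<noteq> (lam, mu)"
        proof
          assume e: "(be @ [c], remove1 c nu) = (lam, mu)"
          then have "?r = 0" by auto
          then have "?zs = lam @ mu" using e by auto
          then show False using pot pot_less_irrefl by metis
        qed
        moreover have "length lam + length (remove1 c nu) \<le> k"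
          unfolding re using snoc.prems(3) nu(1) by simp
        ultimately show ?thesis
          using strict[of "be @ [c]" "remove1 c nu"] part snoc.prems(1) c0
          by (intro K_span_base) (simp add: strict_comp_def del: m_as.simps)
      qed
      ultimately have "(\<lambda>m. 1 * m_as (be, nu) m + - 1 * (\<Sum>c\<in>set nu. 1 * m_as (be @ [c], remove1 c nu) m)) \<in> K_span B"
        by (intro K_span_scale_add K_span_sum)
      moreover have "m_as (be @ [z], nu) =
          (\<lambda>m. 1 * m_as (be, nu) m + - 1 * (\<Sum>c\<in>set nu. 1 * m_as (be @ [c], remove1 c nu) m))"
        using m_as_append_zero[OF nu0, of be] True by (simp add: fun_eq_iff del: m_as.simps)
      ultimately show ?thesis by simp
    qed
  }
qed

theorem theorem2:
  fixes lam mu :: "nat list" and i :: nat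
  assumes "(lam, mu) \<in> Lambda_as" and "i \<ge> 1"
  shows "\<exists>R \<in> K_span (m_as ` {p \<in> Lambda_as. as_less p (lam, mu)}).
    Y_op i (m_as (lam, mu)) =
      (\<lambda>x. delta i lam * qK ^ coord lam i * tK ^ u_stat (lam @ mu) i * m_as (lam, mu) x + R x)"
proof -
  let ?F = "m_as (lam, mu)" and ?L = "length lam" and ?d = "sum_list lam + sum_list mu"
  let ?B = "m_as ` {p \<in> Lambda_as. as_less p (lam, mu)}"
  let ?f = "\<lambda>k. Y_fin i k (Proj k ?F)"
  let ?lead = "delta i lam * qK ^ coord lam i * tK ^ u_stat (lam @ mu) i"
  have mu: "is_partition mu" using assms(1) by (simp add: Lambda_as_def)
  have F: "?F \<in> P_sym ?L" by (rule m_as_P_sym)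
  then have Fi: "?F \<in> P_inf" by (simp add: P_sym_def)
  show ?thesis
  proof (cases "i \<le> ?L")
    \<comment> \<open>For \<open>i\<close> beyond the length all coefficients tend to zero and the leading term is absent.\<close>
    case False
    then have "K_converges (\<lambda>k. lookup (?f k) m) 0" for m
      using Y_fin_converges(2)[OF F assms(2)] by simp
    then have "Y_op i ?F = (\<lambda>m. 0)"
      using Y_op_expansion[OF mu assms(2), of lam "\<lambda>m. 0"] by (simp del: m_as.simps)
    then show ?thesis using False K_span_zero[of ?B]
      by (intro bexI[of _ "\<lambda>m. 0"]) (simp_all add: delta_def del: m_as.simps)
  next
    case True
    obtain c where c: "\<And>m. K_converges (\<lambda>k. lookup (?f k) m) (c m)"
      using Y_fin_converges(1)[OF F assms(2)] by blast
    have Y: "Y_op i ?F = (\<lambda>m. \<Sum>p\<in>indices ?L ?d. c (mon_of (fst p @ snd p)) * m_as p m)"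
      using Y_op_expansion[OF mu assms(2) c] True by (simp add: max_absorb2 del: m_as.simps)
    have lead: "c (mon_of (lam @ mu)) = ?lead"
    proof (rule K_converges_unique[OF c])
      have "lookup (?f k) (mon_of (lam @ mu)) = ?lead" if k: "length (lam @ mu) \<le> k" for k
      proof -
        have ik: "i \<le> k" using True k by simp
        let ?e = "coord (lam @ mu)"
        obtain n where n: "keys n \<subseteq> {1..k}" "in_support (lam, mu) n"
          "Y_ser i k ?F n = leading_coeff i k n"
          using Y_ser_m_as(2)[OF mu k assms(2) ik] by blast
        have st: "(sorting_step ?L k)\<^sup>*\<^sup>* n (mon_of (lam @ mu))"
          by (rule sorting_terminates[OF n(2) mu n(1)])
        have "lookup (?f k) (mon_of (lam @ mu)) = lookup (?f k) n"
          by (rule sorting_coefficient[OF st], rule s_pol_Y_fin)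
            (use assms(2) True Proj_Pol[OF Fi] s_pol_Proj[OF F] in auto)
        also have "\<dots> = tK * Y_ser i k ?F n" by (rule lookup_Y_fin_Proj[OF assms(2) ik Fi])
        also have "\<dots> = ?lead"
        proof -
          have e: "lookup n r = ?e r" if "r \<le> ?L" for r
            using n(2) that by (simp add: in_support_def coord_append)
          have ei: "?e i = coord lam i" using True by (simp add: coord_append)
          have B: "{r \<in> {1..<i}. lookup n i < lookup n r} = {r \<in> {1..<i}. ?e i < ?e r}"
            using e True by auto
          have A: "card {r \<in> {i<..k}. lookup n i \<le> lookup n r} =
              card {r \<in> {i<..k}. ?e i \<le> ?e r}"
            using sorting_card[OF st True, of "?e i"] e[OF True] by simp
          show ?thesis
          proof (cases "0 < ?e i")
            case pos: True
            have "u_stat (lam @ mu) i = Suc (card {r \<in> {1..<i}. ?e i < ?e r} + card {r \<in> {i<..k}. ?e i \<le> ?e r})"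
              by (rule u_stat_eq) (use assms(2) True k pos in auto)
            then show ?thesis
              unfolding n(3) leading_coeff_def A B using pos ei True by (simp add: e[OF True] delta_def power_add)
          next
            case False
            then show ?thesis unfolding n(3) leading_coeff_def using ei by (simp add: e[OF True] delta_def)
          qed
        qed
        finally show ?thesis .
      qed
      then show "K_converges (\<lambda>k. lookup (?f k) (mon_of (lam @ mu))) ?lead"
        by (intro K_converges_cong_ge[OF K_converges_const]) (rule sym)
    qed
    have span: "m_as p \<in> K_span ?B"
      if p: "p \<in> indices ?L ?d - {(lam, mu)}" and nz: "c (mon_of (fst p @ snd p)) \<noteq> 0" for p
    proof -
      obtain al nu where an: "p = (al, nu)" "length al = ?L" "is_partition nu"
        using p by (auto simp: indices_def)
      \<comment> \<open>Any large \<open>k\<close> witnesses the comparison; the affine group is non-trivial from \<open>k = 2\<close> on.\<close>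
      let ?K = "2 + i + length (lam @ mu) + length (al @ nu)" and ?m = "mon_of (al @ nu)"
      have "\<exists>k\<ge>?K. lookup (?f k) ?m \<noteq> 0"
      proof (rule ccontr)
        assume "\<not> ?thesis"
        then have "K_converges (\<lambda>k. lookup (?f k) ?m) 0"
          by (intro K_converges_cong_ge[OF K_converges_const, of ?K]) auto
        then show False using K_converges_unique[OF c] nz an(1) by simp
      qed
      then obtain k where k: "?K \<le> k" "lookup (?f k) ?m \<noteq> 0" by blast
      then have kk: "i \<le> k" "length (lam @ mu) \<le> k" "length (al @ nu) \<le> k" "2 \<le> k" by auto
      have "Y_ser i k ?F ?m \<noteq> 0" using k(2) lookup_Y_fin_Proj[OF assms(2) kk(1) Fi, of ?m] by auto
      then obtain n where n: "keys n \<subseteq> {1..k}" "in_support (lam, mu) n" "lek k (vec_mon ?m) (vec_mon n)"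
        using Y_ser_m_as(1)[OF mu kk(2) assms(2) kk(1) keys_mon_of[OF kk(3)]] by blast
      have "lek k (vec_mon ?m) (vec_mon (mon_of (lam @ mu)))"
      proof (rule lek_sorting[OF sorting_terminates[OF n(2) mu n(1)] n(3)])
        fix j assume j: "?L < j" "j < k"
        have "coord (al @ nu) (Suc j) \<le> coord (al @ nu) j"
          using j an(2,3) by (auto simp: coord_def nth_append is_partition_def sorted_wrt_iff_nth_less)
        then show "vec_mon ?m (Suc j) \<le> vec_mon ?m j" by (simp add: vec_mon_def)
      qed
      then show ?thesis
        unfolding an(1) using an p kk by (intro m_as_in_span[of k]) (auto simp: vec_of_mon_of simp del: m_as.simps)
    qed
    define R where "R = (\<lambda>m. \<Sum>p\<in>indices ?L ?d - {(lam, mu)}. c (mon_of (fst p @ snd p)) * m_as p m)"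
    have "R \<in> K_span ?B" unfolding R_def by (rule K_span_sum) (rule span)
    moreover have "(lam, mu) \<in> indices ?L ?d" using mu by (simp add: indices_def)
    then have "Y_op i ?F = (\<lambda>x. ?lead * m_as (lam, mu) x + R x)"
      unfolding Y R_def lead[symmetric] by (simp add: sum.remove[OF finite_indices] del: m_as.simps)
    ultimately show ?thesis by blast
  qed
qed

end
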